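(* For $n=4$, the second minimum distance of the Fermat function field lattice $\Lambda_4$ is $d_2(\Lambda_4)=\sqrt{n^2-n}=\sqrt{12}$.
   Context: Let $n\geqslant 4$ (here $n=4$). $\mathcal F_n$ is the Fermat curve $X^n+Y^n=Z^n$ over $\mathbb C$ (a non-singular plane curve), and $F_n=\mathbb C(x,y)$ with $x^n+y^n=1$ is its function field ($x=X/Z$, $y=Y/Z$). Let $\zeta$ be a primitive $n$-th root of unity and $\varepsilon$ a primitive $n$-th root of $-1$. The set $\mathcal P$ consists of the $3n$ points of $\mathcal F_n$ having exactly one zero coordinate: $a_j=(0:\zeta^j:1)$, $b_j=(\zeta^j:0:1)$, $c_j=(\varepsilon\zeta^j:1:0)$, $j=0,\dots,n-1$; points of $\mathcal F_n$ are identified with places of $F_n$. Let $\mathcal O_{\mathcal P}^*$ be the multiplicative group of those $z\in F_n^*$ all of whose zeros and poles lie in $\mathcal P$. The lattice $\Lambda_n\subset\mathbb R^{3n}$ is the image of the homomorphism $\mathcal O_{\mathcal P}^*\to\mathbb Z^{3n}$, $z\mapsto (v_P(z))_{P\in\mathcal P}$, where $v_P$ is the discrete valuation at $P$. The minimum distance is $d(\Lambda)=\min_{0\neq v\in\Lambda}\|v\|$ (Euclidean norm), and the second minimum distance $d_2(\Lambda)$ is the smallest norm of a lattice vector that is strictly larger than $d(\Lambda)$ (no linear independence from the shortest vectors is required). *)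

theory Defs
  imports "HOL-Analysis.Analysis" "HOL-Computational_Algebra.Computational_Algebra"
begin

text \<open>
  A primitive \<open>n\<close>-th root of \<open>c\<close>: no smaller positive power equals \<open>c\<close>. It is used for \<open>c = 1\<close>,
  where \<open>z\<close> has multiplicative order \<open>n\<close>, and for \<open>c = -1\<close>, where it has order \<open>2 n\<close>.
\<close>
definition primitive_root_of :: "nat \<Rightarrow> complex \<Rightarrow> complex \<Rightarrow> bool" where
  "primitive_root_of n c z \<longleftrightarrow> z ^ n = c \<and> (\<forall>k. 0 < k \<and> k < n \<longrightarrow> z ^ k \<noteq> c)"

text \<open>Points of the projective plane are given by homogeneous coordinates.\<close>

type_synonym coords = "complex \<times> complex \<times> complex"

definition same_point :: "coords \<Rightarrow> coords \<Rightarrow> bool" where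
  "same_point P Q \<longleftrightarrow> (case (P, Q) of ((a, b, c), (a', b', c')) \<Rightarrow>
     (\<exists>l. l \<noteq> 0 \<and> a' = l * a \<and> b' = l * b \<and> c' = l * c))"

text \<open>The value at \<open>(X, Y, Z)\<close> of the form of degree \<open>d\<close> with coefficients \<open>c i j\<close>.
  For \<open>Z = 1\<close> this is the value at \<open>(X, Y)\<close> of an arbitrary polynomial of total degree at most \<open>d\<close>.\<close>
definition form :: "nat \<Rightarrow> (nat \<Rightarrow> nat \<Rightarrow> 'a) \<Rightarrow> 'a \<Rightarrow> 'a \<Rightarrow> 'a \<Rightarrow> 'a::comm_semiring_1" where
  "form d c X Y Z = (\<Sum>i\<le>d. \<Sum>j\<le>d - i. c i j * X ^ i * Y ^ j * Z ^ (d - i - j))"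

definition fermat_points :: "nat \<Rightarrow> coords set" where
  "fermat_points n = {(a, b, c). (a, b, c) \<noteq> (0, 0, 0) \<and> a ^ n + b ^ n = c ^ n}"

text \<open>
  The field \<open>\<complex>(x, y)\<close> with \<open>x ^ n + y ^ n = 1\<close> is presented inside an arbitrary ambient field, with
  \<open>emb\<close> the inclusion of the constants. Transcendence of \<open>x\<close> determines it up to isomorphism over
  \<open>\<complex>\<close>, since \<open>Y ^ n + X ^ n - 1\<close> is irreducible over \<open>\<complex>(X)\<close>.
\<close>
locale fermat_function_field =
  fixes n :: nat
    and emb :: "complex \<Rightarrow> 'f::field"
    and x y :: 'f
    and \<zeta> \<epsilon> :: complex
  assumes n_ge_4: "n \<ge> 4"
    and emb_1: "emb 1 = 1"
    and emb_add: "emb (a + b) = emb a + emb b"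
    and emb_mult: "emb (a * b) = emb a * emb b"
    and x_transcendental: "p \<noteq> 0 \<Longrightarrow> poly (map_poly emb p) x \<noteq> 0"
    and fermat_equation: "x ^ n + y ^ n = 1"
    and zeta: "primitive_root_of n 1 \<zeta>"
    and epsilon: "primitive_root_of n (-1) \<epsilon>"
begin

definition form_xy :: "nat \<Rightarrow> (nat \<Rightarrow> nat \<Rightarrow> complex) \<Rightarrow> 'f" where
  "form_xy d c = form d (\<lambda>i j. emb (c i j)) x y 1"

text \<open>The subfield \<open>F\<^sub>n = \<complex>(x, y)\<close>.\<close>
definition function_field :: "'f set" where
  "function_field = {form_xy d f / form_xy d g | d f g. form_xy d g \<noteq> 0}"

text \<open>
  The valuation ring of the place belonging to a point \<open>(a : b : c)\<close> of the (non-singular) Fermat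
  curve: quotients of forms of equal degree in \<open>X, Y, Z\<close>, where \<open>x = X / Z\<close> and \<open>y = Y / Z\<close>,
  whose denominator does not vanish at the point.
\<close>
definition local_ring :: "coords \<Rightarrow> 'f set" where
  "local_ring P = (case P of (a, b, c) \<Rightarrow>
     {form_xy d f / form_xy d g | d f g. form d g a b c \<noteq> 0})"

definition local_units :: "coords \<Rightarrow> 'f set" where
  "local_units P = {u \<in> local_ring P. u \<noteq> 0 \<and> inverse u \<in> local_ring P}"

text \<open>A generator of the maximal ideal, i.e. of the ideal of non-units.\<close>
definition uniformizer :: "coords \<Rightarrow> 'f \<Rightarrow> bool" where
  "uniformizer P t \<longleftrightarrow> t \<noteq> 0 \<and> local_ring P - local_units P = (\<lambda>w. t * w) ` local_ring P"

text \<open>Meaningful for nonzero elements of \<^term>\<open>function_field\<close> and points of the curve.\<close>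
definition valuation :: "coords \<Rightarrow> 'f \<Rightarrow> int" where
  "valuation P z = (THE k. \<exists>t u. uniformizer P t \<and> u \<in> local_units P \<and> z = t powi k * u)"

text \<open>The points \<open>a\<^sub>j\<close>, \<open>b\<^sub>j\<close>, \<open>c\<^sub>j\<close>, each represented by one fixed triple of coordinates.\<close>
definition cusps :: "coords set" where
  "cusps = (\<lambda>j. (0, \<zeta> ^ j, 1)) ` {..<n} \<union> (\<lambda>j. (\<zeta> ^ j, 0, 1)) ` {..<n}
         \<union> (\<lambda>j. (\<epsilon> * \<zeta> ^ j, 1, 0)) ` {..<n}"

definition cusp_units :: "'f set" where
  "cusp_units = {z \<in> function_field. z \<noteq> 0 \<and>
     (\<forall>Q \<in> fermat_points n. valuation Q z \<noteq> 0 \<longrightarrow> (\<exists>P \<in> cusps. same_point P Q))}"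

text \<open>
  Vectors of \<open>\<real>\<^sup>3\<^sup>n\<close> have their coordinates indexed by \<^term>\<open>cusps\<close>; they are functions that
  vanish off that set.
\<close>
definition lattice :: "(coords \<Rightarrow> real) set" where
  "lattice = (\<lambda>z P. if P \<in> cusps then real_of_int (valuation P z) else 0) ` cusp_units"

end

text \<open>
  In the following, \<open>I\<close> is the finite set of coordinates, so that \<open>L2_set v I\<close> is the Euclidean
  norm. \<open>LEAST\<close> is only meaningful if the minimum is attained.
\<close>

definition min_distance :: "'i set \<Rightarrow> ('i \<Rightarrow> real) set \<Rightarrow> real" where
  "min_distance I L = (LEAST r. \<exists>v \<in> L. v \<noteq> (\<lambda>_. 0) \<and> r = L2_set v I)"

definition second_min_distance :: "'i set \<Rightarrow> ('i \<Rightarrow> real) set \<Rightarrow> real" where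
  "second_min_distance I L = (LEAST r. \<exists>v \<in> L. r = L2_set v I \<and> r > min_distance I L)"

context fermat_function_field
begin

lemma zeta_nz: "\<zeta> \<noteq> 0" and epsilon_nz: "\<epsilon> \<noteq> 0"
  using zeta epsilon n_ge_4 by (auto simp: primitive_root_of_def power_0_left)

lemma root_powers_inj: "inj_on (\<lambda>j. \<zeta> ^ j) {..<n}"
proof (rule linorder_inj_onI)
  fix i j assume ij: "i < j" "i \<in> {..<n}" "j \<in> {..<n}"
  show "\<zeta> ^ i \<noteq> \<zeta> ^ j"
  proof
    assume eq: "\<zeta> ^ i = \<zeta> ^ j"
    have "\<zeta> ^ j = \<zeta> ^ i * \<zeta> ^ (j - i)"
      using ij by (simp flip: power_add)
    with eq zeta_nz have "\<zeta> ^ (j - i) = 1"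
      by simp
    with zeta ij show False
      by (auto simp: primitive_root_of_def)
  qed
qed auto

lemma card_cusps: "card cusps = 3 * n"
proof -
  let ?A = "(\<lambda>j. (0, \<zeta> ^ j, 1)) ` {..<n} :: coords set"
  let ?B = "(\<lambda>j. (\<zeta> ^ j, 0, 1)) ` {..<n} :: coords set"
  let ?C = "(\<lambda>j. (\<epsilon> * \<zeta> ^ j, 1, 0)) ` {..<n} :: coords set"
  have "inj_on (\<lambda>j. (0::complex, \<zeta> ^ j, 1::complex)) {..<n}"
    using root_powers_inj unfolding inj_on_def by blast
  then have "card ?A = n"
    by (simp only: card_image card_lessThan)
  moreover have "inj_on (\<lambda>j. (\<zeta> ^ j, 0::complex, 1::complex)) {..<n}"
    using root_powers_inj unfolding inj_on_def by blast
  then have "card ?B = n"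
    by (simp only: card_image card_lessThan)
  moreover have "inj_on (\<lambda>j. (\<epsilon> * \<zeta> ^ j, 1::complex, 0::complex)) {..<n}"
    using root_powers_inj epsilon_nz unfolding inj_on_def prod.inject mult_cancel_left by blast
  then have "card ?C = n"
    by (simp only: card_image card_lessThan)
  moreover have "(0, \<zeta> ^ i, 1) \<noteq> (\<zeta> ^ j, 0, 1 :: complex)" for i j
    using zeta_nz by simp
  then have "?A \<inter> ?B = {}"
    by blast
  moreover have "(?A \<union> ?B) \<inter> ?C = {}"
    by (auto simp only: prod.inject zero_neq_one one_neq_zero)
  ultimately have "card (?A \<union> ?B) = 2 * n" "card (?A \<union> ?B \<union> ?C) = card (?A \<union> ?B) + n"
    by (simp_all only: card_Un_disjoint finite_Un finite_imageI finite_lessThan simp_thms mult_2)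
  then show ?thesis
    unfolding cusps_def by simp
qed

end

text \<open>The locale is inhabited: take \<open>y = (1 - x ^ n) powr (1/n)\<close> as a Laurent series in \<open>x\<close>.\<close>

lemma fermat_function_field_exists:
  assumes n: "n \<ge> 4"
    and "primitive_root_of n 1 \<zeta>" "primitive_root_of n (-1) \<epsilon>"
  shows "\<exists>y :: complex fls. fermat_function_field n fls_const fls_X y \<zeta> \<epsilon>"
proof -
  define g :: "complex fps" where "g = fps_radical (\<lambda>_ _. 1) n (1 - fps_X ^ n)"
  have "g ^ Suc (n - 1) = 1 - fps_X ^ n"
    unfolding g_def using n
    by (subst power_radical[of _ "\<lambda>_ _. 1" "n - 1", THEN iffD1, symmetric]) (auto simp: Suc_diff_1)
  then have g: "g ^ n = 1 - fps_X ^ n"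
    using n by simp
  have trans: "poly (map_poly fls_const p) fls_X = fps_to_fls (fps_of_poly p)" for p :: "complex poly"
    by (induction p) (simp_all add: map_poly_pCons fps_of_poly_pCons fls_times_fps_to_fls)
  have "fermat_function_field n fls_const fls_X (fps_to_fls g) \<zeta> \<epsilon>"
  proof
    show "poly (map_poly fls_const p) fls_X \<noteq> 0" if "p \<noteq> 0" for p :: "complex poly"
      using that by (simp add: trans)
    have "fls_X ^ n + fps_to_fls g ^ n = fps_to_fls (fps_X ^ n) + fps_to_fls (g ^ n)"
      by (simp only: fps_to_fls_power fps_X_to_fls)
    also have "\<dots> = fps_to_fls 1"
      by (simp only: g fps_to_fls_plus [symmetric]) simp
    finally show "fls_X ^ n + fps_to_fls g ^ n = 1"
      by simp
  qed (use assms in \<open>simp_all add: fls_plus_const\<close>)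
  then show ?thesis ..
qed

end

(* In the coordinates (X : Y : Z) with Z = \<epsilon> the curve is X^4 + Y^4 + Z^4 = 0. Let z have divisor v supported
   on the twelve cusps. The tangent at each cusp is a hyperflex, so z^4 is, up to a constant, the product of
   the tangent lines with exponents v, while the norm of z along Y -> iY is a product of the functions x - w.
   At a cusp with Y = 0, which is fixed by this automorphism, both must give compatible leading coefficients;
   this reciprocity law relates the parities of v on the class Y = 0 to the degrees of v on the other two classes.
   The laws for the three classes together force |v|^2 to be divisible by 4. Finally |v|^2 = 4 is impossible:
   then v would be invariant under an automorphism Y -> kY, k = -1 or k = i, up to permuting the coordinates, so
   that z is an eigenvector and k^(v_P) does not depend on the cusp P of the fixed class, contrary to the shape
   of v. The values 8 and 12 are attained by x and by x / (y - w). *)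

theory Submission
  imports Defs
begin

section \<open>Forms and their values\<close>

text \<open>With Z = \<epsilon> the equation is symmetric, so each law is proved once, for the class
  Y = 0, and carried to the other classes by permuting coordinates. At a cusp P with Y = 0 all
  conjugates of z have the same order v_P, so z^4 and the norm of z both have order 4 v_P and their
  quotient is a unit. Conjugation multiplies the uniformizer Y/Z by 1, i, -1, -i, whose product is
  -1: the norm picks up (-1)^(v_P), and this sign is all that the comparison retains of v_P. The
  functions z^4 and norm are known only up to constants, but these are shared by the four cusps of
  the class; hence the law is about differences of parities between cusps. The geometric input is
  that a function without zeros and poles is constant, which the norm reduces to roots of
  polynomials in x. The norm serves twice more: its injectivity makes values of functions at points
  well defined, and since a function divides its norm, it shows that every function has an order at
  every point.\<close>

locale complex_algebra =
  fixes emb :: "complex \<Rightarrow> 'f::field"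
  assumes emb_1 [simp]: "emb 1 = 1"
    and emb_add: "emb (a + b) = emb a + emb b"
    and emb_mult: "emb (a * b) = emb a * emb b"
begin

lemma emb_0 [simp]: "emb 0 = 0"
  by (metis add.right_neutral add_left_cancel emb_add)

lemma emb_minus: "emb (- a) = - emb a"
  using emb_add[of a "- a"] by (simp add: eq_neg_iff_add_eq_0 add.commute)

lemma emb_diff: "emb (a - b) = emb a - emb b"
  using emb_add[of a "- b"] by (simp add: emb_minus)

lemma emb_power: "emb (a ^ k) = emb a ^ k"
  by (induction k) (simp_all add: emb_mult)

lemma emb_inverse: "emb (inverse a) = inverse (emb a)"
proof (cases "a = 0")
  case False
  then have "emb a * emb (inverse a) = 1"
    by (simp flip: emb_mult)
  then show ?thesis
    by (simp add: inverse_unique)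
qed simp

lemma emb_divide: "emb (a / b) = emb a / emb b"
  by (simp add: field_class.field_divide_inverse emb_mult emb_inverse)

lemma emb_eq_0_iff [simp]: "emb a = 0 \<longleftrightarrow> a = 0"
proof
  assume "emb a = 0"
  then show "a = 0"
    using emb_mult[of a "inverse a"] by (cases "a = 0") auto
qed simp

definition peval :: "complex poly \<Rightarrow> 'f \<Rightarrow> 'f" where
  "peval p r = poly (map_poly emb p) r"

lemma peval_0 [simp]: "peval 0 r = 0"
  by (simp add: peval_def)

lemma peval_pCons [simp]: "peval (pCons a p) r = emb a + r * peval p r"
  by (simp add: peval_def map_poly_pCons)

lemma peval_add [simp]: "peval (p + q) r = peval p r + peval q r"
proof (induction p arbitrary: q)
  case (pCons a p)
  then show ?case
    by (cases q) (simp add: emb_add algebra_simps)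
qed simp

lemma peval_smult [simp]: "peval (smult a p) r = emb a * peval p r"
  by (induction p) (simp_all add: emb_mult algebra_simps)

lemma peval_mult [simp]: "peval (p * q) r = peval p r * peval q r"
  by (induction p) (simp_all add: algebra_simps)

lemma peval_1 [simp]: "peval 1 r = 1"
  by (simp add: one_pCons)

lemma peval_minus [simp]: "peval (- p) r = - peval p r"
  using peval_smult[of "-1" p r] by (simp add: emb_minus)

lemma peval_diff [simp]: "peval (p - q) r = peval p r - peval q r"
  using peval_add[of p "- q" r] by simp

lemma peval_power [simp]: "peval (p ^ k) r = peval p r ^ k"
  by (induction k) simp_all

text \<open>Over the algebraically closed constants a polynomial splits into linear factors, so an
  element that is not a constant is already transcendental.\<close>

lemma peval_nonzero:
  assumes "\<And>k. r \<noteq> emb k" "p \<noteq> 0"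
  shows "peval p r \<noteq> 0"
  using assms(2)
proof (induction "degree p" arbitrary: p rule: less_induct)
  case less
  show ?case
  proof (cases "\<exists>s. poly p s = 0")
    case True
    then obtain s q where q: "p = [:- s, 1:] * q"
      by (auto simp: poly_eq_0_iff_dvd dvd_def)
    with less.prems have "q \<noteq> 0" by auto
    moreover from this have "degree q < degree p"
      unfolding q by (subst degree_mult_eq) auto
    ultimately have "peval q r \<noteq> 0"
      using less.hyps by blast
    then show ?thesis
      using assms(1)[of s] by (simp add: q emb_minus algebra_simps)
  next
    case False
    then have "degree p = 0"
      using fundamental_theorem_of_algebra[of p] constant_degree by blast
    then obtain a where "p = [:a:]"
      by (rule degree_eq_zeroE)
    then show ?thesis
      using less.prems by simp
  qed
qed

end

text \<open>At a closed point the values are complex numbers, and the constants embed by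
  \<open>id\<close>.\<close>

interpretation complex_self: complex_algebra "id :: complex \<Rightarrow> complex"
  by unfold_locales simp_all

lemma complex_self_peval [simp]: "complex_self.peval p r = poly p r"
  by (simp only: complex_self.peval_def map_poly_id id_apply)

text \<open>
  The forms of degree \<open>d\<close> in three variables are recorded through their pairs of values
  \<open>(u, w)\<close> at the points \<open>(X : Y : Z)\<close> and \<open>(A : B : C)\<close>.
\<close>

inductive specializes for emb :: "complex \<Rightarrow> 'f::field" and X Y Z :: 'f
    and e :: "complex \<Rightarrow> 'g::field" and A B C :: 'g where
  const: "specializes emb X Y Z e A B C 0 (emb k) (e k)"
| add: "specializes emb X Y Z e A B C d u w \<Longrightarrow> specializes emb X Y Z e A B C d u' w'
    \<Longrightarrow> specializes emb X Y Z e A B C d (u + u') (w + w')"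
| mult_X: "specializes emb X Y Z e A B C d u w \<Longrightarrow> specializes emb X Y Z e A B C (Suc d) (X * u) (A * w)"
| mult_Y: "specializes emb X Y Z e A B C d u w \<Longrightarrow> specializes emb X Y Z e A B C (Suc d) (Y * u) (B * w)"
| mult_Z: "specializes emb X Y Z e A B C d u w \<Longrightarrow> specializes emb X Y Z e A B C (Suc d) (Z * u) (C * w)"

lemma specializes_flip:
  "specializes emb X Y Z e A B C d u w \<Longrightarrow> specializes e A B C emb X Y Z d w u"
  by (induction rule: specializes.induct) (auto intro: specializes.intros)

lemma specializes_swap13:
  "specializes emb X Y Z e A B C d u w \<Longrightarrow> specializes emb Z Y X e C B A d u w"
  by (induction rule: specializes.induct) (auto intro: specializes.intros)

lemma specializes_swap12:
  "specializes emb X Y Z e A B C d u w \<Longrightarrow> specializes emb Y X Z e B A C d u w"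
  by (induction rule: specializes.induct) (auto intro: specializes.intros)

text \<open>A derivation of \<open>specializes\<close> encodes the form itself, so it can be
  replayed at any other point.\<close>

lemma specializes_ex:
  "specializes emb X Y Z e A B C d u w \<Longrightarrow> \<exists>w'. specializes emb X Y Z e' A' B' C' d u w'"
  by (induction rule: specializes.induct) (blast intro: specializes.intros)+

lemma specializes_self: "specializes emb X Y Z emb X Y Z d u w \<Longrightarrow> u = w"
  by (induction rule: specializes.induct) auto

lemma specializes_power_Z:
  assumes "emb 1 = 1" "e 1 = 1"
  shows "specializes emb X Y Z e A B C d (Z ^ d) (C ^ d)"
proof (induction d)
  case 0
  then show ?case
    using specializes.const[of emb X Y Z e A B C 1] assms by simp
qed (use specializes.mult_Z in auto)

section \<open>Products of forms, and their normal form modulo the curve\<close>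

locale complex_algebra_pair = complex_algebra emb + target: complex_algebra e
  for emb :: "complex \<Rightarrow> 'f::field" and e :: "complex \<Rightarrow> 'g::field"
begin

lemma specializes_scale:
  "specializes emb X Y Z e A B C d u w \<Longrightarrow> specializes emb X Y Z e A B C d (emb k * u) (e k * w)"
proof (induction rule: specializes.induct)
  case (const l)
  then show ?case
    using specializes.const[of emb X Y Z e A B C "k * l"] by (simp add: emb_mult target.emb_mult)
next
  case (add d u w u' w')
  then show ?case
    by (simp add: distrib_left specializes.add)
next
  case (mult_X d u w)
  then show ?case
    using specializes.mult_X[OF mult_X.IH] by (simp add: mult_ac)
next
  case (mult_Y d u w)
  then show ?case
    using specializes.mult_Y[OF mult_Y.IH] by (simp add: mult_ac)
next
  case (mult_Z d u w)
  then show ?case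
    using specializes.mult_Z[OF mult_Z.IH] by (simp add: mult_ac)
qed

lemma specializes_diff:
  assumes "specializes emb X Y Z e A B C d u w" "specializes emb X Y Z e A B C d u' w'"
  shows "specializes emb X Y Z e A B C d (u - u') (w - w')"
  using specializes.add[OF assms(1) specializes_scale[OF assms(2), of "-1"]]
  by (simp add: emb_minus target.emb_minus)

lemma specializes_mult:
  assumes "specializes emb X Y Z e A B C d u w" "specializes emb X Y Z e A B C d' u' w'"
  shows "specializes emb X Y Z e A B C (d + d') (u * u') (w * w')"
  using assms(1)
proof (induction rule: specializes.induct)
  case (const k)
  then show ?case
    using specializes_scale[OF assms(2)] by simp
next
  case (add d u w v v')
  then show ?case
    by (simp add: distrib_right specializes.add)
qed (auto simp: mult.assoc intro: specializes.intros)

text \<open>Modulo the equation of the curve, each form is a polynomial of degree at most 3 in \<open>Y / Z\<close>.\<close>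

lemma specializes_normal_form:
  assumes eq: "X ^ 4 + Y ^ 4 + Z ^ 4 = 0" "A ^ 4 + B ^ 4 + C ^ 4 = 0" and nz: "Z \<noteq> 0" "C \<noteq> 0"
    and "specializes emb X Y Z e A B C d u w"
  shows "\<exists>p0 p1 p2 p3.
    u = Z ^ d * (peval p0 (X / Z) + peval p1 (X / Z) * (Y / Z)
          + peval p2 (X / Z) * (Y / Z) ^ 2 + peval p3 (X / Z) * (Y / Z) ^ 3) \<and>
    w = C ^ d * (target.peval p0 (A / C) + target.peval p1 (A / C) * (B / C)
          + target.peval p2 (A / C) * (B / C) ^ 2 + target.peval p3 (A / C) * (B / C) ^ 3)"
  using assms(5)
proof (induction rule: specializes.induct)
  case (const k)
  show ?case
    by (rule exI[of _ "[:k:]"], (rule exI[of _ 0])+) simp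
next
  case (add d u w u' w')
  then obtain p0 p1 p2 p3 q0 q1 q2 q3 where
    "u = Z ^ d * (peval p0 (X / Z) + peval p1 (X / Z) * (Y / Z)
          + peval p2 (X / Z) * (Y / Z) ^ 2 + peval p3 (X / Z) * (Y / Z) ^ 3)"
    "w = C ^ d * (target.peval p0 (A / C) + target.peval p1 (A / C) * (B / C)
          + target.peval p2 (A / C) * (B / C) ^ 2 + target.peval p3 (A / C) * (B / C) ^ 3)"
    "u' = Z ^ d * (peval q0 (X / Z) + peval q1 (X / Z) * (Y / Z)
          + peval q2 (X / Z) * (Y / Z) ^ 2 + peval q3 (X / Z) * (Y / Z) ^ 3)"
    "w' = C ^ d * (target.peval q0 (A / C) + target.peval q1 (A / C) * (B / C)
          + target.peval q2 (A / C) * (B / C) ^ 2 + target.peval q3 (A / C) * (B / C) ^ 3)"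
    by blast
  then show ?case
    by (intro exI[of _ "p0 + q0"] exI[of _ "p1 + q1"] exI[of _ "p2 + q2"] exI[of _ "p3 + q3"])
      (simp add: algebra_simps)
next
  case (mult_X d u w)
  then obtain p0 p1 p2 p3 where p:
    "u = Z ^ d * (peval p0 (X / Z) + peval p1 (X / Z) * (Y / Z)
          + peval p2 (X / Z) * (Y / Z) ^ 2 + peval p3 (X / Z) * (Y / Z) ^ 3)"
    "w = C ^ d * (target.peval p0 (A / C) + target.peval p1 (A / C) * (B / C)
          + target.peval p2 (A / C) * (B / C) ^ 2 + target.peval p3 (A / C) * (B / C) ^ 3)"
    by blast
  have *: "X * (Z ^ d * (r0 + r1 * y + r2 * y ^ 2 + r3 * y ^ 3)) =
      Z ^ Suc d * (X / Z * r0 + X / Z * r1 * y + X / Z * r2 * y ^ 2 + X / Z * r3 * y ^ 3)" for r0 r1 r2 r3 y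
    using nz by (simp add: field_simps)
  have **: "A * (C ^ d * (r0 + r1 * y + r2 * y ^ 2 + r3 * y ^ 3)) =
      C ^ Suc d * (A / C * r0 + A / C * r1 * y + A / C * r2 * y ^ 2 + A / C * r3 * y ^ 3)" for r0 r1 r2 r3 y
    using nz by (simp add: field_simps)
  show ?case
    unfolding p by (intro exI[of _ "pCons 0 p0"] exI[of _ "pCons 0 p1"] exI[of _ "pCons 0 p2"] exI[of _ "pCons 0 p3"])
      (simp only: * ** peval_pCons target.peval_pCons emb_0 target.emb_0 add_0_left simp_thms)
next
  case (mult_Y d u w)
  then obtain p0 p1 p2 p3 where p:
    "u = Z ^ d * (peval p0 (X / Z) + peval p1 (X / Z) * (Y / Z)
          + peval p2 (X / Z) * (Y / Z) ^ 2 + peval p3 (X / Z) * (Y / Z) ^ 3)"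
    "w = C ^ d * (target.peval p0 (A / C) + target.peval p1 (A / C) * (B / C)
          + target.peval p2 (A / C) * (B / C) ^ 2 + target.peval p3 (A / C) * (B / C) ^ 3)"
    by blast
  \<comment> \<open>Multiplication by Y turns the cubic term into \<open>p3\<close> y^4, which y^4 =
    -1 - x^4 sends back to the constant coefficient.\<close>
  define q where "q = p3 * (- 1 - [:0, 1:] ^ 4)"
  have "(Y / Z) ^ 4 = - 1 - (X / Z) ^ 4"
    using eq(1) nz(1) by (simp add: field_simps) (simp add: eq_neg_iff_add_eq_0 add_ac)
  then have q: "peval q (X / Z) = peval p3 (X / Z) * (Y / Z) ^ 4"
    by (simp add: q_def)
  have "(B / C) ^ 4 = - 1 - (A / C) ^ 4"
    using eq(2) nz(2) by (simp add: field_simps) (simp add: eq_neg_iff_add_eq_0 add_ac)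
  then have q': "target.peval q (A / C) = target.peval p3 (A / C) * (B / C) ^ 4"
    by (simp add: q_def)
  have *: "Y * (Z ^ d * (r0 + r1 * (Y / Z) + r2 * (Y / Z) ^ 2 + r3 * (Y / Z) ^ 3)) =
      Z ^ Suc d * (r3 * (Y / Z) ^ 4 + r0 * (Y / Z) + r1 * (Y / Z) ^ 2 + r2 * (Y / Z) ^ 3)" for r0 r1 r2 r3
    using nz by (simp add: field_simps eval_nat_numeral)
  have **: "B * (C ^ d * (r0 + r1 * (B / C) + r2 * (B / C) ^ 2 + r3 * (B / C) ^ 3)) =
      C ^ Suc d * (r3 * (B / C) ^ 4 + r0 * (B / C) + r1 * (B / C) ^ 2 + r2 * (B / C) ^ 3)" for r0 r1 r2 r3
    using nz by (simp add: field_simps eval_nat_numeral)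
  show ?case
    unfolding p by (intro exI[of _ q] exI[of _ p0] exI[of _ p1] exI[of _ p2])
      (simp only: * ** q q' simp_thms)
next
  case (mult_Z d u w)
  then obtain p0 p1 p2 p3 where p:
    "u = Z ^ d * (peval p0 (X / Z) + peval p1 (X / Z) * (Y / Z)
          + peval p2 (X / Z) * (Y / Z) ^ 2 + peval p3 (X / Z) * (Y / Z) ^ 3)"
    "w = C ^ d * (target.peval p0 (A / C) + target.peval p1 (A / C) * (B / C)
          + target.peval p2 (A / C) * (B / C) ^ 2 + target.peval p3 (A / C) * (B / C) ^ 3)"
    by blast
  show ?case
    unfolding p by (intro exI[of _ p0] exI[of _ p1] exI[of _ p2] exI[of _ p3])
      (simp only: power_Suc mult.assoc simp_thms)
qed

end

section \<open>Injectivity of the norm to \<complex>(x)\<close>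

text \<open>At a simple root of \<open>x ^ 4 + 1\<close> the orders of the two sides have different parity.\<close>

lemma square_eq_simple_mult_square:
  fixes a b :: "complex poly"
  assumes "a ^ 2 = - (1 + [:0, 1:] ^ 4) * b ^ 2"
  shows "a = 0 \<and> b = 0"
proof -
  define w :: "complex poly" where "w = - (1 + [:0, 1:] ^ 4)"
  have "\<exists>r::complex. r ^ 4 = - 1"
    by (metis nth_root_exists zero_less_numeral numeral_eq_Suc zero_less_Suc)
  then obtain r :: complex where r: "r ^ 4 = - 1" ..
  then have "r \<noteq> 0" by auto
  have w0: "w \<noteq> 0"
  proof
    assume "w = 0"
    then have "poly w 0 = 0" by simp
    then show False by (simp add: w_def)
  qed
  have "poly w r = 0"
    using r by (simp add: w_def)
  moreover have "poly (pderiv w) r \<noteq> 0"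
    using \<open>r \<noteq> 0\<close> by (simp add: w_def pderiv_minus pderiv_add pderiv_diff pderiv_power_Suc pderiv_pCons eval_nat_numeral)
  ultimately have ord: "order r w = 1"
    using w0 by (metis One_nat_def order_0I order_pderiv order_root pderiv_0 poly_0)
  show ?thesis
  proof (cases "b = 0")
    case True
    then show ?thesis using assms by simp
  next
    case False
    have eq: "a ^ 2 = w * b ^ 2"
      using assms by (simp add: w_def)
    with False w0 have a: "a \<noteq> 0" by auto
    have "order r (a ^ 2) = order r a + order r a"
      using a by (simp add: power2_eq_square order_mult)
    moreover have "order r (w * b ^ 2) = 1 + (order r b + order r b)"
      using False w0 by (simp add: power2_eq_square order_mult ord)
    ultimately have "order r a + order r a = 1 + (order r b + order r b)"
      using eq by simp
    then show ?thesis
      by presburger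
  qed
qed

text \<open>The norm of \<open>p\<^sub>0 + p\<^sub>1 y + p\<^sub>2 y\<^sup>2 + p\<^sub>3 y\<^sup>3\<close> along \<open>y \<mapsto> \<i> y\<close>, where \<open>y ^ 4 = - 1 - x ^ 4\<close>.\<close>

definition norm_poly :: "complex poly \<Rightarrow> complex poly \<Rightarrow> complex poly \<Rightarrow> complex poly \<Rightarrow> complex poly" where
  "norm_poly p0 p1 p2 p3 = (let w = - (1 + [:0, 1:] ^ 4) in
     (p0 ^ 2 + w * p2 ^ 2 - 2 * w * p1 * p3) ^ 2 - w * (2 * p0 * p2 - p1 ^ 2 - w * p3 ^ 2) ^ 2)"

text \<open>The norm passes through \<complex>(x, y^2) and has the shape a^2 - w b^2 with w = y^4.
  As w is not a square in \<complex>(x), both a and b vanish; eliminating between these two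
  equations gives once more a square equal to w times a square.\<close>

lemma norm_poly_eq_0D:
  assumes "norm_poly p0 p1 p2 p3 = 0"
  shows "p0 = 0 \<and> p1 = 0 \<and> p2 = 0 \<and> p3 = 0"
proof -
  define w :: "complex poly" where "w = - (1 + [:0, 1:] ^ 4)"
  note sq = square_eq_simple_mult_square[folded w_def]
  have "(p0 ^ 2 + w * p2 ^ 2 - 2 * w * p1 * p3) ^ 2 = w * (2 * p0 * p2 - p1 ^ 2 - w * p3 ^ 2) ^ 2"
    using assms unfolding norm_poly_def Let_def w_def[symmetric] by simp
  from sq[OF this] have e1: "p0 ^ 2 + w * p2 ^ 2 = 2 * w * p1 * p3"
    and e2: "2 * p0 * p2 = p1 ^ 2 + w * p3 ^ 2"
    by (simp_all add: algebra_simps)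
  have "(p0 ^ 2 - w * p2 ^ 2) ^ 2 = (p0 ^ 2 + w * p2 ^ 2) ^ 2 - w * (2 * p0 * p2) ^ 2"
    by (simp add: power2_eq_square algebra_simps)
  also have "\<dots> = - w * (p1 ^ 2 - w * p3 ^ 2) ^ 2"
    unfolding e1 e2 by (simp add: power2_eq_square algebra_simps)
  finally have *: "(p0 ^ 2 - w * p2 ^ 2) ^ 2 = - w * (p1 ^ 2 - w * p3 ^ 2) ^ 2" .
  \<comment> \<open>The sign is absorbed because -1 is the square of the constant i.\<close>
  have "([:\<i>:] * (p0 ^ 2 - w * p2 ^ 2)) ^ 2 = w * (p1 ^ 2 - w * p3 ^ 2) ^ 2"
    unfolding power_mult_distrib * by (simp add: power2_eq_square)
  from sq[OF this] have "p0 ^ 2 = w * p2 ^ 2" "p1 ^ 2 = w * p3 ^ 2"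
    by simp_all
  then show ?thesis
    using sq by blast
qed

section \<open>Places and conjugation\<close>

text \<open>The residue map at a point, as a relation: r is regular there with value g. The values
  may lie in any field, so that complex points, the generic point and the automorphisms of the
  function field are instances of one notion.\<close>

definition place :: "(complex \<Rightarrow> 'f::field) \<Rightarrow> 'f \<Rightarrow> 'f \<Rightarrow> 'f \<Rightarrow> (complex \<Rightarrow> 'g::field) \<Rightarrow> 'g \<Rightarrow> 'g \<Rightarrow> 'g
    \<Rightarrow> 'f \<Rightarrow> 'g \<Rightarrow> bool" where
  "place emb X Y Z e A B C r g \<longleftrightarrow> (\<exists>d u u' w w'. specializes emb X Y Z e A B C d u w
     \<and> specializes emb X Y Z e A B C d u' w' \<and> w' \<noteq> 0 \<and> r = u / u' \<and> g = w / w')"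

lemma place_swap13: "place emb X Y Z e A B C r g \<longleftrightarrow> place emb Z Y X e C B A r g"
  unfolding place_def by (blast dest: specializes_swap13)

lemma place_swap12: "place emb X Y Z e A B C r g \<longleftrightarrow> place emb Y X Z e B A C r g"
  unfolding place_def by (blast dest: specializes_swap12)

context complex_algebra
begin

definition nform :: "complex poly \<Rightarrow> complex poly \<Rightarrow> complex poly \<Rightarrow> complex poly \<Rightarrow> 'f \<Rightarrow> 'f \<Rightarrow> 'f" where
  "nform p0 p1 p2 p3 r s = peval p0 r + peval p1 r * s + peval p2 r * s ^ 2 + peval p3 r * s ^ 3"

text \<open>The product of the three conjugates of \<open>nform\<close> other than itself: s -> -s
  is the first factor, while s -> is and s -> -is together give the second. As a polynomial
  expression in r and s it is regular wherever they are.\<close>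

definition conorm :: "complex poly \<Rightarrow> complex poly \<Rightarrow> complex poly \<Rightarrow> complex poly \<Rightarrow> 'f \<Rightarrow> 'f \<Rightarrow> 'f" where
  "conorm p0 p1 p2 p3 r s = nform p0 p1 p2 p3 r (- s) *
     (let w = - (1 + [:0, 1:] ^ 4) in peval (p0 ^ 2 + w * p2 ^ 2 - 2 * w * p1 * p3) r
      - peval (2 * p0 * p2 - p1 ^ 2 - w * p3 ^ 2) r * s ^ 2)"

lemma peval_numeral [simp]: "peval (numeral k) r = numeral k"
proof -
  have "peval (of_nat k) r = of_nat k" for k
    by (induction k) simp_all
  from this[of "numeral k"] show ?thesis
    by simp
qed

lemma nform_mult_conorm:
  assumes "s ^ 4 = - 1 - r ^ 4"
  shows "nform p0 p1 p2 p3 r s * conorm p0 p1 p2 p3 r s = peval (norm_poly p0 p1 p2 p3) r"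
proof -
  define w where "w = s ^ 4"
  have w: "peval (- (1 + [:0, 1:] ^ 4)) r = w"
    using assms by (simp add: w_def)
  have alg: "(q0 + q1 * s + q2 * s ^ 2 + q3 * s ^ 3) * ((q0 + q1 * (- s) + q2 * (- s) ^ 2 + q3 * (- s) ^ 3) *
      (q0 ^ 2 + w * q2 ^ 2 - 2 * w * q1 * q3 - (2 * q0 * q2 - q1 ^ 2 - w * q3 ^ 2) * s ^ 2))
    = (q0 ^ 2 + w * q2 ^ 2 - 2 * w * q1 * q3) ^ 2 - w * (2 * q0 * q2 - q1 ^ 2 - w * q3 ^ 2) ^ 2" for q0 q1 q2 q3
    unfolding w_def by algebra
  show ?thesis
    unfolding nform_def conorm_def norm_poly_def Let_def
    by (simp only: peval_diff peval_add[of "_ ^ 2"] peval_mult peval_power w alg peval_numeral)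
qed

end

section \<open>The function field of the quartic X^4 + Y^4 + Z^4 = 0\<close>

locale quartic = complex_algebra emb for emb :: "complex \<Rightarrow> 'f::field" +
  fixes X Y Z :: 'f
  assumes quartic_eq: "X ^ 4 + Y ^ 4 + Z ^ 4 = 0"
    and Z_nonzero [simp]: "Z \<noteq> 0"
    and nonconstant: "X \<noteq> emb k * Z"
begin

lemma X_nonzero [simp]: "X \<noteq> 0"
  using nonconstant[of 0] by simp

lemma ratio_nonconstant: "X / Z \<noteq> emb k"
  using nonconstant[of k] by (simp add: field_simps)

lemma peval_ratio_nonzero: "p \<noteq> 0 \<Longrightarrow> peval p (X / Z) \<noteq> 0"
  using peval_nonzero ratio_nonconstant by blast

lemma affine_eq: "(Y / Z) ^ 4 = - 1 - (X / Z) ^ 4"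
  using quartic_eq by (simp add: field_simps) (simp add: eq_neg_iff_add_eq_0 add_ac)

text \<open>If Y/Z were constant, X/Z would be a root of a monic polynomial of degree 4 over the
  constants.\<close>

lemma second_nonconstant: "Y \<noteq> emb k * Z"
proof
  assume "Y = emb k * Z"
  then have "(Y / Z) ^ 4 = emb (k ^ 4)"
    by (simp add: emb_power)
  then have "peval ([:0, 1:] ^ 4 + [:k ^ 4 + 1:]) (X / Z) = 0"
    using affine_eq by (simp add: emb_add) (simp flip: \<open>(Y / Z) ^ 4 = emb (k ^ 4)\<close> add: affine_eq del: power_divide)
  moreover have "[:0, 1:] ^ 4 + [:k ^ 4 + 1:] \<noteq> 0"
  proof
    assume "[:0, 1:] ^ 4 + [:k ^ 4 + 1:] = 0"
    then have "coeff ([:0, 1:] ^ 4 + [:k ^ 4 + 1:]) 4 = 0"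
      by (simp only: coeff_0)
    then show False
      by (simp add: eval_nat_numeral)
  qed
  ultimately show False
    using peval_ratio_nonzero by blast
qed

lemma Y_nonzero [simp]: "Y \<noteq> 0"
  using second_nonconstant[of 0] by simp

lemma quartic_swap13: "quartic emb Z Y X"
proof
  show "Z \<noteq> emb k * X" for k
    using nonconstant[of "inverse k"] by (cases "k = 0") (auto simp: emb_inverse)
qed (use quartic_eq in \<open>simp_all add: add_ac\<close>)

lemma quartic_swap12: "quartic emb Y X Z"
  by unfold_locales (use quartic_eq second_nonconstant in \<open>simp_all add: add_ac\<close>)

lemma quartic_conj:
  assumes "k ^ 4 = 1"
  shows "quartic emb X (emb k * Y) Z"
  by unfold_locales (use quartic_eq nonconstant assms in \<open>simp_all add: power_mult_distrib flip: emb_power\<close>)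

text \<open>Linear independence of 1, y, y^2, y^3 over \<complex>[x], that is, y has degree 4 over
  \<complex>(x). An element that vanishes has norm 0, and the norm is injective in this
  sense.\<close>

lemma nform_eq_0D:
  assumes "nform p0 p1 p2 p3 (X / Z) (Y / Z) = 0"
  shows "p0 = 0 \<and> p1 = 0 \<and> p2 = 0 \<and> p3 = 0"
proof -
  have "peval (norm_poly p0 p1 p2 p3) (X / Z) = 0"
    using nform_mult_conorm[OF affine_eq, of p0 p1 p2 p3] assms by simp
  then show ?thesis
    using peval_ratio_nonzero norm_poly_eq_0D by blast
qed

end

lemma (in quartic) quartic_swap23: "quartic emb X Z Y"
proof -
  interpret a: quartic emb Y X Z by (rule quartic_swap12)
  interpret b: quartic emb Z X Y by (rule a.quartic_swap13)
  show ?thesis by (rule b.quartic_swap12)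
qed

section \<open>Values of functions at points of the quartic\<close>

locale quartic_point = quartic emb X Y Z + target: complex_algebra e
  for emb :: "complex \<Rightarrow> 'f::field" and X Y Z and e :: "complex \<Rightarrow> 'g::field" +
  fixes A B C :: 'g
  assumes point_eq: "A ^ 4 + B ^ 4 + C ^ 4 = 0"
    and point_nonzero: "A \<noteq> 0 \<or> B \<noteq> 0 \<or> C \<noteq> 0"
begin

sublocale complex_algebra_pair emb e ..

abbreviation "spec \<equiv> specializes emb X Y Z e A B C"
abbreviation "pl \<equiv> place emb X Y Z e A B C"

lemma quartic_point_swap13: "quartic_point emb Z Y X e C B A"
proof -
  interpret s: quartic emb Z Y X by (rule quartic_swap13)
  show ?thesis
    by unfold_locales (use point_eq point_nonzero in \<open>auto simp: add_ac\<close>)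
qed

lemma quartic_point_swap12: "quartic_point emb Y X Z e B A C"
proof -
  interpret s: quartic emb Y X Z by (rule quartic_swap12)
  show ?thesis
    by unfold_locales (use point_eq point_nonzero in \<open>auto simp: add_ac\<close>)
qed

lemma affine_point_eq: "C \<noteq> 0 \<Longrightarrow> (B / C) ^ 4 = - 1 - (A / C) ^ 4"
  using point_eq by (simp add: field_simps) (simp add: eq_neg_iff_add_eq_0 add_ac)

lemma specializes_nform:
  assumes "C \<noteq> 0" "spec d u w"
  shows "\<exists>p0 p1 p2 p3. u = Z ^ d * nform p0 p1 p2 p3 (X / Z) (Y / Z) \<and>
           w = C ^ d * target.nform p0 p1 p2 p3 (A / C) (B / C)"
  unfolding nform_def target.nform_def
  by (rule specializes_normal_form) (use quartic_eq point_eq assms in auto)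

lemma specializes_0_affine:
  assumes "C \<noteq> 0" "spec d 0 w"
  shows "w = 0"
proof -
  obtain p0 p1 p2 p3 where p: "0 = Z ^ d * nform p0 p1 p2 p3 (X / Z) (Y / Z)"
    "w = C ^ d * target.nform p0 p1 p2 p3 (A / C) (B / C)"
    using specializes_nform[OF assms] by blast
  from p(1) have "nform p0 p1 p2 p3 (X / Z) (Y / Z) = 0"
    by simp
  from nform_eq_0D[OF this] show ?thesis
    by (simp add: p(2) target.nform_def)
qed

end

context quartic_point
begin

text \<open>A form that is zero in the function field has a zero normal form, so it vanishes at
  every point off Z = 0. On Z = 0 the coordinate X is nonzero, and exchanging X with Z reduces to
  the first case. This is what makes values at points unique.\<close>

lemma specializes_0:
  assumes "spec d 0 w"
  shows "w = 0"
proof (cases "C = 0")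
  case True
  then have "A \<noteq> 0"
    using point_eq point_nonzero by auto
  moreover interpret s: quartic_point emb Z Y X e C B A
    by (rule quartic_point_swap13)
  show ?thesis
    using s.specializes_0_affine \<open>A \<noteq> 0\<close> specializes_swap13[OF assms] by blast
qed (use assms specializes_0_affine in blast)

lemma specializes_unique:
  assumes "spec d u w" "spec d u w'"
  shows "w = w'"
  using specializes_0[of d "w - w'"] specializes_diff[OF assms] by simp

lemma place_unique:
  assumes "pl r g" "pl r g'"
  shows "g = g'"
proof -
  obtain d u v w x where 1: "spec d u w" "spec d v x" "x \<noteq> 0" "r = u / v" "g = w / x"
    using assms(1) unfolding place_def by blast
  obtain d' u' v' w' x' where 2: "spec d' u' w'" "spec d' v' x'" "x' \<noteq> 0" "r = u' / v'" "g' = w' / x'"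
    using assms(2) unfolding place_def by blast
  have "v \<noteq> 0" "v' \<noteq> 0"
    using 1 2 specializes_0 by blast+
  then have "u * v' = v * u'"
    using 1(4) 2(4) by (simp add: field_simps)
  moreover have "spec (d + d') (u * v') (w * x')" "spec (d + d') (v * u') (x * w')"
    using 1 2 by (blast intro: specializes_mult)+
  ultimately have "w * x' = x * w'"
    using specializes_unique by metis
  then have "w / x = w' / x'"
    using 1(3) 2(3) by (simp add: field_simps)
  then show ?thesis
    using 1(5) 2(5) by simp
qed

lemma place_const: "pl (emb k) (e k)"
  unfolding place_def
  by (intro exI[of _ 0] exI[of _ "emb k"] exI[of _ "emb 1"] exI[of _ "e k"] exI[of _ "e 1"])
    (auto intro: specializes.const simp del: emb_1 target.emb_1, simp_all)

lemma place_0: "pl 0 0"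
  using place_const[of 0] by simp

lemma place_1: "pl 1 1"
  using place_const[of 1] by simp

lemma place_add:
  assumes "pl r g" "pl r' g'"
  shows "pl (r + r') (g + g')"
proof -
  obtain d u v w x where 1: "spec d u w" "spec d v x" "x \<noteq> 0" "r = u / v" "g = w / x"
    using assms(1) unfolding place_def by blast
  obtain d' u' v' w' x' where 2: "spec d' u' w'" "spec d' v' x'" "x' \<noteq> 0" "r' = u' / v'" "g' = w' / x'"
    using assms(2) unfolding place_def by blast
  have "v \<noteq> 0" "v' \<noteq> 0"
    using 1 2 specializes_0 by blast+
  have "spec (d + d') (u * v' + v * u') (w * x' + x * w')" "spec (d + d') (v * v') (x * x')"
    using 1 2 by (blast intro: specializes_mult specializes.add)+
  moreover have "r + r' = (u * v' + v * u') / (v * v')" "g + g' = (w * x' + x * w') / (x * x')" "x * x' \<noteq> 0"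
    using 1 2 \<open>v \<noteq> 0\<close> \<open>v' \<noteq> 0\<close> by (simp_all add: field_simps)
  ultimately show ?thesis
    unfolding place_def by blast
qed

lemma place_mult:
  assumes "pl r g" "pl r' g'"
  shows "pl (r * r') (g * g')"
proof -
  obtain d u v w x where 1: "spec d u w" "spec d v x" "x \<noteq> 0" "r = u / v" "g = w / x"
    using assms(1) unfolding place_def by blast
  obtain d' u' v' w' x' where 2: "spec d' u' w'" "spec d' v' x'" "x' \<noteq> 0" "r' = u' / v'" "g' = w' / x'"
    using assms(2) unfolding place_def by blast
  have "spec (d + d') (u * u') (w * w')" "spec (d + d') (v * v') (x * x')"
    using 1 2 by (blast intro: specializes_mult)+
  moreover have "r * r' = (u * u') / (v * v')" "g * g' = (w * w') / (x * x')" "x * x' \<noteq> 0"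
    using 1 2 by simp_all
  ultimately show ?thesis
    unfolding place_def by blast
qed

lemma place_inverse:
  assumes "pl r g" "g \<noteq> 0"
  shows "pl (inverse r) (inverse g)"
proof -
  obtain d u v w x where 1: "spec d u w" "spec d v x" "x \<noteq> 0" "r = u / v" "g = w / x"
    using assms(1) unfolding place_def by blast
  then have "w \<noteq> 0" "inverse r = v / u" "inverse g = x / w"
    using assms(2) by auto
  then show ?thesis
    unfolding place_def using 1 by blast
qed

lemma place_nonzero: "pl r g \<Longrightarrow> g \<noteq> 0 \<Longrightarrow> r \<noteq> 0"
  using place_unique place_0 by blast

lemma place_divide:
  assumes "pl r g" "pl r' g'" "g' \<noteq> 0"
  shows "pl (r / r') (g / g')"
  using place_mult[OF assms(1) place_inverse[OF assms(2,3)]] by (simp add: divide_inverse)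

lemma place_minus: "pl r g \<Longrightarrow> pl (- r) (- g)"
  using place_mult[OF place_const[of "-1"]] by (simp add: emb_minus target.emb_minus)

lemma place_diff: "pl r g \<Longrightarrow> pl r' g' \<Longrightarrow> pl (r - r') (g - g')"
  using place_add[OF _ place_minus] by fastforce

lemma place_power: "pl r g \<Longrightarrow> pl (r ^ k) (g ^ k)"
  by (induction k) (auto intro: place_1 place_mult)

lemma place_power_int:
  assumes "pl r g" "g \<noteq> 0"
  shows "pl (r powi k) (g powi k)"
proof (cases "k \<ge> 0")
  case True
  then show ?thesis
    using assms by (simp add: power_int_def place_power)
next
  case False
  then show ?thesis
    using place_power[OF place_inverse[OF assms]] by (simp add: power_int_def)
qed

lemma place_prod:
  "finite S \<Longrightarrow> (\<And>i. i \<in> S \<Longrightarrow> pl (r i) (g i)) \<Longrightarrow> pl (\<Prod>i\<in>S. r i) (\<Prod>i\<in>S. g i)"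
  by (induction S rule: finite_induct) (auto intro: place_1 place_mult)

lemma specializes_X: "spec 1 X A"
  using specializes.mult_X[OF specializes.const[of emb X Y Z e A B C 1]] by simp

lemma specializes_Y: "spec 1 Y B"
  using specializes.mult_Y[OF specializes.const[of emb X Y Z e A B C 1]] by simp

lemma specializes_Z: "spec 1 Z C"
  using specializes.mult_Z[OF specializes.const[of emb X Y Z e A B C 1]] by simp

lemma place_X_Z: "C \<noteq> 0 \<Longrightarrow> pl (X / Z) (A / C)"
  unfolding place_def using specializes_X specializes_Z by blast

lemma place_Y_Z: "C \<noteq> 0 \<Longrightarrow> pl (Y / Z) (B / C)"
  unfolding place_def using specializes_Y specializes_Z by blast

lemma place_peval: "pl r g \<Longrightarrow> pl (peval p r) (target.peval p g)"
  by (induction p) (auto intro: place_0 place_add place_mult place_const)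

lemma place_nform: "pl r g \<Longrightarrow> pl s h \<Longrightarrow> pl (nform p0 p1 p2 p3 r s) (target.nform p0 p1 p2 p3 g h)"
  unfolding nform_def target.nform_def
  by (intro place_add place_mult place_power place_peval)

lemma place_conorm: "pl r g \<Longrightarrow> pl s h \<Longrightarrow> pl (conorm p0 p1 p2 p3 r s) (target.conorm p0 p1 p2 p3 g h)"
  unfolding conorm_def target.conorm_def Let_def
  by (intro place_diff place_mult place_nform place_minus place_power place_peval)

lemma place_specializes:
  assumes "C \<noteq> 0" "spec d u w"
  shows "pl (u / Z ^ d) (w / C ^ d)"
  unfolding place_def using assms specializes_power_Z[of emb e X Y Z A B C d] by fastforce

end

section \<open>The field \<complex>(X/Z, Y/Z)\<close>

context quartic
begin

sublocale self: quartic_point emb X Y Z emb X Y Z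
  by unfold_locales (use quartic_eq in auto)

text \<open>At the generic point (X : Y : Z) every quotient of forms of equal degree with nonzero
  denominator is regular and is its own value.\<close>

definition funs :: "'f set" where
  "funs = {r. self.pl r r}"

lemma specializes_selfI: "specializes emb X Y Z e A B C d u w \<Longrightarrow> self.spec d u u"
  using specializes_ex specializes_self by metis

lemma funs_const [simp]: "emb k \<in> funs"
  and funs_0 [simp]: "0 \<in> funs" and funs_1 [simp]: "1 \<in> funs"
  unfolding funs_def using self.place_const self.place_0 self.place_1 by auto

lemma funs_add: "r \<in> funs \<Longrightarrow> s \<in> funs \<Longrightarrow> r + s \<in> funs"
  and funs_diff: "r \<in> funs \<Longrightarrow> s \<in> funs \<Longrightarrow> r - s \<in> funs"
  and funs_mult: "r \<in> funs \<Longrightarrow> s \<in> funs \<Longrightarrow> r * s \<in> funs"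
  and funs_power: "r \<in> funs \<Longrightarrow> r ^ k \<in> funs"
  unfolding funs_def mem_Collect_eq
  by (blast intro: self.place_add self.place_diff self.place_mult self.place_power)+

lemma funs_X_Z: "X / Z \<in> funs" and funs_Y_Z: "Y / Z \<in> funs"
  using self.place_X_Z self.place_Y_Z by (simp_all add: funs_def)

lemma funs_inverse: "r \<in> funs \<Longrightarrow> inverse r \<in> funs"
  by (cases "r = 0") (auto simp: funs_def intro: self.place_inverse self.place_0)

lemma funs_divide: "r \<in> funs \<Longrightarrow> s \<in> funs \<Longrightarrow> r / s \<in> funs"
  using funs_mult[OF _ funs_inverse] by (simp add: divide_inverse)

lemma funs_power_int: "r \<in> funs \<Longrightarrow> r powi k \<in> funs"
  unfolding power_int_def by (auto intro: funs_power funs_inverse)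

lemma funs_prod: "(\<And>i. i \<in> S \<Longrightarrow> r i \<in> funs) \<Longrightarrow> (\<Prod>i\<in>S. r i) \<in> funs"
  by (induction S rule: infinite_finite_induct) (auto intro: funs_mult)

lemma funs_iff_spec: "r \<in> funs \<longleftrightarrow> (\<exists>d u v. self.spec d u u \<and> self.spec d v v \<and> v \<noteq> 0 \<and> r = u / v)"
  unfolding funs_def place_def mem_Collect_eq using specializes_self by blast

lemma funs_nform:
  assumes "r \<in> funs"
  obtains p0 p1 p2 p3 q0 q1 q2 q3 where
    "r = nform p0 p1 p2 p3 (X / Z) (Y / Z) / nform q0 q1 q2 q3 (X / Z) (Y / Z)"
    "nform q0 q1 q2 q3 (X / Z) (Y / Z) \<noteq> 0"
proof -
  obtain d u v where *: "self.spec d u u" "self.spec d v v" "v \<noteq> 0" "r = u / v"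
    using assms funs_iff_spec by blast
  obtain p0 p1 p2 p3 where p: "u = Z ^ d * nform p0 p1 p2 p3 (X / Z) (Y / Z)"
    using self.specializes_nform[OF Z_nonzero *(1)] by blast
  obtain q0 q1 q2 q3 where q: "v = Z ^ d * nform q0 q1 q2 q3 (X / Z) (Y / Z)"
    using self.specializes_nform[OF Z_nonzero *(2)] by blast
  show thesis
    by (rule that[of p0 p1 p2 p3 q0 q1 q2 q3]) (use p q * in auto)
qed

end

lemma (in quartic_point) place_funs:
  assumes "pl r g"
  shows "r \<in> funs"
  using assms specializes_0 specializes_selfI unfolding place_def funs_iff_spec by metis

section \<open>The automorphisms Y -> kY\<close>

locale quartic_conj = quartic emb X Y Z for emb :: "complex \<Rightarrow> 'f::field" and X Y Z +
  fixes k :: complex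
  assumes k_root: "k ^ 4 = 1"
begin

sublocale conj: quartic_point emb X Y Z emb X "emb k * Y" Z
  by unfold_locales (use quartic_eq k_root in \<open>auto simp: power_mult_distrib simp flip: emb_power\<close>)

text \<open>The automorphism \<open>Y \<mapsto> k Y\<close> of the function field.\<close>

definition \<sigma> :: "'f \<Rightarrow> 'f" where
  "\<sigma> r = (THE g. conj.pl r g)"

lemma \<sigma>_eqI: "conj.pl r g \<Longrightarrow> \<sigma> r = g"
  unfolding \<sigma>_def using conj.place_unique by blast

text \<open>Read from right to left, the relation specializes the conjugated generic point to the
  original one, so zero goes to zero in that direction too. Thus conjugation is defined on the whole
  field.\<close>

lemma specializes_conj_nonzero:
  assumes "conj.spec d u w" "u \<noteq> 0"
  shows "w \<noteq> 0"
proof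
  assume "w = 0"
  interpret q: quartic emb X "emb k * Y" Z
    by (rule quartic_conj[OF k_root])
  interpret q: quartic_point emb X "emb k * Y" Z emb X Y Z
    by unfold_locales (use quartic_eq in auto)
  show False
    using q.specializes_0[of d u] specializes_flip[OF assms(1)] \<open>w = 0\<close> assms(2) by simp
qed

lemma place_\<sigma>:
  assumes "r \<in> funs"
  shows "conj.pl r (\<sigma> r)"
proof -
  obtain d u v where *: "self.spec d u u" "self.spec d v v" "v \<noteq> 0" "r = u / v"
    using assms funs_iff_spec by blast
  obtain w x where "conj.spec d u w" "conj.spec d v x"
    using specializes_ex[OF *(1)] specializes_ex[OF *(2)] by blast
  then have "conj.pl r (w / x)"
    unfolding place_def using * specializes_conj_nonzero by blast
  then show ?thesis
    using \<sigma>_eqI by metis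
qed

lemma \<sigma>_add: "r \<in> funs \<Longrightarrow> s \<in> funs \<Longrightarrow> \<sigma> (r + s) = \<sigma> r + \<sigma> s"
  and \<sigma>_mult: "r \<in> funs \<Longrightarrow> s \<in> funs \<Longrightarrow> \<sigma> (r * s) = \<sigma> r * \<sigma> s"
  and \<sigma>_power: "r \<in> funs \<Longrightarrow> \<sigma> (r ^ m) = \<sigma> r ^ m"
  and \<sigma>_const: "\<sigma> (emb l) = emb l"
  and \<sigma>_X_Z: "\<sigma> (X / Z) = X / Z" and \<sigma>_Y_Z: "\<sigma> (Y / Z) = emb k * (Y / Z)"
  by (rule \<sigma>_eqI, use place_\<sigma> conj.place_add conj.place_mult conj.place_power
    conj.place_const conj.place_X_Z conj.place_Y_Z in auto)+

lemma \<sigma>_0 [simp]: "\<sigma> 0 = 0" and \<sigma>_1 [simp]: "\<sigma> 1 = 1"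
  using \<sigma>_const[of 0] \<sigma>_const[of 1] by auto

lemma \<sigma>_nonzero:
  assumes "r \<in> funs" "r \<noteq> 0"
  shows "\<sigma> r \<noteq> 0"
  using \<sigma>_mult[OF assms(1) funs_inverse[OF assms(1)]] assms(2) by auto

lemma \<sigma>_inverse: "r \<in> funs \<Longrightarrow> \<sigma> (inverse r) = inverse (\<sigma> r)"
  using \<sigma>_mult[OF _ funs_inverse, of r r] by (cases "r = 0") (auto simp: inverse_unique)

lemma \<sigma>_divide: "r \<in> funs \<Longrightarrow> s \<in> funs \<Longrightarrow> \<sigma> (r / s) = \<sigma> r / \<sigma> s"
  by (simp add: divide_inverse \<sigma>_mult \<sigma>_inverse funs_inverse)

lemma \<sigma>_power_int: "r \<in> funs \<Longrightarrow> \<sigma> (r powi m) = \<sigma> r powi m"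
  unfolding power_int_def by (auto simp: \<sigma>_power \<sigma>_inverse funs_inverse)

lemma \<sigma>_peval: "r \<in> funs \<Longrightarrow> peval p r \<in> funs \<and> \<sigma> (peval p r) = peval p (\<sigma> r)"
  by (induction p) (auto simp: \<sigma>_const \<sigma>_add \<sigma>_mult funs_add funs_mult)

lemma \<sigma>_nform:
  "\<sigma> (nform p0 p1 p2 p3 (X / Z) (Y / Z)) = nform p0 p1 p2 p3 (X / Z) (emb k * (Y / Z))"
  unfolding nform_def
  by (simp add: \<sigma>_peval funs_X_Z funs_Y_Z funs_add funs_mult funs_power \<sigma>_add \<sigma>_mult \<sigma>_power \<sigma>_X_Z \<sigma>_Y_Z
     del: times_divide_eq_right times_divide_eq_left power_divide)

text \<open>Evaluating the conjugate of a form at a point amounts to evaluating the form at the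
  moved point. The behaviour of values and orders under \<sigma> rests on this.\<close>

lemma specializes_conj_compose:
  assumes "complex_algebra e" "conj.spec d u w"
  shows "\<exists>v. specializes emb X Y Z e A B C d w v \<and> specializes emb X Y Z e A (e k * B) C d u v"
  using assms(2)
proof (induction rule: specializes.induct)
  case (mult_Y d u w)
  interpret t: complex_algebra_pair emb e
    using assms(1) by (simp add: complex_algebra_pair_def complex_algebra_axioms)
  from mult_Y obtain v where "specializes emb X Y Z e A B C d w v" "specializes emb X Y Z e A (e k * B) C d u v"
    by blast
  then have "specializes emb X Y Z e A B C (Suc d) (emb k * (Y * w)) (e k * (B * v))"
    "specializes emb X Y Z e A (e k * B) C (Suc d) (Y * u) (e k * B * v)"
    by (blast intro: specializes.intros t.specializes_scale)+
  then show ?case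
    by (auto simp: mult.assoc)
qed (blast intro: specializes.intros)+

lemma place_conj:
  assumes "quartic_point emb X Y Z e A B C" "place emb X Y Z e A (e k * B) C r g"
  shows "place emb X Y Z e A B C (\<sigma> r) g"
proof -
  interpret t: quartic_point emb X Y Z e A B C by fact
  interpret t': quartic_point emb X Y Z e A "e k * B" C
    by unfold_locales (use t.point_eq t.point_nonzero k_root t.target.emb_eq_0_iff[of k] in
      \<open>auto simp: power_mult_distrib simp flip: t.target.emb_power\<close>)
  obtain d u v w x where *: "t'.spec d u w" "t'.spec d v x" "x \<noteq> 0" "r = u / v" "g = w / x"
    using assms(2) unfolding place_def by blast
  obtain u' v' where c: "conj.spec d u u'" "conj.spec d v v'"
    using specializes_ex[OF *(1)] specializes_ex[OF *(2)] by blast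
  have "v \<noteq> 0"
    using * t'.specializes_0 by blast
  then have "v' \<noteq> 0"
    using c(2) specializes_conj_nonzero by blast
  then have "conj.pl r (u' / v')"
    using c * unfolding place_def by blast
  then have "\<sigma> r = u' / v'"
    by (rule \<sigma>_eqI)
  moreover have "t.spec d u' w" "t.spec d v' x"
    using specializes_conj_compose[OF t.target.complex_algebra_axioms c(1), of A B C] *(1) 
      specializes_conj_compose[OF t.target.complex_algebra_axioms c(2), of A B C] *(2)
      t'.specializes_unique by blast+
  ultimately show ?thesis
    unfolding place_def using *(3,5) by blast
qed

lemma \<sigma>_funs: "r \<in> funs \<Longrightarrow> \<sigma> r \<in> funs"
  unfolding funs_def mem_Collect_eq
  using place_conj[OF self.quartic_point_axioms] place_\<sigma> funs_def self.place_funs by blast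

lemma \<sigma>_compose:
  assumes l: "l ^ 4 = 1" and r: "r \<in> funs"
  shows "quartic_conj.\<sigma> emb X Y Z l (\<sigma> r) = quartic_conj.\<sigma> emb X Y Z (k * l) r"
proof -
  interpret L: quartic_conj emb X Y Z l
    by unfold_locales fact
  interpret KL: quartic_conj emb X Y Z "k * l"
    by unfold_locales (simp add: power_mult_distrib k_root l)
  have "place emb X Y Z emb X (emb k * (emb l * Y)) Z r (KL.\<sigma> r)"
    using KL.place_\<sigma>[OF r] by (simp add: emb_mult mult.assoc)
  from place_conj[OF L.conj.quartic_point_axioms this] show ?thesis
    by (rule L.\<sigma>_eqI)
qed

lemma \<sigma>_inv:
  assumes r: "r \<in> funs"
  shows "quartic_conj.\<sigma> emb X Y Z (inverse k) (\<sigma> r) = r"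
proof -
  have k: "k \<noteq> 0"
    using k_root by auto
  interpret I: quartic_conj emb X Y Z 1
    by unfold_locales simp
  have "I.\<sigma> r = r"
    using r by (intro I.\<sigma>_eqI) (simp add: funs_def)
  then show ?thesis
    using \<sigma>_compose[OF _ r, of "inverse k"] k_root k by (simp add: power_inverse)
qed

lemma place_conj_iff:
  assumes "quartic_point emb X Y Z e A B C" "r \<in> funs"
  shows "place emb X Y Z e A B C (\<sigma> r) g \<longleftrightarrow> place emb X Y Z e A (e k * B) C r g"
proof
  interpret t: quartic_point emb X Y Z e A B C by fact
  interpret t': quartic_point emb X Y Z e A "e k * B" C
    by unfold_locales (use t.point_eq t.point_nonzero k_root t.target.emb_eq_0_iff[of k] in
      \<open>auto simp: power_mult_distrib simp flip: t.target.emb_power\<close>)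
  have k: "k \<noteq> 0"
    using k_root by auto
  interpret L: quartic_conj emb X Y Z "inverse k"
    by unfold_locales (simp add: power_inverse k_root)
  assume "place emb X Y Z e A B C (\<sigma> r) g"
  then have "place emb X Y Z e A (e (inverse k) * (e k * B)) C (\<sigma> r) g"
    using k by (simp add: t.target.emb_inverse mult.assoc[symmetric])
  from L.place_conj[OF t'.quartic_point_axioms this] show "place emb X Y Z e A (e k * B) C r g"
    by (simp add: \<sigma>_inv assms(2))
qed (use place_conj[OF assms(1)] in blast)

end

section \<open>Valuations\<close>

definition uniformizes :: "(complex \<Rightarrow> 'f::field) \<Rightarrow> 'f \<Rightarrow> 'f \<Rightarrow> 'f \<Rightarrow> complex \<Rightarrow> complex \<Rightarrow> complex \<Rightarrow> 'f \<Rightarrow> bool" where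
  "uniformizes emb X Y Z a b c t \<longleftrightarrow> t \<noteq> 0 \<and> place emb X Y Z id a b c t 0 \<and>
     (\<forall>r. place emb X Y Z id a b c r 0 \<longrightarrow> (\<exists>s h. place emb X Y Z id a b c s h \<and> r = t * s))"

text \<open>The uniformizer is quantified as in \<open>valuation\<close>; this keeps the notion
  visibly invariant under permuting and rescaling coordinates.\<close>

definition has_order :: "(complex \<Rightarrow> 'f::field) \<Rightarrow> 'f \<Rightarrow> 'f \<Rightarrow> 'f \<Rightarrow> complex \<Rightarrow> complex \<Rightarrow> complex \<Rightarrow> 'f \<Rightarrow> int \<Rightarrow> bool" where
  "has_order emb X Y Z a b c z k \<longleftrightarrow> (\<exists>t u g. uniformizes emb X Y Z a b c t \<and>
     place emb X Y Z id a b c u g \<and> g \<noteq> 0 \<and> z = t powi k * u)"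

definition order_at :: "(complex \<Rightarrow> 'f::field) \<Rightarrow> 'f \<Rightarrow> 'f \<Rightarrow> 'f \<Rightarrow> complex \<Rightarrow> complex \<Rightarrow> complex \<Rightarrow> 'f \<Rightarrow> int" where
  "order_at emb X Y Z a b c z = (THE k. has_order emb X Y Z a b c z k)"

lemma order_at_swap13: "order_at emb X Y Z a b c z = order_at emb Z Y X c b a z"
  unfolding order_at_def has_order_def uniformizes_def
  by (subst (1 2 3 4) place_swap13) (rule refl)

lemma order_at_swap12: "order_at emb X Y Z a b c z = order_at emb Y X Z b a c z"
  unfolding order_at_def has_order_def uniformizes_def
  by (subst (1 2 3 4) place_swap12) (rule refl)

lemma order_at_swap23: "order_at emb X Y Z a b c z = order_at emb X Z Y a c b z"
  using order_at_swap12 order_at_swap13 by metis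

lemma specializes_homogeneous:
  "specializes emb X Y Z e A B C d u w \<Longrightarrow> specializes emb X Y Z e (l * A) (l * B) (l * C) d u (l ^ d * w)"
proof (induction rule: specializes.induct)
  case (const k)
  then show ?case
    using specializes.const[of emb X Y Z e _ _ _ k] by simp
next
  case (add d u w u' w')
  then show ?case
    by (simp add: distrib_left specializes.add)
next
  case (mult_X d u w)
  then show ?case
    using specializes.mult_X[OF mult_X.IH] by (simp add: mult_ac)
next
  case (mult_Y d u w)
  then show ?case
    using specializes.mult_Y[OF mult_Y.IH] by (simp add: mult_ac)
next
  case (mult_Z d u w)
  then show ?case
    using specializes.mult_Z[OF mult_Z.IH] by (simp add: mult_ac)
qed

lemma place_homogeneous:
  assumes "l \<noteq> 0"
  shows "place emb X Y Z id (l * a) (l * b) (l * c) = place emb X Y Z id a b c"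
proof -
  have *: "place emb X Y Z id (l * a) (l * b) (l * c) r g" if "l \<noteq> 0" "place emb X Y Z id a b c r g" for l a b c r g
  proof -
    obtain d u u' w w' where "specializes emb X Y Z id a b c d u w" "specializes emb X Y Z id a b c d u' w'"
      "w' \<noteq> 0" "r = u / u'" "g = w / w'"
      using \<open>place emb X Y Z id a b c r g\<close> unfolding place_def by blast
    then have "specializes emb X Y Z id (l * a) (l * b) (l * c) d u (l ^ d * w)"
      "specializes emb X Y Z id (l * a) (l * b) (l * c) d u' (l ^ d * w')"
      "l ^ d * w' \<noteq> 0" "r = u / u'" "g = (l ^ d * w) / (l ^ d * w')"
      using \<open>l \<noteq> 0\<close> by (simp_all add: specializes_homogeneous)
    then show ?thesis
      unfolding place_def by blast
  qed
  show ?thesis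
    using *[OF assms, of a b c] *[of "inverse l" "l * a" "l * b" "l * c"] assms
    by (intro ext iffI) (auto simp: mult.assoc[symmetric])
qed

lemma order_at_homogeneous:
  "l \<noteq> 0 \<Longrightarrow> order_at emb X Y Z (l * a) (l * b) (l * c) z = order_at emb X Y Z a b c z"
  unfolding order_at_def has_order_def uniformizes_def by (simp add: place_homogeneous)

context quartic
begin

lemma funs_swap13: "quartic.funs emb Z Y X = funs"
proof -
  interpret s: quartic emb Z Y X by (rule quartic_swap13)
  show ?thesis
    unfolding funs_def s.funs_def using place_swap13 by metis
qed

lemma funs_swap12: "quartic.funs emb Y X Z = funs"
proof -
  interpret s: quartic emb Y X Z by (rule quartic_swap12)
  show ?thesis
    unfolding funs_def s.funs_def using place_swap12 by metis
qed

lemma funs_swap23: "quartic.funs emb X Z Y = funs"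
proof -
  interpret s: quartic emb Y X Z by (rule quartic_swap12)
  interpret t: quartic emb Z X Y by (rule s.quartic_swap13)
  show ?thesis
    using funs_swap12 s.funs_swap13 t.funs_swap12 by simp
qed

end

section \<open>Uniformizers and existence of orders at a complex point\<close>

locale closed_point = quartic_point emb X Y Z id a b c
  for emb :: "complex \<Rightarrow> 'f::field" and X Y Z a b c
begin

abbreviation "unif \<equiv> uniformizes emb X Y Z a b c"
abbreviation "ho \<equiv> has_order emb X Y Z a b c"
abbreviation "ord \<equiv> order_at emb X Y Z a b c"

lemma closed_point_swap13: "closed_point emb Z Y X c b a"
  unfolding closed_point_def by (rule quartic_point_swap13)

lemma closed_point_swap12: "closed_point emb Y X Z b a c"
  unfolding closed_point_def by (rule quartic_point_swap12)

lemma unifD: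
  assumes "unif t"
  shows "t \<noteq> 0" "pl t 0" "pl r 0 \<Longrightarrow> \<exists>s h. pl s h \<and> r = t * s"
  using assms unfolding uniformizes_def by auto

text \<open>If t divides both affine coordinates minus their values, it divides every dehomogenized
  form minus its value, by induction on the form with fg - f(P)g(P) = f (g - g(P)) + (f - f(P))
  g(P).\<close>

lemma ideal_generator:
  assumes c: "c \<noteq> 0" and t: "t \<noteq> 0" "pl t 0"
    and 1: "X / Z - emb (a / c) = t * s1" "pl s1 h1"
    and 2: "Y / Z - emb (b / c) = t * s2" "pl s2 h2"
  shows "unif t"
proof -
  have *: "\<exists>s h. pl s h \<and> u / Z ^ d - emb (w / c ^ d) = t * s" if "spec d u w" for d u w
    using that
  proof (induction rule: specializes.induct)
    case (const k)
    show ?case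
      by (rule exI[of _ 0], rule exI[of _ 0], rule conjI, rule place_0) simp
  next
    case (add d u w u' w')
    then obtain s h s' h' where s: "pl s h" "u / Z ^ d - emb (w / c ^ d) = t * s"
      "pl s' h'" "u' / Z ^ d - emb (w' / c ^ d) = t * s'" by blast
    have "(u + u') / Z ^ d - emb ((w + w') / c ^ d) =
        (u / Z ^ d - emb (w / c ^ d)) + (u' / Z ^ d - emb (w' / c ^ d))"
      by (simp add: add_divide_distrib emb_add)
    also have "\<dots> = t * (s + s')"
      unfolding s by (simp add: distrib_left)
    finally show ?case
      using place_add[OF s(1,3)] by blast
  next
    case (mult_X d u w)
    then obtain s h where s: "pl s h" "u / Z ^ d - emb (w / c ^ d) = t * s" by blast
    have "X * u / Z ^ Suc d - emb (a * w / c ^ Suc d) =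
        X / Z * (u / Z ^ d) - emb (a / c) * emb (w / c ^ d)"
      by (simp flip: emb_mult)
    also have "\<dots> = X / Z * (u / Z ^ d - emb (w / c ^ d)) + (X / Z - emb (a / c)) * emb (w / c ^ d)"
      by (rule mult_diff_mult)
    also have "\<dots> = t * (X / Z * s + s1 * emb (w / c ^ d))"
      unfolding s 1 by (simp only: distrib_left mult.assoc mult.left_commute[of t])
    finally show ?case
      using place_add[OF place_mult[OF place_X_Z[OF c] s(1)] place_mult[OF 1(2) place_const[of "w / c ^ d"]]]
      by blast
  next
    case (mult_Y d u w)
    then obtain s h where s: "pl s h" "u / Z ^ d - emb (w / c ^ d) = t * s" by blast
    have "Y * u / Z ^ Suc d - emb (b * w / c ^ Suc d) =
        Y / Z * (u / Z ^ d) - emb (b / c) * emb (w / c ^ d)"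
      by (simp flip: emb_mult)
    also have "\<dots> = Y / Z * (u / Z ^ d - emb (w / c ^ d)) + (Y / Z - emb (b / c)) * emb (w / c ^ d)"
      by (rule mult_diff_mult)
    also have "\<dots> = t * (Y / Z * s + s2 * emb (w / c ^ d))"
      unfolding s 2 by (simp only: distrib_left mult.assoc mult.left_commute[of t])
    finally show ?case
      using place_add[OF place_mult[OF place_Y_Z[OF c] s(1)] place_mult[OF 2(2) place_const[of "w / c ^ d"]]]
      by blast
  next
    case (mult_Z d u w)
    then show ?case
      using c by simp
  qed
  show ?thesis
    unfolding uniformizes_def
  proof (intro conjI allI impI t)
    fix r assume "pl r 0"
    then obtain d u v w x where r: "spec d u w" "spec d v x" "x \<noteq> 0" "r = u / v" "0 = w / x"
      unfolding place_def by blast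
    then have "w = 0" by simp
    then obtain s h where s: "pl s h" "u / Z ^ d = t * s"
      using *[OF r(1)] by auto
    have v: "pl (v / Z ^ d) (x / c ^ d)" "x / c ^ d \<noteq> 0"
      using place_specializes[OF c r(2)] c r(3) by auto
    have "r = (u / Z ^ d) / (v / Z ^ d)"
      using r(4) by simp
    also have "\<dots> = t * (s / (v / Z ^ d))"
      unfolding s(2) by simp
    finally show "\<exists>s h. pl s h \<and> r = t * s"
      using place_divide[OF s(1) v] by blast
  qed
qed

lemma place_diff_emb:
  assumes "pl r g"
  shows "pl (r - emb g) 0"
  using place_diff[OF assms place_const[of g]] by simp

text \<open>Where a coordinate does not vanish, it is unramified over its fourth power.\<close>

lemma fourth_root_diff:
  assumes "pl r g" "g \<noteq> 0"
  obtains U where "(r - emb g) * U = r ^ 4 - emb g ^ 4" "pl U (4 * g ^ 3)" "4 * g ^ 3 \<noteq> 0"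
proof
  show "(r - emb g) * (r ^ 3 + r ^ 2 * emb g + r * emb g ^ 2 + emb g ^ 3) = r ^ 4 - emb g ^ 4"
    by algebra
  have "pl (r ^ 3 + r ^ 2 * emb g + r * emb g ^ 2 + emb g ^ 3) (g ^ 3 + g ^ 2 * id g + g * id g ^ 2 + id g ^ 3)"
    by (intro place_add place_mult place_power assms place_const)
  moreover have "g ^ 3 + g ^ 2 * id g + g * id g ^ 2 + id g ^ 3 = 4 * g ^ 3"
    by (simp add: eval_nat_numeral)
  ultimately show "pl (r ^ 3 + r ^ 2 * emb g + r * emb g ^ 2 + emb g ^ 3) (4 * g ^ 3)"
    by simp
qed (use assms in simp)

text \<open>With x, y for X/Z, Y/Z and (a, b) for the affine point, y^4 - b^4 = -(x^4 - a^4). As b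
  is nonzero, the cofactor of y - b on the left is a unit, so y - b is a multiple of x - a.\<close>

lemma uniformizes_X_diff:
  assumes "b \<noteq> 0" "c \<noteq> 0"
  shows "unif (X / Z - emb (a / c))"
proof -
  let ?x = "X / Z" and ?y = "Y / Z" and ?a = "a / c" and ?b = "b / c"
  obtain U where U: "(?y - emb ?b) * U = ?y ^ 4 - emb ?b ^ 4" "pl U (4 * ?b ^ 3)" "4 * ?b ^ 3 \<noteq> 0"
    using fourth_root_diff[OF place_Y_Z] assms by auto
  have "?y ^ 4 - emb ?b ^ 4 = - (?x ^ 4 - emb ?a ^ 4)"
    using affine_eq affine_point_eq[OF assms(2)] by (simp add: emb_diff emb_minus flip: emb_power)
  also have "\<dots> = (?x - emb ?a) * - (?x ^ 3 + ?x ^ 2 * emb ?a + ?x * emb ?a ^ 2 + emb ?a ^ 3)"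
    by algebra
  finally have "?y - emb ?b = (?x - emb ?a) * (- (?x ^ 3 + ?x ^ 2 * emb ?a + ?x * emb ?a ^ 2 + emb ?a ^ 3) / U)"
    using U place_nonzero[OF U(2,3)] by (simp add: nonzero_eq_divide_eq)
  moreover have "pl (- (?x ^ 3 + ?x ^ 2 * emb ?a + ?x * emb ?a ^ 2 + emb ?a ^ 3) / U)
      (- (?a ^ 3 + ?a ^ 2 * id ?a + ?a * id ?a ^ 2 + id ?a ^ 3) / (4 * ?b ^ 3))"
    by (intro place_divide U place_minus place_add place_mult place_power place_const place_X_Z assms)
  moreover have "?x - emb ?a \<noteq> 0"
    using ratio_nonconstant by simp
  moreover have "pl (?x - emb ?a) 0"
    by (intro place_diff_emb place_X_Z assms)
  ultimately show ?thesis
    using place_1 by (intro ideal_generator[OF assms(2), of _ 1 1]) auto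
qed

text \<open>For b = 0 the affine point satisfies a^4 = -1, hence x^4 - a^4 = -y^4, and the cofactor
  of x - a is a unit. This is the hyperflex: the tangent x = a meets the curve four times.\<close>

lemma X_diff_factor:
  assumes "b = 0"
  obtains u g where "X / Z - emb (a / c) = (Y / Z) ^ 4 * u" "pl u g" "g \<noteq> 0"
proof -
  let ?x = "X / Z" and ?y = "Y / Z" and ?a = "a / c"
  have nz: "a \<noteq> 0" "c \<noteq> 0"
    using point_eq point_nonzero assms by auto
  obtain U where U: "(?x - emb ?a) * U = ?x ^ 4 - emb ?a ^ 4" "pl U (4 * ?a ^ 3)" "4 * ?a ^ 3 \<noteq> 0"
    using fourth_root_diff[OF place_X_Z] nz by auto
  have "?a ^ 4 = - 1"
    using affine_point_eq nz assms by (simp add: eq_neg_iff_add_eq_0 add.commute)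
  then have "?x ^ 4 - emb ?a ^ 4 = ?y ^ 4 * (- 1)"
    using affine_eq by (simp add: emb_minus flip: emb_power)
  moreover have "p * U = q * (- 1) \<Longrightarrow> p = q * (- 1 / U)" for p q
    using place_nonzero[OF U(2,3)] by (simp add: field_simps)
  ultimately have "?x - emb ?a = ?y ^ 4 * (- 1 / U)"
    using U(1) by simp
  moreover have "pl (- 1 / U) (- 1 / (4 * ?a ^ 3))"
    by (intro place_divide place_minus place_1 U)
  ultimately show thesis
    using that[of "- 1 / U" "- 1 / (4 * ?a ^ 3)"] nz by simp
qed

lemma uniformizes_Y:
  assumes "b = 0"
  shows "unif (Y / Z)"
proof -
  have nz: "c \<noteq> 0"
    using point_eq point_nonzero assms by auto
  obtain u g where u: "X / Z - emb (a / c) = (Y / Z) ^ 4 * u" "pl u g" "g \<noteq> 0"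
    using X_diff_factor[OF assms] .
  have "X / Z - emb (a / c) = Y / Z * ((Y / Z) ^ 3 * u)"
    unfolding u by (simp add: eval_nat_numeral)
  moreover have "pl ((Y / Z) ^ 3 * u) ((b / c) ^ 3 * g)"
    by (intro place_mult place_power place_Y_Z nz u)
  ultimately show ?thesis
    using place_Y_Z[OF nz] place_1 assms by (intro ideal_generator[OF nz, of _ _ _ 1 1]) auto
qed

lemma uniformizer_exists: "\<exists>t. unif t"
proof (cases "c = 0")
  case False
  then show ?thesis
    using uniformizes_X_diff uniformizes_Y by (cases "b = 0") blast+
next
  case True
  interpret s: closed_point emb Z Y X c b a
    by (rule closed_point_swap13)
  have "s.unif = unif"
    unfolding uniformizes_def fun_eq_iff by (subst (1 2 3) place_swap13) simp
  moreover have "a \<noteq> 0" "b \<noteq> 0"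
    using True point_eq point_nonzero by auto
  ultimately show ?thesis
    using s.uniformizes_X_diff by auto
qed

text \<open>Two uniformizers divide each other, so their quotient is a unit and any of them computes
  the order.\<close>

lemma has_order_unif:
  assumes "ho z k" "unif t"
  obtains u g where "pl u g" "g \<noteq> 0" "z = t powi k * u"
proof -
  obtain t' u g where *: "unif t'" "pl u g" "g \<noteq> 0" "z = t' powi k * u"
    using assms(1) unfolding has_order_def by blast
  obtain s h s' h' where s: "pl s h" "t' = t * s" "pl s' h'" "t = t' * s'"
    using unifD[OF *(1)] unifD[OF assms(2)] by meson
  then have "t * (s * s') = t"
    by (metis mult.assoc)
  then have "s * s' = 1"
    using unifD(1)[OF assms(2)] by simp
  then have "h * h' = 1"
    using place_mult[OF s(1,3)] place_1 place_unique by metis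
  then have "h \<noteq> 0" by auto
  show thesis
  proof
    show "pl (s powi k * u) (h powi k * g)"
      by (intro place_mult place_power_int s * \<open>h \<noteq> 0\<close>)
    show "z = t powi k * (s powi k * u)"
      unfolding *(4) s(2) by (simp add: power_int_mult_distrib mult.assoc)
    show "h powi k * g \<noteq> 0"
      using \<open>h \<noteq> 0\<close> * by simp
  qed
qed

lemma has_orderI: "unif t \<Longrightarrow> pl u g \<Longrightarrow> g \<noteq> 0 \<Longrightarrow> z = t powi k * u \<Longrightarrow> ho z k"
  unfolding has_order_def by blast

lemma has_order_nonzero: "ho z k \<Longrightarrow> z \<noteq> 0"
  unfolding has_order_def uniformizes_def using place_nonzero by auto

lemma has_order_pos:
  assumes "ho z k" "k > 0"
  shows "pl z 0"
proof -
  obtain t u g where *: "unif t" "pl u g" "z = t powi k * u"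
    using assms(1) unfolding has_order_def by blast
  have "pl (t ^ nat k * u) (0 ^ nat k * g)"
    by (intro place_mult place_power * unifD(2)[OF *(1)])
  then show ?thesis
    using assms(2) * by (simp add: power_int_def zero_power)
qed

lemma has_order_0:
  assumes "ho z 0"
  obtains g where "pl z g" "g \<noteq> 0"
  using assms unfolding has_order_def by auto

lemma has_order_unit:
  assumes "pl u g" "g \<noteq> 0"
  shows "ho u 0"
  using uniformizer_exists assms by (auto intro: has_orderI)

lemma has_order_mult:
  assumes "ho z k" "ho z' k'"
  shows "ho (z * z') (k + k')"
proof -
  obtain t where t: "unif t" using uniformizer_exists by blast
  obtain u g where 1: "pl u g" "g \<noteq> 0" "z = t powi k * u"
    using has_order_unif[OF assms(1) t] .
  obtain u' g' where 2: "pl u' g'" "g' \<noteq> 0" "z' = t powi k' * u'"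
    using has_order_unif[OF assms(2) t] .
  show ?thesis
    by (rule has_orderI[OF t place_mult[OF 1(1) 2(1)]])
      (use 1 2 unifD(1)[OF t] in \<open>simp_all add: power_int_add\<close>)
qed

lemma has_order_inverse:
  assumes "ho z k"
  shows "ho (inverse z) (- k)"
proof -
  obtain t u g where *: "unif t" "pl u g" "g \<noteq> 0" "z = t powi k * u"
    using assms unfolding has_order_def by blast
  show ?thesis
    by (rule has_orderI[OF *(1) place_inverse[OF *(2,3)]])
      (use * in \<open>simp_all add: power_int_minus\<close>)
qed

text \<open>Two different orders would give the function 1 a positive order, hence the value
  0.\<close>

lemma has_order_unique:
  assumes "ho z k" "ho z l"
  shows "k = l"
proof -
  have *: "ho 1 (k - l)" "ho 1 (l - k)"
    using has_order_mult[OF assms(1) has_order_inverse[OF assms(2)]]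
      has_order_mult[OF assms(2) has_order_inverse[OF assms(1)]] has_order_nonzero[OF assms(1)]
    by simp_all
  moreover have "\<not> pl 1 0"
    using place_1 place_unique by fastforce
  ultimately show ?thesis
    using has_order_pos by (metis diff_gt_0_iff_gt linorder_neqE)
qed

lemma has_order_power: "ho z k \<Longrightarrow> ho (z ^ n) (int n * k)"
proof (induction n)
  case 0
  then show ?case using has_order_unit[OF place_1] by simp
next
  case (Suc n)
  then show ?case
    using has_order_mult[OF Suc.prems Suc.IH[OF Suc.prems]] by (simp add: algebra_simps)
qed

lemma has_order_uniformizer: "unif t \<Longrightarrow> ho t 1"
  by (rule has_orderI[OF _ place_1]) auto

lemma X_diff_order:
  assumes "b = 0"
  shows "ho (X / Z - emb (a / c)) 4"
proof -
  obtain u g where "X / Z - emb (a / c) = (Y / Z) ^ 4 * u" "pl u g" "g \<noteq> 0"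
    using X_diff_factor[OF assms] .
  then show ?thesis
    using has_orderI[OF uniformizes_Y[OF assms], of u g _ 4] by simp
qed

text \<open>Splitting off all factors x - a/c leaves a unit, and x - a/c itself has order 1 or
  4.\<close>

lemma has_order_peval:
  assumes "c \<noteq> 0" "p \<noteq> 0"
  shows "\<exists>n. ho (peval p (X / Z)) (int n)"
proof -
  obtain q where q: "p = [:- (a / c), 1:] ^ Polynomial.order (a / c) p * q" "\<not> [:- (a / c), 1:] dvd q"
    using order_decomp[OF assms(2)] by blast
  then have "poly q (a / c) \<noteq> 0"
    by (simp add: poly_eq_0_iff_dvd)
  then have 1: "ho (peval q (X / Z)) 0"
    using place_peval[OF place_X_Z[OF assms(1)], of q] by (intro has_order_unit) auto
  obtain e :: nat where e: "ho (X / Z - emb (a / c)) (int e)"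
    using X_diff_order has_order_uniformizer[OF uniformizes_X_diff] assms(1)
    by (cases "b = 0") (metis of_nat_numeral, metis of_nat_1)
  have "peval p (X / Z) = (X / Z - emb (a / c)) ^ Polynomial.order (a / c) p * peval q (X / Z)"
    by (subst q(1)) (simp add: emb_minus)
  then show ?thesis
    using has_order_mult[OF has_order_power[OF e] 1] by (metis add.right_neutral of_nat_mult)
qed

text \<open>A regular factor f that vanishes can be divided by a uniformizer, which lowers the order
  of the product by one. Since the other factor stays regular, this stops after at most n
  divisions.\<close>

lemma has_order_factor:
  assumes "ho (f * f') (int n)" "pl f g" "pl f' g'"
  shows "\<exists>k. ho f k"
  using assms
proof (induction n arbitrary: f g)
  case 0
  then have "g * g' \<noteq> 0"
    using place_mult[of f g f' g'] has_order_0[of "f * f'"] place_unique by (metis of_nat_0)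
  then have "g \<noteq> 0" by auto
  then show ?case
    using has_order_unit[OF 0(2)] by blast
next
  case (Suc n)
  show ?case
  proof (cases "g = 0")
    case True
    obtain t where t: "unif t" using uniformizer_exists by blast
    then obtain s h where s: "pl s h" "f = t * s"
      using unifD(3) Suc.prems(2) True by blast
    have "ho (f * f' * inverse t) (int (Suc n) + - 1)"
      by (intro has_order_mult has_order_inverse Suc.prems has_order_uniformizer t)
    then have "ho (s * f') (int n)"
      using unifD(1)[OF t] s by (simp add: field_simps)
    then obtain k where "ho s k"
      using Suc.IH s(1) Suc.prems(3) by blast
    then show ?thesis
      using has_order_mult[OF has_order_uniformizer[OF t]] s(2) by blast
  qed (use has_order_unit Suc.prems in blast)
qed

text \<open>A polynomial in x and y divides its norm, whose order is known as it is a polynomial in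
  x. The cofactor \<open>conorm\<close> is regular, so \<open>has_order_factor\<close> applies to
  numerator and denominator.\<close>

lemma has_order_exists_affine:
  assumes "c \<noteq> 0" "r \<in> funs" "r \<noteq> 0"
  shows "\<exists>k. ho r k"
proof -
  have *: "\<exists>k. ho f k" if f: "f = nform p0 p1 p2 p3 (X / Z) (Y / Z)" "f \<noteq> 0" for f p0 p1 p2 p3
  proof -
    let ?D = "norm_poly p0 p1 p2 p3"
    have "?D \<noteq> 0"
    proof
      assume "?D = 0"
      then have "f = 0"
        using norm_poly_eq_0D[of p0 p1 p2 p3] by (simp add: f nform_def)
      with f show False by simp
    qed
    then obtain n where "ho (peval ?D (X / Z)) (int n)"
      using has_order_peval assms(1) by blast
    then have "ho (f * conorm p0 p1 p2 p3 (X / Z) (Y / Z)) (int n)"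
      by (simp add: f nform_mult_conorm[OF affine_eq])
    moreover have "\<exists>g. pl f g"
      unfolding f using place_nform place_X_Z place_Y_Z assms(1) by blast
    moreover have "\<exists>g. pl (conorm p0 p1 p2 p3 (X / Z) (Y / Z)) g"
      using place_conorm place_X_Z place_Y_Z assms(1) by blast
    ultimately show ?thesis
      using has_order_factor by blast
  qed
  obtain p0 p1 p2 p3 q0 q1 q2 q3 where
    r: "r = nform p0 p1 p2 p3 (X / Z) (Y / Z) / nform q0 q1 q2 q3 (X / Z) (Y / Z)"
    "nform q0 q1 q2 q3 (X / Z) (Y / Z) \<noteq> 0"
    using funs_nform[OF assms(2)] .
  then have "nform p0 p1 p2 p3 (X / Z) (Y / Z) \<noteq> 0"
    using assms(3) by auto
  with *[OF refl] r(2) obtain k l where "ho (nform p0 p1 p2 p3 (X / Z) (Y / Z)) k" "ho (nform q0 q1 q2 q3 (X / Z) (Y / Z)) l"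
    by meson
  then show ?thesis
    unfolding r(1) divide_inverse by (blast intro: has_order_mult has_order_inverse)
qed

end

context closed_point
begin

lemma has_order_exists:
  assumes "r \<in> funs" "r \<noteq> 0"
  shows "\<exists>k. ho r k"
proof (cases "c = 0")
  case True
  interpret s: closed_point emb Z Y X c b a
    by (rule closed_point_swap13)
  have "s.ho = ho"
    unfolding has_order_def uniformizes_def fun_eq_iff by (subst (1 2 3 4) place_swap13) simp
  moreover have "a \<noteq> 0"
    using True point_eq point_nonzero by auto
  ultimately show ?thesis
    using s.has_order_exists_affine assms funs_swap13 by auto
qed (use assms has_order_exists_affine in blast)

lemma ord_eqI: "ho z k \<Longrightarrow> ord z = k"
  unfolding order_at_def using has_order_unique by blast

lemma has_order_ord: "z \<in> funs \<Longrightarrow> z \<noteq> 0 \<Longrightarrow> ho z (ord z)"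
  using has_order_exists ord_eqI by metis

lemma ord_mult:
  "z \<in> funs \<Longrightarrow> z \<noteq> 0 \<Longrightarrow> z' \<in> funs \<Longrightarrow> z' \<noteq> 0 \<Longrightarrow> ord (z * z') = ord z + ord z'"
  by (intro ord_eqI has_order_mult has_order_ord)

lemma ord_inverse: "z \<in> funs \<Longrightarrow> z \<noteq> 0 \<Longrightarrow> ord (inverse z) = - ord z"
  by (intro ord_eqI has_order_inverse has_order_ord)

lemma ord_divide:
  "z \<in> funs \<Longrightarrow> z \<noteq> 0 \<Longrightarrow> z' \<in> funs \<Longrightarrow> z' \<noteq> 0 \<Longrightarrow> ord (z / z') = ord z - ord z'"
  using ord_mult[of z "inverse z'"] by (simp add: divide_inverse ord_inverse funs_inverse)

lemma ord_power: "z \<in> funs \<Longrightarrow> z \<noteq> 0 \<Longrightarrow> ord (z ^ n) = int n * ord z"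
  by (intro ord_eqI has_order_power has_order_ord)

lemma ord_power_int: "z \<in> funs \<Longrightarrow> z \<noteq> 0 \<Longrightarrow> ord (z powi k) = k * ord z"
  by (cases "k \<ge> 0") (auto simp: power_int_def ord_power ord_inverse funs_inverse simp flip: power_inverse)

lemma ord_unit: "pl z g \<Longrightarrow> g \<noteq> 0 \<Longrightarrow> ord z = 0"
  by (intro ord_eqI has_order_unit)

lemma ord_prod:
  "finite S \<Longrightarrow> (\<And>i. i \<in> S \<Longrightarrow> r i \<in> funs \<and> r i \<noteq> 0) \<Longrightarrow> ord (\<Prod>i\<in>S. r i) = (\<Sum>i\<in>S. ord (r i))"
  by (induction S rule: finite_induct) (simp_all add: ord_unit[OF place_1] ord_mult funs_prod)

lemma ord_0_place:
  assumes "z \<in> funs" "z \<noteq> 0" "ord z = 0"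
  obtains g where "pl z g" "g \<noteq> 0"
  using has_order_ord[OF assms(1,2)] assms(3) has_order_0 by auto

lemma place_ord_pos:
  assumes "pl z 0" "z \<noteq> 0"
  shows "ord z > 0"
proof (rule ccontr)
  assume "\<not> ord z > 0"
  moreover have z: "ho z (ord z)" "ho (inverse z) (- ord z)"
    using assms place_funs has_order_ord has_order_inverse by blast+
  ultimately consider "ho z 0" | "pl (inverse z) 0"
    using has_order_pos[OF z(2)] by fastforce
  then show False
  proof cases
    case 1
    then show ?thesis
      using has_order_0 assms(1) place_unique by metis
  next
    case 2
    then have "pl 1 0"
      using place_mult[OF assms(1) 2] assms(2) by simp
    then show ?thesis
      using place_1 place_unique by fastforce
  qed
qed

lemma place_inverse_contra:
  assumes "pl z g" "pl (inverse z) 0"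
  shows "z = 0"
proof (rule ccontr)
  assume "z \<noteq> 0"
  then have "pl 1 0"
    using place_mult[OF assms] by simp
  then show False
    using place_unique[OF _ place_1] by fastforce
qed

end

text \<open>Conjugation identifies the local ring at the moved point with that at the point, the
  inverse being conjugation by \<open>inverse k\<close>; so it carries uniformizers to
  uniformizers.\<close>

lemma (in quartic_conj) has_order_conj:
  assumes "closed_point emb X Y Z a b c" "z \<in> funs" "has_order emb X Y Z a (k * b) c z m"
  shows "has_order emb X Y Z a b c (\<sigma> z) m"
proof -
  interpret P: closed_point emb X Y Z a b c by fact
  interpret Q: closed_point emb X Y Z a "k * b" c
    by unfold_locales (use P.point_eq P.point_nonzero k_root in \<open>auto simp: power_mult_distrib\<close>)
  have iff: "P.pl (\<sigma> r) g \<longleftrightarrow> Q.pl r g" if "r \<in> funs" for r g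
    using place_conj_iff[OF P.quartic_point_axioms that, of g] id_apply[of k] by (simp only:)
  obtain t u g where t: "Q.unif t" and u: "Q.pl u g" "g \<noteq> 0" "z = t powi m * u"
    using assms(3) unfolding has_order_def by blast
  have funs: "t \<in> funs" "u \<in> funs"
    using Q.unifD(2)[OF t] u Q.place_funs by blast+
  interpret L: quartic_conj emb X Y Z "inverse k"
    by unfold_locales (simp add: power_inverse k_root)
  have "k \<noteq> 0" using k_root by auto
  have "P.unif (\<sigma> t)"
    unfolding uniformizes_def
  proof (intro conjI allI impI)
    show "\<sigma> t \<noteq> 0"
      using \<sigma>_nonzero funs Q.unifD(1)[OF t] by blast
    show "P.pl (\<sigma> t) 0"
      using iff[OF funs(1)] Q.unifD(2)[OF t] by blast
    fix r assume r: "P.pl r 0"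
    then have rf: "r \<in> funs" "L.\<sigma> r \<in> funs"
      using P.place_funs L.\<sigma>_funs by blast+
    have \<sigma>r: "\<sigma> (L.\<sigma> r) = r"
      using L.\<sigma>_inv[OF rf(1)] by simp
    then have "Q.pl (L.\<sigma> r) 0"
      using iff[OF rf(2)] r by simp
    then obtain s h where s: "Q.pl s h" "L.\<sigma> r = t * s"
      using Q.unifD(3)[OF t] by blast
    then have "s \<in> funs"
      using Q.place_funs by blast
    then show "\<exists>s h. P.pl s h \<and> r = \<sigma> t * s"
      using s iff \<sigma>r \<sigma>_mult funs by metis
  qed
  then show ?thesis
    by (rule P.has_orderI[of _ "\<sigma> u" g])
      (use u iff funs in \<open>auto simp: \<sigma>_mult \<sigma>_power_int funs_power_int\<close>)
qed

lemma (in quartic_conj) order_at_conj: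
  assumes "closed_point emb X Y Z a b c" "z \<in> funs" "z \<noteq> 0"
  shows "order_at emb X Y Z a b c (\<sigma> z) = order_at emb X Y Z a (k * b) c z"
proof -
  interpret P: closed_point emb X Y Z a b c by fact
  interpret Q: closed_point emb X Y Z a "k * b" c
    by unfold_locales (use P.point_eq P.point_nonzero k_root in \<open>auto simp: power_mult_distrib\<close>)
  show ?thesis
    using has_order_conj[OF assms(1,2) Q.has_order_ord] P.ord_eqI assms by blast
qed

section \<open>Divisors of the coordinate functions and constants\<close>

text \<open>In the symmetric equation this one set parametrizes all three classes of cusps: (0 : w :
  1), (w : 0 : 1) and (w : 1 : 0).\<close>

definition \<Omega> :: "complex set" where
  "\<Omega> = {w. w ^ 4 = - 1}"

lemma \<Omega>_nonzero: "w \<in> \<Omega> \<Longrightarrow> w \<noteq> 0"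
  by (auto simp: \<Omega>_def)

lemma \<Omega>_nonempty: "\<exists>w. w \<in> \<Omega>"
  unfolding \<Omega>_def using nth_root_exists[of 4 "- 1"] by auto

lemma \<Omega>_mult: "k ^ 4 = 1 \<Longrightarrow> w \<in> \<Omega> \<Longrightarrow> k * w \<in> \<Omega>"
  by (simp add: \<Omega>_def power_mult_distrib)

lemma fourth_power_i: "\<i> ^ 4 = 1" "(- \<i>) ^ 4 = 1" "(- 1 :: complex) ^ 4 = 1"
  by (simp_all add: eval_nat_numeral)

lemma \<Omega>_eq:
  assumes "r \<in> \<Omega>"
  shows "\<Omega> = {r, \<i> * r, - r, - \<i> * r}"
proof -
  have "w \<in> {r, \<i> * r, - r, - \<i> * r}" if "w \<in> \<Omega>" for w
  proof -
    have "(w - r) * (w - \<i> * r) * (w + r) * (w + \<i> * r) = w ^ 4 - r ^ 4"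
      using i_squared by algebra
    also have "\<dots> = 0"
      using assms that by (simp add: \<Omega>_def)
    finally show ?thesis
      by (auto simp: eq_neg_iff_add_eq_0)
  qed
  moreover have "{r, \<i> * r, - r, - \<i> * r} \<subseteq> \<Omega>"
    using assms \<Omega>_mult[OF fourth_power_i(1)] \<Omega>_mult[OF fourth_power_i(2)] \<Omega>_mult[OF fourth_power_i(3)]
    by auto
  ultimately show ?thesis
    by blast
qed

lemma finite_\<Omega> [simp]: "finite \<Omega>"
  using \<Omega>_nonempty \<Omega>_eq by (metis finite.emptyI finite.insertI)

lemma sum_\<Omega>:
  fixes f :: "complex \<Rightarrow> 'a::comm_monoid_add"
  assumes "r \<in> \<Omega>"
  shows "sum f \<Omega> = f r + f (\<i> * r) + f (- r) + f (- \<i> * r)"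
proof -
  have "r \<noteq> 0"
    using \<Omega>_nonzero[OF assms] .
  then have "r \<notin> {\<i> * r, - r, - \<i> * r}" "\<i> * r \<notin> {- r, - \<i> * r}" "- r \<notin> {- \<i> * r}"
    by (auto simp: complex_eq_iff)
  then show ?thesis
    unfolding \<Omega>_eq[OF assms]
    by (simp only: sum.insert finite.intros sum.empty add_0_right add.assoc simp_thms empty_iff)
qed

lemma sum_delta_\<Omega>: "w \<in> \<Omega> \<Longrightarrow> (\<Sum>v\<in>\<Omega>. f v * (if w = v then k else 0)) = f w * (k::int)"
  by (simp add: if_distrib cong: if_cong)

section \<open>Orders of the coordinates and of the tangent lines\<close>

context closed_point
begin

text \<open>On the affine curve x^4 = -1 forces y = 0, so x - w can vanish only at the cusp (w : 0 :
  1), the hyperflex of this line.\<close>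

lemma ord_X_diff:
  assumes "w \<in> \<Omega>"
  shows "c \<noteq> 0 \<Longrightarrow> b \<noteq> 0 \<Longrightarrow> ord (X / Z - emb w) = 0"
    and "c \<noteq> 0 \<Longrightarrow> b = 0 \<Longrightarrow> ord (X / Z - emb w) = (if a / c = w then 4 else 0)"
proof -
  have *: "ord (X / Z - emb w) = 0" if "c \<noteq> 0" "a / c \<noteq> w"
    by (rule ord_unit[OF place_diff[OF place_X_Z place_const]]) (use that in auto)
  show "c \<noteq> 0 \<Longrightarrow> b = 0 \<Longrightarrow> ord (X / Z - emb w) = (if a / c = w then 4 else 0)"
    using * ord_eqI[OF X_diff_order] by auto
  show "c \<noteq> 0 \<Longrightarrow> b \<noteq> 0 \<Longrightarrow> ord (X / Z - emb w) = 0"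
    using assms affine_point_eq * by (cases "a / c = w") (auto simp: \<Omega>_def)
qed

lemma ord_X_Z: "c \<noteq> 0 \<Longrightarrow> a \<noteq> 0 \<Longrightarrow> ord (X / Z) = 0"
  and ord_X_Z_zero: "c \<noteq> 0 \<Longrightarrow> a = 0 \<Longrightarrow> ord (X / Z) = 1"
proof -
  show "c \<noteq> 0 \<Longrightarrow> a \<noteq> 0 \<Longrightarrow> ord (X / Z) = 0"
    by (rule ord_unit[OF place_X_Z]) auto
  assume "c \<noteq> 0" "a = 0"
  moreover from this have "b \<noteq> 0"
    using point_eq by auto
  then have "ord (X / Z - emb (a / c)) = 1"
    using \<open>c \<noteq> 0\<close> by (intro ord_eqI has_order_uniformizer uniformizes_X_diff)
  ultimately show "ord (X / Z) = 1"
    by simp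
qed

end

context closed_point
begin

lemma ord_X_Z_pole:
  assumes "c = 0"
  shows "ord (X / Z) = - 1"
proof -
  interpret s: closed_point emb Z Y X c b a
    by (rule closed_point_swap13)
  have "a \<noteq> 0"
    using assms point_eq point_nonzero by auto
  then have "ord (Z / X) = 1"
    using s.ord_X_Z_zero[OF _ assms] order_at_swap13 by metis
  moreover have "X / Z = inverse (Z / X)"
    by simp
  ultimately show ?thesis
    using ord_inverse[of "Z / X"] funs_inverse[OF funs_X_Z] by simp
qed

lemma ord_X_diff_pole:
  assumes "c = 0" "w \<in> \<Omega>"
  shows "ord (X / Z - emb w) = - 1"
proof -
  interpret s: closed_point emb Z Y X c b a
    by (rule closed_point_swap13)
  have "a \<noteq> 0"
    using assms(1) point_eq point_nonzero by auto
  then have "pl (Z / X) (c / a)"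
    using s.place_X_Z place_swap13 by metis
  then have *: "pl (1 - emb w * (Z / X)) (1 - w * (c / a))"
    using place_diff[OF place_1 place_mult[OF place_const[of w]]] by (simp only: id_apply)
  have "X / Z - emb w = X / Z * (1 - emb w * (Z / X))"
    by (simp add: field_simps)
  moreover have "ord (1 - emb w * (Z / X)) = 0"
    by (rule ord_unit[OF *]) (use assms(1) in simp)
  moreover have "1 - emb w * (Z / X) \<noteq> 0"
    by (rule place_nonzero[OF *]) (use assms(1) in simp)
  ultimately show ?thesis
    using ord_mult[of "X / Z" "1 - emb w * (Z / X)"] ord_X_Z_pole[OF assms(1)] place_funs[OF *] funs_X_Z
    by simp
qed

text \<open>At an affine point x = wy would give x^4 + y^4 = 0 instead of -1. At infinity the
  function is (X/Y - w)(Y/Z): the first factor is the tangent with Y and Z exchanged, and the second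
  has a simple pole.\<close>

lemma ord_X_diff_Y:
  assumes "w \<in> \<Omega>"
  shows "c \<noteq> 0 \<Longrightarrow> ord (X / Z - emb w * (Y / Z)) = 0"
    and "c = 0 \<Longrightarrow> ord (X / Z - emb w * (Y / Z)) = (if a / b = w then 4 else 0) - 1"
proof -
  show "ord (X / Z - emb w * (Y / Z)) = 0" if "c \<noteq> 0"
  proof (rule ord_unit[OF place_diff[OF place_X_Z place_mult[OF place_const place_Y_Z]]])
    show "a / c - id w * (b / c) \<noteq> 0"
    proof
      assume "a / c - id w * (b / c) = 0"
      then have "a / c = w * (b / c)" by simp
      then have "(a / c) ^ 4 = w ^ 4 * (b / c) ^ 4"
        by (simp only: power_mult_distrib)
      then have "(a / c) ^ 4 = - ((b / c) ^ 4)"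
        using assms by (simp add: \<Omega>_def)
      then show False
        using affine_point_eq[OF that] by simp
    qed
  qed (use that in auto)
next
  assume c: "c = 0"
  then have b: "b \<noteq> 0"
    using point_eq point_nonzero by auto
  interpret s: closed_point emb Y X Z b a c
    by (rule closed_point_swap12)
  interpret s': closed_point emb Z X Y c a b
    by (rule s.closed_point_swap13)
  interpret s'': closed_point emb X Z Y a c b
    by (rule s'.closed_point_swap12)
  have "ord (X / Y - emb w) = (if a / b = w then 4 else 0)"
    using s''.ord_X_diff(2)[OF assms b c] order_at_swap23 by metis
  moreover have "ord (Y / Z) = - 1"
    using s.ord_X_Z_pole[OF c] order_at_swap12 by metis
  moreover have "X / Z - emb w * (Y / Z) = (X / Y - emb w) * (Y / Z)"
    by (simp add: field_simps)
  moreover have "X / Y - emb w \<in> funs" "X / Y - emb w \<noteq> 0"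
    using s''.funs_X_Z funs_swap23 funs_diff s''.ratio_nonconstant[of w] by auto
  ultimately show "ord (X / Z - emb w * (Y / Z)) = (if a / b = w then 4 else 0) - 1"
    using ord_mult[of "X / Y - emb w" "Y / Z"] funs_Y_Z by simp
qed

lemma ord_Y_diff:
  assumes "w \<in> \<Omega>"
  shows "c \<noteq> 0 \<Longrightarrow> a \<noteq> 0 \<Longrightarrow> ord (Y / Z - emb w) = 0"
    and "c \<noteq> 0 \<Longrightarrow> a = 0 \<Longrightarrow> ord (Y / Z - emb w) = (if b / c = w then 4 else 0)"
    and "c = 0 \<Longrightarrow> ord (Y / Z - emb w) = - 1"
proof -
  interpret s: closed_point emb Y X Z b a c
    by (rule closed_point_swap12)
  show "c \<noteq> 0 \<Longrightarrow> a \<noteq> 0 \<Longrightarrow> ord (Y / Z - emb w) = 0"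
    "c \<noteq> 0 \<Longrightarrow> a = 0 \<Longrightarrow> ord (Y / Z - emb w) = (if b / c = w then 4 else 0)"
    "c = 0 \<Longrightarrow> ord (Y / Z - emb w) = - 1"
    using s.ord_X_diff[OF assms] s.ord_X_diff_pole[OF _ assms] by (simp_all add: order_at_swap12[of _ X])
qed

end

text \<open>Here q is the reciprocal polynomial; its constant term is the leading coefficient of p.
  It isolates the pole of p(x) at infinity in a power of x.\<close>

lemma peval_reverse:
  assumes "complex_algebra emb" "p \<noteq> 0" "(r::'f::field) \<noteq> 0"
  shows "\<exists>q. poly q 0 \<noteq> 0 \<and>
    complex_algebra.peval emb p r = r ^ degree p * complex_algebra.peval emb q (inverse r)"
proof -
  interpret complex_algebra emb by fact
  show ?thesis
    using assms(2)
  proof (induction p)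
    case (pCons a p)
    show ?case
    proof (cases "p = 0")
      case True
      then show ?thesis
        using pCons by (intro exI[of _ "[:a:]"]) auto
    next
      case False
      then obtain q where q: "poly q 0 \<noteq> 0" "peval p r = r ^ degree p * peval q (inverse r)"
        using pCons by blast
      let ?q = "q + smult a ([:0, 1:] ^ Suc (degree p))"
      have "peval (pCons a p) r = r ^ degree (pCons a p) * peval ?q (inverse r)"
        using q(2) assms(3) False by (simp add: power_inverse field_simps)
      moreover have "poly ?q 0 \<noteq> 0"
        using q(1) by simp
      ultimately show ?thesis by blast
    qed
  qed simp
qed

lemma degree_0_if_no_root:
  fixes p :: "complex poly"
  assumes "\<And>r. poly p r \<noteq> 0"
  shows "degree p = 0"
  using fundamental_theorem_of_algebra[of p] constant_degree assms by blast

section \<open>The norm to \<complex>(x), and constancy of functions without zeros and poles\<close>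

context quartic
begin

interpretation c1: quartic_conj emb X Y Z \<i>
  by unfold_locales (simp add: fourth_power_i)

interpretation c2: quartic_conj emb X Y Z "- 1"
  by unfold_locales (simp add: fourth_power_i)

interpretation c3: quartic_conj emb X Y Z "- \<i>"
  by unfold_locales (simp only: fourth_power_i)

definition norm_fun :: "'f \<Rightarrow> 'f" where
  "norm_fun z = z * c1.\<sigma> z * c2.\<sigma> z * c3.\<sigma> z"

lemma norm_fun_nonzero: "z \<in> funs \<Longrightarrow> z \<noteq> 0 \<Longrightarrow> norm_fun z \<noteq> 0"
  by (simp add: norm_fun_def c1.\<sigma>_nonzero c2.\<sigma>_nonzero c3.\<sigma>_nonzero)

lemma norm_fun_funs: "z \<in> funs \<Longrightarrow> norm_fun z \<in> funs"
  by (simp add: norm_fun_def c1.\<sigma>_funs c2.\<sigma>_funs c3.\<sigma>_funs funs_mult)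

lemma norm_fun_divide: "z \<in> funs \<Longrightarrow> z' \<in> funs \<Longrightarrow> norm_fun (z / z') = norm_fun z / norm_fun z'"
  by (simp add: norm_fun_def c1.\<sigma>_divide c2.\<sigma>_divide c3.\<sigma>_divide)

lemma funs_nformI: "nform p0 p1 p2 p3 (X / Z) (Y / Z) \<in> funs"
  unfolding nform_def
  by (intro funs_add funs_mult funs_power funs_X_Z funs_Y_Z conjunct1[OF c1.\<sigma>_peval])

text \<open>The conjugates y -> iy and y -> -iy multiply to the second factor of
  \<open>conorm\<close>; together with y -> -y they make up the whole cofactor.\<close>

lemma norm_fun_nform: "norm_fun (nform p0 p1 p2 p3 (X / Z) (Y / Z)) = peval (norm_poly p0 p1 p2 p3) (X / Z)"
proof -
  define x y j where "x = X / Z" and "y = Y / Z" and "j = emb \<i>"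
  have j: "j ^ 2 = - 1"
    by (simp add: j_def emb_minus flip: emb_power)
  have y4: "peval (- (1 + [:0, 1:] ^ 4)) x = y ^ 4"
    using affine_eq by (simp add: x_def y_def)
  have alg: "(q0 + q1 * (j * y) + q2 * (j * y) ^ 2 + q3 * (j * y) ^ 3) *
     (q0 + q1 * (- (j * y)) + q2 * (- (j * y)) ^ 2 + q3 * (- (j * y)) ^ 3)
    = q0 ^ 2 + y ^ 4 * q2 ^ 2 - 2 * y ^ 4 * q1 * q3 - (2 * q0 * q2 - q1 ^ 2 - y ^ 4 * q3 ^ 2) * y ^ 2" for q0 q1 q2 q3
  proof -
    define t where "t = j * y"
    have t: "t ^ 2 = - (y ^ 2)"
      by (simp add: t_def power_mult_distrib j)
    have "(q0 + q1 * t + q2 * t ^ 2 + q3 * t ^ 3) * (q0 + q1 * (- t) + q2 * (- t) ^ 2 + q3 * (- t) ^ 3) =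
        (q0 + q2 * t ^ 2) ^ 2 - t ^ 2 * (q1 + q3 * t ^ 2) ^ 2"
      by algebra
    also have "\<dots> = q0 ^ 2 + y ^ 4 * q2 ^ 2 - 2 * y ^ 4 * q1 * q3 - (2 * q0 * q2 - q1 ^ 2 - y ^ 4 * q3 ^ 2) * y ^ 2"
      unfolding t by algebra
    finally show ?thesis
      unfolding t_def .
  qed
  have "conorm p0 p1 p2 p3 x y = nform p0 p1 p2 p3 x (- y) * (nform p0 p1 p2 p3 x (j * y) * nform p0 p1 p2 p3 x (- (j * y)))"
    unfolding conorm_def nform_def Let_def alg
    by (simp only: peval_diff peval_add[of "_ ^ 2"] peval_mult peval_power y4 peval_numeral)
  then show ?thesis
    using nform_mult_conorm[OF affine_eq, of p0 p1 p2 p3]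
    unfolding norm_fun_def c1.\<sigma>_nform c2.\<sigma>_nform c3.\<sigma>_nform
    by (simp add: x_def y_def j_def emb_minus mult_ac)
qed

lemma norm_fun_rational:
  assumes "z \<in> funs" "z \<noteq> 0"
  obtains p q where "p \<noteq> 0" "q \<noteq> 0" "norm_fun z = peval p (X / Z) / peval q (X / Z)"
proof -
  obtain p0 p1 p2 p3 q0 q1 q2 q3 where
    r: "z = nform p0 p1 p2 p3 (X / Z) (Y / Z) / nform q0 q1 q2 q3 (X / Z) (Y / Z)"
    by (rule funs_nform[OF assms(1)])
  then have *: "norm_fun z = peval (norm_poly p0 p1 p2 p3) (X / Z) / peval (norm_poly q0 q1 q2 q3) (X / Z)"
    by (simp add: norm_fun_divide funs_nformI norm_fun_nform)
  with norm_fun_nonzero[OF assms] show thesis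
    by (intro that[OF _ _ *]) auto
qed

text \<open>Once common roots are removed, a root of the denominator gives a pole and a root of the
  numerator a zero.\<close>

lemma cancel_common_roots:
  assumes "p \<noteq> 0" "q \<noteq> 0"
  shows "\<exists>p' q'. p' \<noteq> 0 \<and> q' \<noteq> 0 \<and> (\<forall>r. \<not> (poly p' r = 0 \<and> poly q' r = 0)) \<and>
    peval p (X / Z) / peval q (X / Z) = peval p' (X / Z) / peval q' (X / Z)"
  using assms
proof (induction "degree p" arbitrary: p q rule: less_induct)
  case less
  show ?case
  proof (cases "\<exists>r. poly p r = 0 \<and> poly q r = 0")
    case True
    then obtain r p' q' where *: "p = [:- r, 1:] * p'" "q = [:- r, 1:] * q'"
      by (auto simp: poly_eq_0_iff_dvd dvd_def)
    with less.prems have nz: "p' \<noteq> 0" "q' \<noteq> 0" by auto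
    then have "degree p' < degree p"
      unfolding * by (subst degree_mult_eq) auto
    moreover have "peval p (X / Z) / peval q (X / Z) = peval p' (X / Z) / peval q' (X / Z)"
      unfolding * peval_mult using peval_ratio_nonzero[of "[:- r, 1:]"] by simp
    ultimately show ?thesis
      using less.hyps[OF _ nz] by simp
  qed (use less.prems in blast)
qed

lemma closed_pointI: "a ^ 4 + b ^ 4 + c ^ 4 = 0 \<Longrightarrow> a \<noteq> 0 \<or> b \<noteq> 0 \<or> c \<noteq> 0 \<Longrightarrow> closed_point emb X Y Z a b c"
  by unfold_locales

lemma closed_point_\<Omega>:
  assumes "w \<in> \<Omega>"
  shows "closed_point emb X Y Z 0 w 1" "closed_point emb X Y Z w 0 1" "closed_point emb X Y Z w 1 0"
  using assms by (auto intro!: closed_pointI simp: \<Omega>_def)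

lemma point_above: "\<exists>s. closed_point emb X Y Z r s 1"
proof -
  obtain s :: complex where "s ^ 4 = - 1 - r ^ 4"
    using nth_root_exists[of 4 "- 1 - r ^ 4"] by auto
  then show ?thesis
    by (intro exI[of _ s] closed_pointI) auto
qed

lemma rational_zero:
  assumes "poly p r = 0" "poly q r \<noteq> 0"
  obtains s where "closed_point emb X Y Z r s 1" "place emb X Y Z id r s 1 (peval p (X / Z) / peval q (X / Z)) 0"
proof -
  obtain s where "closed_point emb X Y Z r s 1"
    using point_above by blast
  then interpret P: closed_point emb X Y Z r s 1 .
  have x: "P.pl (X / Z) r"
    using P.place_X_Z by simp
  have "P.pl (peval p (X / Z) / peval q (X / Z)) (poly p r / poly q r)"
    using P.place_divide[OF P.place_peval[OF x, of p] P.place_peval[OF x, of q], unfolded complex_self_peval, OF assms(2)] .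
  then show thesis
    using that P.closed_point_axioms assms(1) by simp
qed

text \<open>Numerator and denominator can have no root, since over each root lies an affine point of
  the curve. The behaviour at infinity is left open, so that \<open>degree_zero\<close> can be
  derived from this lemma.\<close>

lemma affine_unit_constant:
  assumes h: "h = peval p (X / Z) / peval q (X / Z)" "p \<noteq> 0" "q \<noteq> 0"
    and unit: "\<And>a b. closed_point emb X Y Z a b 1 \<Longrightarrow> order_at emb X Y Z a b 1 h = 0"
  shows "h \<in> range emb"
proof -
  obtain p' q' where *: "p' \<noteq> 0" "q' \<noteq> 0" "\<And>r. \<not> (poly p' r = 0 \<and> poly q' r = 0)"
    "h = peval p' (X / Z) / peval q' (X / Z)"
    using cancel_common_roots[OF h(2,3)] h(1) by auto
  have hnz: "h \<noteq> 0"
    unfolding *(4) using peval_ratio_nonzero * by simp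
  have "poly p' r \<noteq> 0" for r
  proof
    assume "poly p' r = 0"
    then obtain s where s: "closed_point emb X Y Z r s 1" "place emb X Y Z id r s 1 h 0"
      using rational_zero[of p' r q'] * by metis
    then show False
      using closed_point.place_ord_pos[OF s hnz] unit by fastforce
  qed
  moreover have "poly q' r \<noteq> 0" for r
  proof
    assume "poly q' r = 0"
    then obtain s where s: "closed_point emb X Y Z r s 1" "place emb X Y Z id r s 1 (inverse h) 0"
      using rational_zero[of q' r p'] * by (metis inverse_divide)
    interpret P: closed_point emb X Y Z r s 1 by fact
    have "h \<in> funs"
      using funs_inverse[OF P.place_funs[OF s(2)]] by simp
    then show False
      using P.place_ord_pos[OF s(2)] hnz unit[OF s(1)] P.ord_inverse[of h] by simp
  qed
  ultimately obtain k l where "p' = [:k:]" "q' = [:l:]"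
    using degree_0_if_no_root degree_eq_zeroE by metis
  then have "h = emb (k / l)"
    using * by (simp add: emb_divide)
  then show ?thesis by blast
qed

text \<open>A root of the denominator would be a pole, so h is a polynomial in x; at a point at
  infinity a polynomial of positive degree has a pole.\<close>

lemma regular_rational_constant:
  assumes h: "h = peval p (X / Z) / peval q (X / Z)" "p \<noteq> 0" "q \<noteq> 0"
    and regular: "\<And>a b c. closed_point emb X Y Z a b c \<Longrightarrow> \<exists>g. place emb X Y Z id a b c h g"
  shows "h \<in> range emb"
proof -
  obtain p' q' where *: "p' \<noteq> 0" "q' \<noteq> 0" "\<And>r. \<not> (poly p' r = 0 \<and> poly q' r = 0)"
    "h = peval p' (X / Z) / peval q' (X / Z)"
    using cancel_common_roots[OF h(2,3)] h(1) by auto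
  have "poly q' r \<noteq> 0" for r
  proof
    assume "poly q' r = 0"
    then obtain s where s: "closed_point emb X Y Z r s 1" "place emb X Y Z id r s 1 (inverse h) 0"
      using rational_zero[of q' r p'] * by (metis inverse_divide)
    interpret P: closed_point emb X Y Z r s 1 by fact
    have "h = 0"
      using regular[OF s(1)] P.place_inverse_contra s(2) by blast
    then show False
      using * peval_ratio_nonzero by simp
  qed
  then obtain l where l: "q' = [:l:]" "l \<noteq> 0"
    using degree_0_if_no_root degree_eq_zeroE *(2) by (metis pCons_0_0)
  obtain f where f: "poly f 0 \<noteq> 0" "peval p' (X / Z) = (X / Z) ^ degree p' * peval f (inverse (X / Z))"
    using peval_reverse[OF complex_algebra_axioms *(1), of "X / Z"] by auto
  obtain w where w: "w \<in> \<Omega>" using \<Omega>_nonempty by blast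
  then interpret P: closed_point emb X Y Z w 1 0
    by (rule closed_point_\<Omega>)
  interpret s: closed_point emb Z Y X 0 1 w
    by (rule P.closed_point_swap13)
  have ZX: "P.pl (inverse (X / Z)) 0"
    using s.place_X_Z \<Omega>_nonzero[OF w] by (simp add: place_swap13[of emb X])
  then have unit: "P.pl (peval f (inverse (X / Z))) (poly f 0)"
    using P.place_peval[OF ZX, of f] by (simp only: complex_self_peval)
  obtain g where "P.pl h g"
    using regular[OF P.closed_point_axioms] by blast
  then have "P.pl (h * emb l / peval f (inverse (X / Z))) (g * id l / poly f 0)"
    by (intro P.place_divide P.place_mult P.place_const unit f)
  moreover have "h * emb l / peval f (inverse (X / Z)) = (X / Z) ^ degree p'"
    using *(4) l f(2) P.place_nonzero[OF unit f(1)] by simp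
  ultimately have 1: "P.pl ((X / Z) ^ degree p') (g * id l / poly f 0)"
    by simp
  have "degree p' = 0"
  proof (rule ccontr)
    assume "degree p' \<noteq> 0"
    then have "P.pl (inverse ((X / Z) ^ degree p')) 0"
      using P.place_power[OF ZX, of "degree p'"] by (simp only: power_inverse zero_power neq0_conv)
    from P.place_inverse_contra[OF 1 this] show False by simp
  qed
  then obtain k where "p' = [:k:]"
    by (rule degree_eq_zeroE)
  then have "h = emb (k / l)"
    using * l by (simp add: emb_divide)
  then show ?thesis by blast
qed

lemma place_conj_closed:
  assumes "k ^ 4 = 1" "closed_point emb X Y Z a b c" "r \<in> funs"
  shows "place emb X Y Z id a b c (quartic_conj.\<sigma> emb X Y Z k r) g \<longleftrightarrow> place emb X Y Z id a (k * b) c r g"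
proof -
  interpret c: quartic_conj emb X Y Z k
    by unfold_locales fact
  interpret P: closed_point emb X Y Z a b c by fact
  show ?thesis
    using c.place_conj_iff[OF P.quartic_point_axioms assms(3), of g] id_apply[of k] by (simp only:)
qed

lemma closed_point_conj: "k ^ 4 = 1 \<Longrightarrow> closed_point emb X Y Z a b c \<Longrightarrow> closed_point emb X Y Z a (k * b) c"
  by (rule closed_pointI)
    (auto simp: closed_point_def quartic_point_def quartic_point_axioms_def power_mult_distrib)

text \<open>If \<open>w = u - u(P)\<close> were nonzero, then its norm would be a regular element of \<open>\<complex>(x)\<close>, hence
  a constant, with a zero.\<close>

lemma unit_constant:
  assumes u: "u \<in> funs" "u \<noteq> 0"
    and unit: "\<And>a b c. closed_point emb X Y Z a b c \<Longrightarrow> order_at emb X Y Z a b c u = 0"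
  shows "u \<in> range emb"
proof -
  \<comment> \<open>A cusp with Y = 0 is fixed by every conjugation, so a zero there is shared by
    all conjugates.\<close>
  obtain w where w: "w \<in> \<Omega>" using \<Omega>_nonempty by blast
  then interpret P: closed_point emb X Y Z w 0 1
    by (rule closed_point_\<Omega>)
  obtain l where l: "P.pl u l"
    using P.ord_0_place[OF u unit[OF P.closed_point_axioms]] .
  define v where "v = u - emb l"
  have v: "v \<in> funs"
    using u by (simp add: v_def funs_diff)
  have regular: "\<exists>g. place emb X Y Z id a b c v g" if Q: "closed_point emb X Y Z a b c" for a b c
  proof -
    interpret Q: closed_point emb X Y Z a b c by fact
    obtain g where "Q.pl u g"
      using Q.ord_0_place[OF u unit[OF Q]] .
    then show ?thesis
      unfolding v_def using Q.place_diff[OF _ Q.place_const] by blast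
  qed
  have "v = 0"
  proof (rule ccontr)
    assume "v \<noteq> 0"
    obtain p q where pq: "p \<noteq> 0" "q \<noteq> 0" "norm_fun v = peval p (X / Z) / peval q (X / Z)"
      using norm_fun_rational[OF v \<open>v \<noteq> 0\<close>] .
    have "norm_fun v \<in> range emb"
    proof (rule regular_rational_constant[OF pq(3,1,2)])
      fix a b c assume Q: "closed_point emb X Y Z a b c"
      then interpret Q: closed_point emb X Y Z a b c .
      note conj = place_conj_closed[OF _ Q v] regular[OF closed_point_conj[OF _ Q]]
      have "\<exists>g. Q.pl (c1.\<sigma> v) g" "\<exists>g. Q.pl (c2.\<sigma> v) g" "\<exists>g. Q.pl (c3.\<sigma> v) g"
        using conj fourth_power_i by blast+
      then show "\<exists>g. Q.pl (norm_fun v) g"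
        unfolding norm_fun_def using regular[OF Q] by (blast intro: Q.place_mult)
    qed
    then obtain k where k: "norm_fun v = emb k" by blast
    have v0: "P.pl v 0"
      unfolding v_def using P.place_diff_emb[OF l] .
    have "P.pl (c1.\<sigma> v) 0" "P.pl (c2.\<sigma> v) 0" "P.pl (c3.\<sigma> v) 0"
      using place_conj_closed[OF _ P.closed_point_axioms v, of _ 0] v0 fourth_power_i by simp_all
    then have "P.pl (norm_fun v) (0 * 0 * 0 * 0)"
      unfolding norm_fun_def by (intro P.place_mult v0)
    then have "k = 0"
      using P.place_unique[OF P.place_const[of k]] k by simp
    then show False
      using k norm_fun_nonzero[OF v \<open>v \<noteq> 0\<close>] by simp
  qed
  then show ?thesis
    by (simp add: v_def)
qed

text \<open>Rescaling brings each point to standard coordinates, leaving the points with no zero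
  coordinate and the three classes of cusps. The first conclusion stays off the line at
  infinity.\<close>

lemma unit_on_curveI:
  assumes affine: "\<And>a b. closed_point emb X Y Z a b 1 \<Longrightarrow> a \<noteq> 0 \<Longrightarrow> b \<noteq> 0 \<Longrightarrow> order_at emb X Y Z a b 1 u = 0"
    and "\<And>w. w \<in> \<Omega> \<Longrightarrow> order_at emb X Y Z 0 w 1 u = 0"
    and "\<And>w. w \<in> \<Omega> \<Longrightarrow> order_at emb X Y Z w 0 1 u = 0"
  shows "\<And>a b. closed_point emb X Y Z a b 1 \<Longrightarrow> order_at emb X Y Z a b 1 u = 0"
    and "(\<And>w. w \<in> \<Omega> \<Longrightarrow> order_at emb X Y Z w 1 0 u = 0) \<Longrightarrow> closed_point emb X Y Z a b c
      \<Longrightarrow> order_at emb X Y Z a b c u = 0"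
proof -
  show *: "order_at emb X Y Z a b 1 u = 0" if "closed_point emb X Y Z a b 1" for a b
  proof -
    interpret P: closed_point emb X Y Z a b 1 by fact
    have "a = 0 \<Longrightarrow> b \<in> \<Omega>" "b = 0 \<Longrightarrow> a \<in> \<Omega>"
      using P.point_eq by (auto simp: \<Omega>_def eq_neg_iff_add_eq_0)
    then show ?thesis
      using assms that by metis
  qed
  assume inf: "\<And>w. w \<in> \<Omega> \<Longrightarrow> order_at emb X Y Z w 1 0 u = 0" and "closed_point emb X Y Z a b c"
  then interpret P: closed_point emb X Y Z a b c by simp
  show "order_at emb X Y Z a b c u = 0"
  proof (cases "c = 0")
    case True
    then have b: "b \<noteq> 0"
      using P.point_eq P.point_nonzero by auto
    then have "a / b \<in> \<Omega>"
      using P.point_eq True by (simp add: \<Omega>_def field_simps eq_neg_iff_add_eq_0)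
    then show ?thesis
      using inf[of "a / b"] order_at_homogeneous[OF b, of emb X Y Z "a / b" 1 0] True b by simp
  next
    case False
    then have "closed_point emb X Y Z (a / c) (b / c) 1"
      using P.affine_point_eq by (intro closed_pointI) auto
    then show ?thesis
      using * order_at_homogeneous[OF False, of emb X Y Z "a / c" "b / c" 1] False by simp
  qed
qed

end

section \<open>Functions supported on the cusps\<close>

lemma prod_power_int_exponents:
  "w \<noteq> 0 \<Longrightarrow> (\<Prod>v\<in>S. w powi f v) = (w :: 'a::field) powi (\<Sum>v\<in>S. f v)"
  by (induction S rule: infinite_finite_induct) (simp_all add: power_int_add)

locale cuspidal_function = quartic emb X Y Z for emb :: "complex \<Rightarrow> 'f::field" and X Y Z +
  fixes z :: 'f
  assumes z_funs: "z \<in> funs" and z_nonzero [simp]: "z \<noteq> 0"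
    and z_unit: "closed_point emb X Y Z a b c \<Longrightarrow> a \<noteq> 0 \<Longrightarrow> b \<noteq> 0 \<Longrightarrow> c \<noteq> 0
      \<Longrightarrow> order_at emb X Y Z a b c z = 0"
begin

text \<open>The letter names the coordinate that vanishes at the cusps of the class.\<close>

definition mX :: "complex \<Rightarrow> int" where "mX w = order_at emb X Y Z 0 w 1 z"
definition mY :: "complex \<Rightarrow> int" where "mY w = order_at emb X Y Z w 0 1 z"
definition mZ :: "complex \<Rightarrow> int" where "mZ w = order_at emb X Y Z w 1 0 z"

lemma closed_point_swap12_iff: "closed_point emb Y X Z b a c \<longleftrightarrow> closed_point emb X Y Z a b c"
  using closed_point.closed_point_swap12 by blast

lemma closed_point_swap23_iff: "closed_point emb X Z Y a c b \<longleftrightarrow> closed_point emb X Y Z a b c"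
  using closed_point.closed_point_swap12 closed_point.closed_point_swap13 by blast

lemma cuspidal_swap12: "cuspidal_function emb Y X Z z"
proof -
  interpret s: quartic emb Y X Z by (rule quartic_swap12)
  show ?thesis
  proof
    show "order_at emb Y X Z a b c z = 0" if "closed_point emb Y X Z a b c" "a \<noteq> 0" "b \<noteq> 0" "c \<noteq> 0" for a b c
      using z_unit[of b a c] closed_point_swap12_iff[of a b c] order_at_swap12[of emb Y X Z a b c z] that by simp
  qed (use z_funs funs_swap12 in auto)
qed

lemma cuspidal_swap23: "cuspidal_function emb X Z Y z"
proof -
  interpret s: quartic emb X Z Y by (rule quartic_swap23)
  show ?thesis
  proof
    show "order_at emb X Z Y a b c z = 0" if "closed_point emb X Z Y a b c" "a \<noteq> 0" "b \<noteq> 0" "c \<noteq> 0" for a b c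
      using z_unit[of a c b] closed_point_swap23_iff[of a b c] order_at_swap23[of emb X Z Y a b c z] that by simp
  qed (use z_funs funs_swap23 in auto)
qed

text \<open>Conjugation moves (w : 1 : 0) to (w : k : 0); normalizing the second coordinate to 1
  inverts k.\<close>

lemma order_infinity:
  assumes "k ^ 4 = 1"
  shows "order_at emb X Y Z w k 0 z = mZ (inverse k * w)"
proof -
  have "k \<noteq> 0" using assms by auto
  then show ?thesis
    using order_at_homogeneous[of k emb X Y Z "inverse k * w" 1 0 z] by (simp add: mZ_def mult.assoc[symmetric])
qed

text \<open>The lines \<open>y = w\<close>, \<open>x = w\<close>, \<open>x = w y\<close> are the tangents at the cusps, where they meet the curve
  four times.\<close>

definition tangent_prod :: 'f where
  "tangent_prod = (\<Prod>w\<in>\<Omega>. (Y / Z - emb w) powi mX w) * (\<Prod>w\<in>\<Omega>. (X / Z - emb w) powi mY w)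
     * (\<Prod>w\<in>\<Omega>. (X / Z - emb w * (Y / Z)) powi mZ w)"

text \<open>The expected norm of z. The four cusps with X = 0 are permuted by Y -> iY, so at each of
  them the norm has the degree of the whole class as its order, and x has order 1. The cusps with Y
  = 0 are fixed, so the norm has order 4 \<open>mY w\<close>, and x - w has order 4.\<close>

definition norm_prod :: 'f where
  "norm_prod = (X / Z) powi (\<Sum>w\<in>\<Omega>. mX w) * (\<Prod>w\<in>\<Omega>. (X / Z - emb w) powi mY w)"

lemma X_diff_funs: "X / Z - emb w \<in> funs" "X / Z - emb w \<noteq> 0"
  using funs_X_Z ratio_nonconstant by (auto intro: funs_diff)

lemma Y_diff_funs: "Y / Z - emb w \<in> funs" "Y / Z - emb w \<noteq> 0"
proof -
  show "Y / Z - emb w \<in> funs"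
    by (intro funs_diff funs_Y_Z funs_const)
  show "Y / Z - emb w \<noteq> 0"
    using second_nonconstant[of w] by (simp add: field_simps)
qed

lemma X_diff_Y_funs: "X / Z - emb w * (Y / Z) \<in> funs" "X / Z - emb w * (Y / Z) \<noteq> 0"
proof -
  interpret s: quartic emb X Z Y by (rule quartic_swap23)
  show "X / Z - emb w * (Y / Z) \<in> funs"
    by (intro funs_diff funs_mult funs_X_Z funs_Y_Z funs_const)
  show "X / Z - emb w * (Y / Z) \<noteq> 0"
    using s.nonconstant[of w] by (simp add: field_simps)
qed

lemma powi_prod_funs:
  assumes "\<And>w. r w \<in> funs" "\<And>w. r w \<noteq> 0"
  shows "(\<Prod>w\<in>\<Omega>. r w powi (f w :: int)) \<in> funs" "(\<Prod>w\<in>\<Omega>. r w powi f w) \<noteq> 0"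
  using assms by (auto intro: funs_prod funs_power_int)

lemmas prods_funs = powi_prod_funs[OF X_diff_funs] powi_prod_funs[OF Y_diff_funs] powi_prod_funs[OF X_diff_Y_funs]

lemma tangent_prod_funs: "tangent_prod \<in> funs" "tangent_prod \<noteq> 0"
  unfolding tangent_prod_def by (simp_all only: funs_mult prods_funs mult_eq_0_iff simp_thms)

lemma norm_prod_funs: "norm_prod \<in> funs" "norm_prod \<noteq> 0"
proof -
  show "norm_prod \<in> funs"
    unfolding norm_prod_def by (intro funs_mult funs_power_int funs_X_Z prods_funs)
  show "norm_prod \<noteq> 0"
    unfolding norm_prod_def by (simp only: prods_funs mult_eq_0_iff power_int_eq_0_iff) simp
qed

lemma ord_powi_prod:
  assumes "closed_point emb X Y Z a b c" "\<And>w. r w \<in> funs" "\<And>w. r w \<noteq> 0"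
    and "\<And>w. w \<in> \<Omega> \<Longrightarrow> order_at emb X Y Z a b c (r w) = g w"
  shows "order_at emb X Y Z a b c (\<Prod>w\<in>\<Omega>. r w powi f w) = (\<Sum>w\<in>\<Omega>. f w * g w)"
proof -
  interpret P: closed_point emb X Y Z a b c by fact
  show ?thesis
    using assms by (simp add: P.ord_prod funs_power_int P.ord_power_int)
qed

lemma ord_tangent_prod:
  assumes "closed_point emb X Y Z a b c"
    and "\<And>w. w \<in> \<Omega> \<Longrightarrow> order_at emb X Y Z a b c (Y / Z - emb w) = gX w"
    and "\<And>w. w \<in> \<Omega> \<Longrightarrow> order_at emb X Y Z a b c (X / Z - emb w) = gY w"
    and "\<And>w. w \<in> \<Omega> \<Longrightarrow> order_at emb X Y Z a b c (X / Z - emb w * (Y / Z)) = gZ w"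
  shows "order_at emb X Y Z a b c tangent_prod =
    (\<Sum>w\<in>\<Omega>. mX w * gX w) + (\<Sum>w\<in>\<Omega>. mY w * gY w) + (\<Sum>w\<in>\<Omega>. mZ w * gZ w)"
proof -
  interpret P: closed_point emb X Y Z a b c by fact
  show ?thesis
    unfolding tangent_prod_def
    by (simp only: P.ord_mult funs_mult prods_funs mult_eq_0_iff simp_thms
        ord_powi_prod[OF assms(1) X_diff_funs assms(3)] ord_powi_prod[OF assms(1) Y_diff_funs assms(2)]
        ord_powi_prod[OF assms(1) X_diff_Y_funs assms(4)])
qed

lemma ord_norm_prod:
  assumes "closed_point emb X Y Z a b c"
    and "\<And>w. w \<in> \<Omega> \<Longrightarrow> order_at emb X Y Z a b c (X / Z - emb w) = gY w"
  shows "order_at emb X Y Z a b c norm_prod =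
    (\<Sum>w\<in>\<Omega>. mX w) * order_at emb X Y Z a b c (X / Z) + (\<Sum>w\<in>\<Omega>. mY w * gY w)"
proof -
  interpret P: closed_point emb X Y Z a b c by fact
  have "X / Z \<noteq> 0" by simp
  then show ?thesis
    unfolding norm_prod_def
    using P.ord_mult[OF funs_power_int[OF funs_X_Z] _ prods_funs(1,2)]
    by (simp only: P.ord_power_int[OF funs_X_Z] ord_powi_prod[OF assms(1) X_diff_funs assms(2)]
        power_int_eq_0_iff simp_thms)
qed

lemma ord_norm_fun:
  assumes "closed_point emb X Y Z a b c"
  shows "order_at emb X Y Z a b c (norm_fun z) = order_at emb X Y Z a b c z
     + order_at emb X Y Z a (\<i> * b) c z + order_at emb X Y Z a (- b) c z + order_at emb X Y Z a (- \<i> * b) c z"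
proof -
  interpret P: closed_point emb X Y Z a b c by fact
  interpret c1: quartic_conj emb X Y Z \<i>
    by unfold_locales (simp add: fourth_power_i)
  interpret c2: quartic_conj emb X Y Z "- 1"
    by unfold_locales (simp add: fourth_power_i)
  interpret c3: quartic_conj emb X Y Z "- \<i>"
    by unfold_locales (simp only: fourth_power_i)
  show ?thesis
    unfolding norm_fun_def
    using z_funs
    by (simp add: P.ord_mult funs_mult c1.\<sigma>_funs c2.\<sigma>_funs c3.\<sigma>_funs c1.\<sigma>_nonzero c2.\<sigma>_nonzero c3.\<sigma>_nonzero
        c1.order_at_conj[OF assms] c2.order_at_conj[OF assms] c3.order_at_conj[OF assms])
qed

lemma sum_\<Omega>_conj:
  fixes f :: "complex \<Rightarrow> int"
  assumes "w \<in> \<Omega>"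
  shows "f w + f (\<i> * w) + f (- w) + f (- \<i> * w) = sum f \<Omega>"
  using sum_\<Omega>[OF assms, of f] by simp

text \<open>The quotient of the two functions lies in \<complex>(x) and has order 0 at all affine
  points, hence is constant. Comparing orders at one point at infinity then yields the degree
  formula.\<close>

lemma norm_fun_constant: "\<exists>l. l \<noteq> 0 \<and> norm_fun z = emb l * norm_prod"
  and degree_zero: "(\<Sum>w\<in>\<Omega>. mX w) + (\<Sum>w\<in>\<Omega>. mY w) + (\<Sum>w\<in>\<Omega>. mZ w) = 0"
proof -
  have N: "norm_fun z \<in> funs" "norm_fun z \<noteq> 0"
    using norm_fun_funs norm_fun_nonzero z_funs by auto
  have h_ord: "order_at emb X Y Z a b c (norm_fun z / norm_prod) =
      order_at emb X Y Z a b c (norm_fun z) - order_at emb X Y Z a b c norm_prod"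
    if "closed_point emb X Y Z a b c" for a b c
    using closed_point.ord_divide[OF that N norm_prod_funs] .
  obtain p q where pq: "p \<noteq> 0" "q \<noteq> 0" "norm_fun z / norm_prod = peval p (X / Z) / peval q (X / Z)"
  proof -
    obtain p q where pq: "p \<noteq> 0" "q \<noteq> 0" "norm_fun z = peval p (X / Z) / peval q (X / Z)"
      using norm_fun_rational[OF z_funs z_nonzero] .
    have rat_mult: "\<exists>p q. p \<noteq> 0 \<and> q \<noteq> 0 \<and> r * s = peval p (X / Z) / peval q (X / Z)"
      if "\<exists>p q. p \<noteq> 0 \<and> q \<noteq> 0 \<and> r = peval p (X / Z) / peval q (X / Z)"
        "\<exists>p q. p \<noteq> 0 \<and> q \<noteq> 0 \<and> s = peval p (X / Z) / peval q (X / Z)" for r s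
    proof -
      from that obtain p q p' q' where "p \<noteq> 0" "q \<noteq> 0" "p' \<noteq> 0" "q' \<noteq> 0"
        "r = peval p (X / Z) / peval q (X / Z)" "s = peval p' (X / Z) / peval q' (X / Z)"
        by blast
      then show ?thesis
        by (intro exI[of _ "p * p'"] exI[of _ "q * q'"]) auto
    qed
    have rat_powi: "\<exists>p q. p \<noteq> 0 \<and> q \<noteq> 0 \<and> peval r (X / Z) powi n = peval p (X / Z) / peval q (X / Z)"
      if "r \<noteq> 0" for r n
    proof (cases "n \<ge> 0")
      case True
      then show ?thesis
        using that by (intro exI[of _ "r ^ nat n"] exI[of _ 1]) (auto simp: power_int_def)
    next
      case False
      then show ?thesis
        using that by (intro exI[of _ 1] exI[of _ "r ^ nat (- n)"]) (auto simp: power_int_def field_simps)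
    qed
    have "\<exists>p q. p \<noteq> 0 \<and> q \<noteq> 0 \<and> (\<Prod>w\<in>S. (X / Z - emb w) powi mY w) = peval p (X / Z) / peval q (X / Z)"
      if "finite S" for S
      using that
    proof (induction S rule: finite_induct)
      case empty
      show ?case
        by (intro exI[of _ 1]) simp
    next
      case (insert w S)
      have *: "\<exists>p q. p \<noteq> 0 \<and> q \<noteq> 0 \<and> (X / Z - emb w) powi mY w = peval p (X / Z) / peval q (X / Z)"
        using rat_powi[of "[:- w, 1:]" "mY w"] by (simp add: emb_minus)
      show ?case
        unfolding prod.insert[OF insert.hyps] by (rule rat_mult[OF * insert.IH])
    qed
    moreover have "\<exists>p q. p \<noteq> 0 \<and> q \<noteq> 0 \<and> (X / Z) powi n = peval p (X / Z) / peval q (X / Z)" for n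
      using rat_powi[of "[:0, 1:]" n] by simp
    ultimately obtain p' q' where pq': "p' \<noteq> 0" "q' \<noteq> 0" "norm_prod = peval p' (X / Z) / peval q' (X / Z)"
      unfolding norm_prod_def using rat_mult finite_\<Omega> by meson
    show thesis
      by (rule that[of "p * q'" "q * p'"]) (use pq pq' in auto)
  qed
  have affine: "order_at emb X Y Z a b 1 (norm_fun z / norm_prod) = 0" if P: "closed_point emb X Y Z a b 1" for a b
  proof (rule unit_on_curveI(1)[OF _ _ _ P])
    fix a b :: complex assume *: "closed_point emb X Y Z a b 1" "a \<noteq> 0" "b \<noteq> 0"
    interpret P: closed_point emb X Y Z a b 1 by fact
    have conj: "order_at emb X Y Z a (k * b) 1 z = 0" if "k ^ 4 = 1" for k
      using z_unit[OF closed_point_conj[OF that *(1)]] that * by (cases "k = 0") auto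
    have "P.ord (norm_fun z) = 0"
      using ord_norm_fun[OF *(1)] z_unit[OF * zero_neq_one[symmetric]] conj[OF fourth_power_i(1)]
        conj[OF fourth_power_i(2)] conj[OF fourth_power_i(3)] by simp
    moreover have "P.ord norm_prod = 0"
      using ord_norm_prod[OF *(1), of "\<lambda>_. 0"] P.ord_X_diff(1) * P.ord_X_Z by simp
    ultimately show "P.ord (norm_fun z / norm_prod) = 0"
      using h_ord[OF *(1)] by simp
  next
    fix w assume w: "w \<in> \<Omega>"
    note P = closed_point_\<Omega>(1)[OF w]
    interpret P: closed_point emb X Y Z 0 w 1 by (rule P)
    have "P.ord (norm_fun z) = (\<Sum>w\<in>\<Omega>. mX w)"
      using ord_norm_fun[OF P] sum_\<Omega>_conj[OF w, of mX] by (simp add: mX_def)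
    moreover have "P.ord norm_prod = (\<Sum>w\<in>\<Omega>. mX w)"
      using ord_norm_prod[OF P, of "\<lambda>_. 0"] P.ord_X_diff(1) P.ord_X_Z_zero \<Omega>_nonzero[OF w] by simp
    ultimately show "P.ord (norm_fun z / norm_prod) = 0"
      using h_ord[OF P] by simp
  next
    fix w assume w: "w \<in> \<Omega>"
    note P = closed_point_\<Omega>(2)[OF w]
    interpret P: closed_point emb X Y Z w 0 1 by (rule P)
    have "P.ord (norm_fun z) = 4 * mY w"
      using ord_norm_fun[OF P] by (simp add: mY_def)
    moreover have "P.ord norm_prod = mY w * 4"
      using ord_norm_prod[OF P, of "\<lambda>v. if w = v then 4 else 0"] P.ord_X_diff(2) P.ord_X_Z \<Omega>_nonzero[OF w]
      by (simp add: sum_delta_\<Omega>[OF w])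
    ultimately show "P.ord (norm_fun z / norm_prod) = 0"
      using h_ord[OF P] by simp
  qed
  have "norm_fun z / norm_prod \<in> range emb"
    using affine_unit_constant[OF pq(3,1,2) affine] .
  then obtain l where l: "norm_fun z / norm_prod = emb l"
    by blast
  then have "l \<noteq> 0" "norm_fun z = emb l * norm_prod"
    using N norm_prod_funs(2) by (auto simp: field_simps)
  then show "\<exists>l. l \<noteq> 0 \<and> norm_fun z = emb l * norm_prod"
    by blast
  obtain w where w: "w \<in> \<Omega>"
    using \<Omega>_nonempty by blast
  note P = closed_point_\<Omega>(3)[OF w]
  interpret P: closed_point emb X Y Z w 1 0 by (rule P)
  have "P.ord (norm_fun z / norm_prod) = 0"
    unfolding l using \<open>l \<noteq> 0\<close> by (intro P.ord_unit[OF P.place_const]) simp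
  then have "P.ord (norm_fun z) = P.ord norm_prod"
    using h_ord[OF P] by simp
  moreover have "P.ord norm_prod = - (\<Sum>w\<in>\<Omega>. mX w) - (\<Sum>w\<in>\<Omega>. mY w)"
    using ord_norm_prod[OF P, of "\<lambda>_. - 1"] P.ord_X_diff_pole P.ord_X_Z_pole by (simp add: sum_negf)
  moreover have "P.ord (norm_fun z) = (\<Sum>w\<in>\<Omega>. mZ w)"
    using ord_norm_fun[OF P] sum_\<Omega>_conj[OF w, of mZ] order_infinity[of \<i> w] order_infinity[of "- 1" w]
      order_infinity[of "- \<i>" w] fourth_power_i by (simp add: mZ_def)
  ultimately show "(\<Sum>w\<in>\<Omega>. mX w) + (\<Sum>w\<in>\<Omega>. mY w) + (\<Sum>w\<in>\<Omega>. mZ w) = 0"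
    by simp
qed

text \<open>At an affine cusp only its own tangent contributes, with order 4. At infinity every line
  contributes -1; these cancel by \<open>degree_zero\<close>, and the tangent at the cusp leaves 4
  \<open>mZ w\<close>.\<close>

lemma fourth_power_constant: "\<exists>l. l \<noteq> 0 \<and> z ^ 4 = emb l * tangent_prod"
proof -
  have z4: "z ^ 4 \<in> funs" "z ^ 4 \<noteq> 0"
    using z_funs by (auto intro: funs_power)
  have h_ord: "order_at emb X Y Z a b c (z ^ 4 / tangent_prod) =
      4 * order_at emb X Y Z a b c z - order_at emb X Y Z a b c tangent_prod"
    if "closed_point emb X Y Z a b c" for a b c
    using closed_point.ord_divide[OF that z4 tangent_prod_funs] closed_point.ord_power[OF that z_funs z_nonzero, of 4]
    by simp
  have "z ^ 4 / tangent_prod \<in> range emb"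
  proof (rule unit_constant)
    show "z ^ 4 / tangent_prod \<in> funs" "z ^ 4 / tangent_prod \<noteq> 0"
      using z4 tangent_prod_funs by (auto intro: funs_divide)
    fix a b c assume "closed_point emb X Y Z a b c"
    then show "order_at emb X Y Z a b c (z ^ 4 / tangent_prod) = 0"
    proof (rule unit_on_curveI(2)[rotated 4])
      fix a b :: complex assume *: "closed_point emb X Y Z a b 1" "a \<noteq> 0" "b \<noteq> 0"
      interpret P: closed_point emb X Y Z a b 1 by fact
      have "P.ord tangent_prod = 0"
        using ord_tangent_prod[OF *(1), of "\<lambda>_. 0" "\<lambda>_. 0" "\<lambda>_. 0"]
          P.ord_X_diff(1) P.ord_Y_diff(1) P.ord_X_diff_Y(1) * by simp
      then show "P.ord (z ^ 4 / tangent_prod) = 0"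
        using h_ord[OF *(1)] z_unit[OF *(1)] * by simp
    next
      fix w assume w: "w \<in> \<Omega>"
      note P = closed_point_\<Omega>(1)[OF w]
      interpret P: closed_point emb X Y Z 0 w 1 by (rule P)
      have "P.ord tangent_prod = 4 * mX w"
        using ord_tangent_prod[OF P, of "\<lambda>v. if w = v then 4 else 0" "\<lambda>_. 0" "\<lambda>_. 0"]
          P.ord_X_diff(1) P.ord_Y_diff(2) P.ord_X_diff_Y(1) \<Omega>_nonzero[OF w]
        by (simp add: sum_delta_\<Omega>[OF w])
      then show "P.ord (z ^ 4 / tangent_prod) = 0"
        using h_ord[OF P] by (simp add: mX_def)
    next
      fix w assume w: "w \<in> \<Omega>"
      note P = closed_point_\<Omega>(2)[OF w]
      interpret P: closed_point emb X Y Z w 0 1 by (rule P)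
      have "P.ord tangent_prod = 4 * mY w"
        using ord_tangent_prod[OF P, of "\<lambda>_. 0" "\<lambda>v. if w = v then 4 else 0" "\<lambda>_. 0"]
          P.ord_X_diff(2) P.ord_Y_diff(1) P.ord_X_diff_Y(1) \<Omega>_nonzero[OF w]
        by (simp add: sum_delta_\<Omega>[OF w])
      then show "P.ord (z ^ 4 / tangent_prod) = 0"
        using h_ord[OF P] by (simp add: mY_def)
    next
      fix w assume w: "w \<in> \<Omega>"
      note P = closed_point_\<Omega>(3)[OF w]
      interpret P: closed_point emb X Y Z w 1 0 by (rule P)
      have "P.ord tangent_prod = (\<Sum>v\<in>\<Omega>. mX v * - 1) + (\<Sum>v\<in>\<Omega>. mY v * - 1)
          + (\<Sum>v\<in>\<Omega>. mZ v * ((if w = v then 4 else 0) - 1))"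
        using P.ord_X_diff_pole P.ord_Y_diff(3) P.ord_X_diff_Y(2)
        by (intro ord_tangent_prod[OF P]) auto
      also have "\<dots> = 4 * mZ w"
        using degree_zero
        by (simp only: right_diff_distrib sum_subtractf sum_delta_\<Omega>[OF w]) (simp add: sum_negf)
      finally show "P.ord (z ^ 4 / tangent_prod) = 0"
        using h_ord[OF P] by (simp add: mZ_def)
    qed
  qed
  then obtain l where l: "z ^ 4 / tangent_prod = emb l" by blast
  then have "l \<noteq> 0" "z ^ 4 = emb l * tangent_prod"
    using z4 tangent_prod_funs(2) by (auto simp: field_simps)
  then show ?thesis by blast
qed

section \<open>Leading coefficients at the cusps with Y = 0\<close>

text \<open>The quotient of \<open>z ^ 4\<close> by the norm of \<open>z\<close> is computed in two ways at the cusps \<open>(w : 0 : 1)\<close>,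
  which the automorphisms \<open>Y \<mapsto> k Y\<close> fix, multiplying the uniformizer \<open>Y / Z\<close> by \<open>k\<close>.\<close>

lemma reciprocity:
  "\<exists>C. \<forall>w\<in>\<Omega>. (- 1) powi mY w = C * w powi ((\<Sum>v\<in>\<Omega>. mX v) - (\<Sum>v\<in>\<Omega>. mZ v))"
proof -
  interpret c1: quartic_conj emb X Y Z \<i>
    by unfold_locales (simp add: fourth_power_i)
  interpret c2: quartic_conj emb X Y Z "- 1"
    by unfold_locales (simp add: fourth_power_i)
  interpret c3: quartic_conj emb X Y Z "- \<i>"
    by unfold_locales (simp only: fourth_power_i)
  obtain l where l: "l \<noteq> 0" "norm_fun z = emb l * norm_prod"
    using norm_fun_constant by blast
  obtain m where m: "m \<noteq> 0" "z ^ 4 = emb m * tangent_prod"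
    using fourth_power_constant by blast
  let ?\<alpha> = "\<Sum>v\<in>\<Omega>. mX v" and ?\<gamma> = "\<Sum>v\<in>\<Omega>. mZ v"
  \<comment> \<open>The value at the cusp of the lines y = v. Like l and m it does not depend on the
    cusp, so it goes into the constant of the law.\<close>
  define K where "K = (\<Prod>v\<in>\<Omega>. (- v) powi mX v)"
  \<comment> \<open>The quotient of \<open>tangent_prod\<close> by \<open>norm_prod\<close>. The
    lines x = w, which alone vanish at the cusps (w : 0 : 1), have cancelled, so G is a unit
    there.\<close>
  define G where "G = (\<Prod>w\<in>\<Omega>. (Y / Z - emb w) powi mX w)
      * (\<Prod>w\<in>\<Omega>. (X / Z - emb w * (Y / Z)) powi mZ w) / (X / Z) powi ?\<alpha>"
  have "K \<noteq> 0"
    by (simp add: K_def \<Omega>_nonzero)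
  have tang: "tangent_prod = norm_prod * G"
  proof -
    have "A * B * D = C * B * (A * D / C)" if "C \<noteq> 0" for A B C D :: 'f
      using that by simp
    then show ?thesis
      unfolding tangent_prod_def norm_prod_def G_def by simp
  qed
  have "(- 1) powi mY w = l / (m * K) * w powi (?\<alpha> - ?\<gamma>)" if w: "w \<in> \<Omega>" for w
  proof -
    note P = closed_point_\<Omega>(2)[OF w]
    interpret P: closed_point emb X Y Z w 0 1 by (rule P)
    have w0: "w \<noteq> 0"
      using \<Omega>_nonzero[OF w] .
    define n where "n = mY w"
    obtain v h where v: "P.pl v h" "h \<noteq> 0" "z = (Y / Z) powi n * v"
      using P.has_order_unif[OF P.has_order_ord[OF z_funs z_nonzero] P.uniformizes_Y[OF refl]]
      by (auto simp: n_def mY_def)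
    have vf: "v \<in> funs"
      using P.place_funs[OF v(1)] .
    have "P.pl (c1.\<sigma> v) h" "P.pl (c2.\<sigma> v) h" "P.pl (c3.\<sigma> v) h"
      using place_conj_closed[OF _ P vf, of _ h] v(1) fourth_power_i by simp_all
    then have V: "P.pl (v * c1.\<sigma> v * c2.\<sigma> v * c3.\<sigma> v) (h * h * h * h)"
      using v(1) by (intro P.place_mult)
    have "norm_fun z = (emb \<i> * emb (- 1) * emb (- \<i>)) powi n * ((Y / Z) powi n) ^ 4 * (v * c1.\<sigma> v * c2.\<sigma> v * c3.\<sigma> v)"
      unfolding norm_fun_def v(3) using vf funs_Y_Z
      by (simp add: c1.\<sigma>_mult c2.\<sigma>_mult c3.\<sigma>_mult c1.\<sigma>_power_int c2.\<sigma>_power_int c3.\<sigma>_power_int funs_power_int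
          c1.\<sigma>_Y_Z c2.\<sigma>_Y_Z c3.\<sigma>_Y_Z power_int_mult_distrib mult_ac eval_nat_numeral del: times_divide_eq_right times_divide_eq_left)
    \<comment> \<open>The origin of the sign: the product of the factors by which the three
      conjugations multiply Y/Z.\<close>
    moreover have "emb \<i> * emb (- 1) * emb (- \<i>) = emb (- 1)"
      by (simp flip: emb_mult)
    moreover have "z ^ 4 = ((Y / Z) powi n) ^ 4 * v ^ 4"
      unfolding v(3) by (rule power_mult_distrib)
    ultimately have "norm_fun z * v ^ 4 = emb (- 1) powi n * z ^ 4 * (v * c1.\<sigma> v * c2.\<sigma> v * c3.\<sigma> v)"
      by (simp only: mult_ac)
    then have "norm_prod * (emb l * v ^ 4) =
        norm_prod * (emb (- 1) powi n * (emb m * G) * (v * c1.\<sigma> v * c2.\<sigma> v * c3.\<sigma> v))"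
      unfolding l(2) m(2) tang by (simp only: mult_ac)
    \<comment> \<open>Cancelling \<open>norm_prod\<close>, of order 4n at the cusp, leaves only
      factors with a nonzero value there, so both sides can be evaluated.\<close>
    then have eq: "emb l * v ^ 4 = emb (- 1) powi n * (emb m * G) * (v * c1.\<sigma> v * c2.\<sigma> v * c3.\<sigma> v)"
      using norm_prod_funs(2) by (simp only: mult_cancel_left simp_thms)
    define g where "g = (\<Prod>v\<in>\<Omega>. (0 - id v) powi mX v) * (\<Prod>v\<in>\<Omega>. (w - id v * 0) powi mZ v) / w powi ?\<alpha>"
    have xy: "P.pl (X / Z) w" "P.pl (Y / Z) 0"
      using P.place_X_Z P.place_Y_Z by simp_all
    have G: "P.pl G g"
      unfolding G_def g_def
      by (intro P.place_divide P.place_mult P.place_prod P.place_power_int P.place_diff xy P.place_const finite_\<Omega>)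
        (use w0 \<Omega>_nonzero in auto)
    have "(\<Prod>v\<in>\<Omega>. w powi mZ v) = w powi ?\<gamma>"
      using w0 by (simp add: prod_power_int_exponents)
    then have g: "g = K * w powi (?\<gamma> - ?\<alpha>)"
      using w0 by (simp add: g_def K_def power_int_diff)
    have "P.pl (emb l * v ^ 4) (id l * h ^ 4)"
      by (intro P.place_mult P.place_power P.place_const v(1))
    moreover have "P.pl (emb (- 1) powi n * (emb m * G) * (v * c1.\<sigma> v * c2.\<sigma> v * c3.\<sigma> v))
        (id (- 1) powi n * (id m * g) * (h * h * h * h))"
      by (intro P.place_mult P.place_power_int P.place_const V[unfolded mult.assoc] G V) simp_all
    ultimately have "l * h ^ 4 = (- 1) powi n * (m * g) * (h * h * h * h)"
      using P.place_unique eq by (metis id_apply)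
    then have "l = (- 1) powi n * (m * g)"
      using v(2) by (simp add: eval_nat_numeral)
    then show ?thesis
      using m(1) \<open>K \<noteq> 0\<close> w0 by (simp add: g n_def power_int_diff field_simps)
  qed
  then show ?thesis
    by blast
qed

text \<open>The quotient of \<sigma> z by z has order 0 everywhere: on the two moved classes by
  hypothesis, on the class Y = 0 because its cusps are fixed. At each fixed cusp its constant value
  is k to the power \<open>mY w\<close>, as the uniformizer Y/Z is multiplied by k.\<close>

lemma invariant_divisor:
  assumes k: "k ^ 4 = 1" and inv: "\<And>w. w \<in> \<Omega> \<Longrightarrow> mX (k * w) = mX w" "\<And>w. w \<in> \<Omega> \<Longrightarrow> mZ (k * w) = mZ w"
  shows "\<exists>C. \<forall>w\<in>\<Omega>. k powi mY w = C"
proof -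
  interpret c: quartic_conj emb X Y Z k
    by unfold_locales fact
  have k0: "k \<noteq> 0" using k by auto
  have sz: "c.\<sigma> z \<in> funs" "c.\<sigma> z \<noteq> 0"
    using z_funs c.\<sigma>_funs c.\<sigma>_nonzero by auto
  have h_ord: "order_at emb X Y Z a b c (c.\<sigma> z / z) = order_at emb X Y Z a (k * b) c z - order_at emb X Y Z a b c z"
    if "closed_point emb X Y Z a b c" for a b c
    using closed_point.ord_divide[OF that sz z_funs z_nonzero] c.order_at_conj[OF that z_funs z_nonzero] by simp
  have "c.\<sigma> z / z \<in> range emb"
  proof (rule unit_constant)
    show "c.\<sigma> z / z \<in> funs" "c.\<sigma> z / z \<noteq> 0"
      using sz z_funs by (auto intro: funs_divide)
    fix a b c assume "closed_point emb X Y Z a b c"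
    then show "order_at emb X Y Z a b c (c.\<sigma> z / z) = 0"
    proof (rule unit_on_curveI(2)[rotated 4])
      fix a b :: complex assume *: "closed_point emb X Y Z a b 1" "a \<noteq> 0" "b \<noteq> 0"
      then show "order_at emb X Y Z a b 1 (c.\<sigma> z / z) = 0"
        using h_ord[OF *(1)] z_unit[OF *(1)] z_unit[OF closed_point_conj[OF k *(1)]] k0 by simp
    next
      fix w assume w: "w \<in> \<Omega>"
      then show "order_at emb X Y Z 0 w 1 (c.\<sigma> z / z) = 0"
        using h_ord[OF closed_point_\<Omega>(1)[OF w]] inv(1)[OF w] by (simp add: mX_def)
    next
      fix w assume w: "w \<in> \<Omega>"
      then show "order_at emb X Y Z w 0 1 (c.\<sigma> z / z) = 0"
        using h_ord[OF closed_point_\<Omega>(2)[OF w]] by simp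
    next
      fix w assume w: "w \<in> \<Omega>"
      \<comment> \<open>The parameter at infinity moves by \<open>inverse k\<close>, so the
        invariance is used at the moved parameter.\<close>
      have "mZ (k * (inverse k * w)) = mZ (inverse k * w)"
        using k by (intro inv(2) \<Omega>_mult w) (simp add: power_inverse)
      then show "order_at emb X Y Z w 1 0 (c.\<sigma> z / z) = 0"
        using h_ord[OF closed_point_\<Omega>(3)[OF w]] order_infinity[OF k, of w] k0
        by (simp add: mZ_def mult.assoc[symmetric])
    qed
  qed
  then obtain l where l: "c.\<sigma> z = emb l * z"
    by (auto simp: field_simps)
  have "k powi mY w = l" if w: "w \<in> \<Omega>" for w
  proof -
    note P = closed_point_\<Omega>(2)[OF w]
    interpret P: closed_point emb X Y Z w 0 1 by (rule P)
    define n where "n = mY w"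
    obtain v h where v: "P.pl v h" "h \<noteq> 0" "z = (Y / Z) powi n * v"
      using P.has_order_unif[OF P.has_order_ord[OF z_funs z_nonzero] P.uniformizes_Y[OF refl]]
      by (auto simp: n_def mY_def)
    have vf: "v \<in> funs"
      using P.place_funs[OF v(1)] .
    have sv: "P.pl (c.\<sigma> v) h"
      using place_conj_closed[OF k P vf, of h] v(1) by simp
    have "c.\<sigma> z = (Y / Z) powi n * (emb k powi n * c.\<sigma> v)"
      unfolding v(3) using vf funs_Y_Z
      by (simp add: c.\<sigma>_mult c.\<sigma>_power_int funs_power_int c.\<sigma>_Y_Z power_int_mult_distrib mult_ac
          del: times_divide_eq_right times_divide_eq_left)
    then have "(Y / Z) powi n * (emb k powi n * c.\<sigma> v) = (Y / Z) powi n * (emb l * v)"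
      using l v(3) by (simp only: mult.left_commute)
    then have "emb k powi n * c.\<sigma> v = emb l * v"
      by simp
    moreover have "P.pl (emb k powi n * c.\<sigma> v) (id k powi n * h)"
      using k0 by (intro P.place_mult P.place_power_int P.place_const sv) simp
    moreover have "P.pl (emb l * v) (id l * h)"
      by (intro P.place_mult P.place_const v)
    ultimately have "k powi n * h = l * h"
      using P.place_unique by (metis id_apply)
    then show ?thesis
      using v(2) by (simp add: n_def)
  qed
  then show ?thesis by blast
qed

end

section \<open>Square norms of divisors\<close>

lemma minus_one_powi: "(- 1 :: complex) powi n = (if even n then 1 else - 1)"
  by (auto simp: power_int_minus_left)

lemma i_powi_even: "\<i> powi (2 * e) = (- 1) powi e"
  using power_int_mult[of \<i> 2 e] by simp

lemma i_powi_odd: "\<i> powi (2 * e + 1) = (- 1) powi e * \<i>"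
  by (simp add: power_int_add i_powi_even)

text \<open>Modulo 2 the entries alternate between x0 and x0 + e, and adding an even number to an
  entry changes its square by an even multiple of it plus a multiple of 4. Summing gives 2 e^2
  modulo 4, and e^2 has the parity of e.\<close>

lemma sum_squares_mod_4:
  fixes x0 x1 x2 x3 e :: int
  assumes "even (x1 - x0 - e)" "even (x2 - x1 - e)" "even (x3 - x2 - e)"
  shows "4 dvd (x0 ^ 2 + x1 ^ 2 + x2 ^ 2 + x3 ^ 2 - 2 * e)"
proof -
  obtain a b c where "x1 - x0 - e = 2 * a" "x2 - x1 - e = 2 * b" "x3 - x2 - e = 2 * c"
    using assms by (elim evenE)
  then obtain g h where x: "x1 = x0 + e + 2 * a" "x2 = x0 + 2 * h" "x3 = x0 + e + 2 * g"
    using that[of "e + a + b" "e + a + b + c"] by simp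
  have "even (e * (e - 1))"
    by simp
  then obtain f where f: "e * (e - 1) = 2 * f" ..
  have eq: "x0 ^ 2 + x1 ^ 2 + x2 ^ 2 + x3 ^ 2 - 2 * e = 4 * (x0 ^ 2 + x0 * e + a * (x0 + e) + a ^ 2 + h * x0 + h ^ 2
      + g * (x0 + e) + g ^ 2) + 2 * (e * (e - 1))"
    unfolding x by (simp add: power2_eq_square algebra_simps)
  show ?thesis
    unfolding eq f by (rule dvd_add) simp_all
qed

lemma square_le_4: "(x::int) ^ 2 \<le> 4 \<Longrightarrow> x \<in> {-2, -1, 0, 1, 2}"
  using abs_le_square_iff[of x 2] by auto

lemma square_le_2: "(x::int) ^ 2 \<le> 2 \<Longrightarrow> x \<in> {-1, 0, 1}"
  using square_le_4[of x] by auto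

lemma congruent_small:
  fixes x y :: int
  assumes "x ^ 2 \<le> 4" "y ^ 2 \<le> 4" "4 dvd (y - x)"
  shows "y = x \<or> x ^ 2 + y ^ 2 = 8"
  using assms(3) square_le_4[OF assms(1)] square_le_4[OF assms(2)] by auto

text \<open>Entries of absolute value at most 2 that agree modulo 4 are equal or are 2 and -2, where
  the squares already sum to 8. So all four are equal, and sum 0 makes them vanish.\<close>

lemma congruent_norm_4:
  fixes x0 x1 x2 x3 :: int
  assumes "x0 ^ 2 + x1 ^ 2 + x2 ^ 2 + x3 ^ 2 = 4" "x0 + x1 + x2 + x3 = 0"
    and "4 dvd (x1 - x0)" "4 dvd (x2 - x1)" "4 dvd (x3 - x2)"
  shows False
proof -
  note nonneg = zero_le_power2[of x0] zero_le_power2[of x1] zero_le_power2[of x2] zero_le_power2[of x3]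
  have le: "x0 ^ 2 \<le> 4" "x1 ^ 2 \<le> 4" "x2 ^ 2 \<le> 4" "x3 ^ 2 \<le> 4"
    using assms(1) nonneg by linarith+
  have "x1 = x0" "x2 = x1" "x3 = x2"
    using congruent_small[OF le(1,2) assms(3)] congruent_small[OF le(2,3) assms(4)]
      congruent_small[OF le(3,4) assms(5)] assms(1) nonneg by linarith+
  then show False
    using assms(1,2) by simp
qed

text \<open>Parities alternate, so an opposite pair is odd with entries 1 or -1 and the other pair
  is zero. Opposite signs would give sum 0, but the sum is twice an odd number.\<close>

lemma alternating_norm_2:
  fixes x0 x1 x2 x3 e :: int
  assumes "x0 ^ 2 + x1 ^ 2 + x2 ^ 2 + x3 ^ 2 = 2" "x0 + x1 + x2 + x3 = 2 * e" "odd e"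
    and "even (x1 - x0 - e')" "even (x2 - x1 - e')" "even (x3 - x2 - e')" "odd e'"
  shows "x2 = x0 \<and> x3 = x1"
proof -
  have "x0 ^ 2 \<le> 2" "x1 ^ 2 \<le> 2" "x2 ^ 2 \<le> 2" "x3 ^ 2 \<le> 2"
    using assms(1) zero_le_power2[of x0] zero_le_power2[of x1] zero_le_power2[of x2] zero_le_power2[of x3]
    by linarith+
  note range = this[THEN square_le_2]
  have even_iff: "even x \<longleftrightarrow> x = 0" if "x \<in> {-1, 0, 1}" for x :: int
    using that by auto
  have sum: "x0 + x1 + x2 + x3 \<noteq> 0"
    using assms(2,3) by auto
  have odd: "odd (x1 - x0)" "odd (x2 - x1)" "odd (x3 - x2)"
    using assms(4-7) by simp_all
  show ?thesis
  proof (cases "even x0")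
    case True
    then have "even x2" "odd x1" "odd x3"
      using odd by simp_all
    with True have "x0 = 0" "x2 = 0" "x1 \<in> {-1, 1}" "x3 \<in> {-1, 1}"
      using even_iff range by auto
    with sum show ?thesis by auto
  next
    case False
    then have "odd x2" "even x1" "even x3"
      using odd by simp_all
    with False have "x1 = 0" "x3 = 0" "x0 \<in> {-1, 1}" "x2 \<in> {-1, 1}"
      using even_iff range by auto
    with sum show ?thesis by auto
  qed
qed

lemma sum_squares_eq_0:
  fixes x0 x1 x2 x3 :: int
  assumes "x0 ^ 2 + x1 ^ 2 + x2 ^ 2 + x3 ^ 2 = 0"
  shows "x0 = 0 \<and> x1 = 0 \<and> x2 = 0 \<and> x3 = 0"
proof -
  have "x0 ^ 2 = 0" "x1 ^ 2 = 0" "x2 ^ 2 = 0" "x3 ^ 2 = 0"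
    using assms zero_le_power2[of x0] zero_le_power2[of x1] zero_le_power2[of x2] zero_le_power2[of x3]
    by linarith+
  then show ?thesis by simp
qed

lemma card_\<Omega>: "card \<Omega> = 4"
proof -
  obtain r where "r \<in> \<Omega>" using \<Omega>_nonempty by blast
  then show ?thesis
    using sum_\<Omega>[of r "\<lambda>_. 1 :: nat"] by simp
qed

lemma sum_\<Omega>_inverse: "(\<Sum>w\<in>\<Omega>. f (inverse w)) = (\<Sum>w\<in>\<Omega>. f w)"
  by (rule sum.reindex_bij_witness[of _ inverse inverse]) (auto simp: \<Omega>_def power_inverse)

section \<open>Parity laws and symmetric divisors for the three classes\<close>

context cuspidal_function
begin

text \<open>Permuting coordinates leads to cusps such as (1 : w : 0), and normalizing these inverts
  w. As \<Omega> is closed under inversion, sums over a class do not change.\<close>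

lemma order_inverse: "w \<in> \<Omega> \<Longrightarrow> order_at emb X Y Z 1 w 0 z = mZ (inverse w)"
  "w \<in> \<Omega> \<Longrightarrow> order_at emb X Y Z 0 1 w z = mX (inverse w)"
  using \<Omega>_nonzero[of w] order_at_homogeneous[of w emb X Y Z "inverse w" 1 0 z]
    order_at_homogeneous[of w emb X Y Z 0 "inverse w" 1 z]
  by (simp_all add: mX_def mZ_def)

text \<open>In \<open>reciprocity\<close> the step from w to iw multiplies the right side by i^D,
  with D the difference of the two degrees. The left side is 1 or -1, so D is even, D = 2e, and the
  sign changes by (-1)^e.\<close>

lemma parity_Y:
  assumes w: "w \<in> \<Omega>"
  shows "\<exists>e. (\<Sum>v\<in>\<Omega>. mX v) - (\<Sum>v\<in>\<Omega>. mZ v) = 2 * e \<and> (\<forall>w\<in>\<Omega>. even (mY (\<i> * w) - mY w - e))"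
proof -
  let ?D = "(\<Sum>v\<in>\<Omega>. mX v) - (\<Sum>v\<in>\<Omega>. mZ v)"
  obtain C where C: "\<And>w. w \<in> \<Omega> \<Longrightarrow> (- 1) powi mY w = C * w powi ?D"
    using reciprocity by blast
  have step: "(- 1) powi mY (\<i> * w) = \<i> powi ?D * (- 1) powi mY w" if "w \<in> \<Omega>" for w
    using C[OF that] C[OF \<Omega>_mult[OF fourth_power_i(1) that]] by (simp add: power_int_mult_distrib)
  have "even ?D"
  proof (rule ccontr)
    assume "odd ?D"
    then obtain e where "?D = 2 * e + 1" ..
    then show False
      using step[OF w] by (auto simp: i_powi_odd minus_one_powi complex_eq_iff split: if_splits)
  qed
  then obtain e where e: "?D = 2 * e" ..
  have "even (mY (\<i> * w) - mY w - e)" if "w \<in> \<Omega>" for w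
    using step[OF that] unfolding e i_powi_even by (simp add: minus_one_powi split: if_splits)
  with e show ?thesis by blast
qed

lemma parity_X:
  assumes "w \<in> \<Omega>"
  shows "\<exists>e. (\<Sum>v\<in>\<Omega>. mY v) - (\<Sum>v\<in>\<Omega>. mZ v) = 2 * e \<and> (\<forall>w\<in>\<Omega>. even (mX (\<i> * w) - mX w - e))"
proof -
  interpret s: cuspidal_function emb Y X Z z by (rule cuspidal_swap12)
  have "s.mX = mY" "s.mY = mX"
    by (simp_all add: fun_eq_iff s.mX_def s.mY_def mX_def mY_def order_at_swap12[of emb Y])
  moreover have "(\<Sum>v\<in>\<Omega>. s.mZ v) = (\<Sum>v\<in>\<Omega>. mZ (inverse v))"
    by (rule sum.cong) (simp_all add: s.mZ_def order_at_swap12[of emb Y] order_inverse)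
  ultimately show ?thesis
    using s.parity_Y[OF assms] by (simp add: sum_\<Omega>_inverse)
qed

lemma parity_Z:
  assumes "w \<in> \<Omega>"
  shows "\<exists>e. (\<Sum>v\<in>\<Omega>. mX v) - (\<Sum>v\<in>\<Omega>. mY v) = 2 * e \<and> (\<forall>w\<in>\<Omega>. even (mZ (\<i> * w) - mZ w - e))"
proof -
  interpret s: cuspidal_function emb X Z Y z by (rule cuspidal_swap23)
  have "s.mZ = mY" "s.mY = mZ"
    by (simp_all add: fun_eq_iff s.mZ_def s.mY_def mZ_def mY_def order_at_swap23[of emb X Z])
  moreover have "(\<Sum>v\<in>\<Omega>. s.mX v) = (\<Sum>v\<in>\<Omega>. mX (inverse v))"
    by (rule sum.cong) (simp_all add: s.mX_def order_at_swap23[of emb X Z] order_inverse)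
  ultimately show ?thesis
    using s.parity_Y[OF assms] by (simp add: sum_\<Omega>_inverse)
qed

lemma symmetric_Y:
  assumes "\<And>w. w \<in> \<Omega> \<Longrightarrow> mX (- w) = mX w" "\<And>w. w \<in> \<Omega> \<Longrightarrow> mZ (- w) = mZ w" "w \<in> \<Omega>"
  shows "even (mY (\<i> * w) - mY w)"
proof -
  have "\<exists>C. \<forall>w\<in>\<Omega>. (- 1 :: complex) powi mY w = C"
    by (rule invariant_divisor[OF fourth_power_i(3)]) (use assms in auto)
  then obtain C where C: "\<And>w. w \<in> \<Omega> \<Longrightarrow> (- 1 :: complex) powi mY w = C"
    by blast
  from C[OF assms(3)] C[OF \<Omega>_mult[OF fourth_power_i(1) assms(3)]] show ?thesis
    by (simp add: minus_one_powi split: if_splits)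
qed

lemma symmetric_X:
  assumes "\<And>w. w \<in> \<Omega> \<Longrightarrow> mY (- w) = mY w" "\<And>w. w \<in> \<Omega> \<Longrightarrow> mZ (- w) = mZ w" "w \<in> \<Omega>"
  shows "even (mX (\<i> * w) - mX w)"
proof -
  interpret s: cuspidal_function emb Y X Z z by (rule cuspidal_swap12)
  have m: "s.mX = mY" "s.mY = mX"
    by (simp_all add: fun_eq_iff s.mX_def s.mY_def mX_def mY_def order_at_swap12[of emb Y])
  have inv: "- w \<in> \<Omega>" "inverse w \<in> \<Omega>" if "w \<in> \<Omega>" for w
    using that by (auto simp: \<Omega>_def power_inverse)
  have "s.mZ w = mZ (inverse w)" if "w \<in> \<Omega>" for w
    using that by (simp add: s.mZ_def order_at_swap12[of emb Y] order_inverse)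
  then have "s.mZ (- w) = s.mZ w" if "w \<in> \<Omega>" for w
    using that inv assms(2)[of "inverse w"] by simp
  then show ?thesis
    using s.symmetric_Y[OF _ _ assms(3)] assms(1) m by simp
qed

text \<open>A divisor supported on the class Y = 0 is fixed by Y -> iY, so
  \<open>invariant_divisor\<close> applies with k = i and determines the entries modulo 4 up to a
  common shift.\<close>

lemma support_Y:
  assumes "\<And>w. w \<in> \<Omega> \<Longrightarrow> mX w = 0" "\<And>w. w \<in> \<Omega> \<Longrightarrow> mZ w = 0" "w \<in> \<Omega>"
  shows "4 dvd (mY (\<i> * w) - mY w)"
proof -
  have "\<exists>C. \<forall>w\<in>\<Omega>. \<i> powi mY w = C"
    by (rule invariant_divisor[OF fourth_power_i(1)]) (use assms \<Omega>_mult[OF fourth_power_i(1)] in auto)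
  then have eq: "\<i> powi mY (\<i> * w) = \<i> powi mY w"
    using assms(3) \<Omega>_mult[OF fourth_power_i(1) assms(3)] by auto
  have "\<i> powi (mY (\<i> * w) - mY w) = 1"
    by (simp add: power_int_diff eq)
  moreover have "4 dvd n" if "\<i> powi n = 1" for n
  proof (cases "even n")
    case True
    then obtain e where e: "n = 2 * e" ..
    with that have "even e"
      by (simp add: i_powi_even minus_one_powi split: if_splits)
    with e show ?thesis by auto
  next
    case False
    then obtain e where "n = 2 * e + 1" ..
    with that show ?thesis
      by (auto simp: i_powi_odd minus_one_powi complex_eq_iff split: if_splits)
  qed
  ultimately show ?thesis by blast
qed

lemma support_X:
  assumes "\<And>w. w \<in> \<Omega> \<Longrightarrow> mY w = 0" "\<And>w. w \<in> \<Omega> \<Longrightarrow> mZ w = 0" "w \<in> \<Omega>"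
  shows "4 dvd (mX (\<i> * w) - mX w)"
proof -
  interpret s: cuspidal_function emb Y X Z z by (rule cuspidal_swap12)
  have m: "s.mX = mY" "s.mY = mX"
    by (simp_all add: fun_eq_iff s.mX_def s.mY_def mX_def mY_def order_at_swap12[of emb Y])
  have "s.mZ w = 0" if "w \<in> \<Omega>" for w
    using that assms(2)[of "inverse w"] by (simp add: s.mZ_def order_at_swap12[of emb Y] order_inverse)
      (simp add: \<Omega>_def power_inverse)
  then show ?thesis
    using s.support_Y[OF _ _ assms(3)] assms(1) m by simp
qed

lemma support_Z:
  assumes "\<And>w. w \<in> \<Omega> \<Longrightarrow> mX w = 0" "\<And>w. w \<in> \<Omega> \<Longrightarrow> mY w = 0" "w \<in> \<Omega>"
  shows "4 dvd (mZ (\<i> * w) - mZ w)"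
proof -
  interpret s: cuspidal_function emb X Z Y z by (rule cuspidal_swap23)
  have m: "s.mZ = mY" "s.mY = mZ"
    by (simp_all add: fun_eq_iff s.mZ_def s.mY_def mZ_def mY_def order_at_swap23[of emb X Z])
  have "s.mX w = 0" if "w \<in> \<Omega>" for w
    using that assms(1)[of "inverse w"] by (simp add: s.mX_def order_at_swap23[of emb X Z] order_inverse)
      (simp add: \<Omega>_def power_inverse)
  then show ?thesis
    using s.support_Y[OF _ _ assms(3)] assms(2) m by simp
qed

section \<open>The squared norm of a divisor: divisibility by 4, exclusion of 4\<close>

definition sq_norm :: int where
  "sq_norm = (\<Sum>w\<in>\<Omega>. mX w ^ 2) + (\<Sum>w\<in>\<Omega>. mY w ^ 2) + (\<Sum>w\<in>\<Omega>. mZ w ^ 2)"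

lemma sq_norm_mod_4: "4 dvd sq_norm" and sq_norm_neq_4: "sq_norm \<noteq> 4"
proof -
  obtain r where r: "r \<in> \<Omega>" using \<Omega>_nonempty by blast
  have orbit: "\<i> * r \<in> \<Omega>" "- r \<in> \<Omega>" "- \<i> * r \<in> \<Omega>" "\<i> * (\<i> * r) = - r" "\<i> * (- r) = - \<i> * r"
    using \<Omega>_mult[OF fourth_power_i(1) r] \<Omega>_mult[OF fourth_power_i(2) r] \<Omega>_mult[OF fourth_power_i(3) r] by simp_all
  define x0 x1 x2 x3 where x: "x0 = mX r" "x1 = mX (\<i> * r)" "x2 = mX (- r)" "x3 = mX (- \<i> * r)"
  define y0 y1 y2 y3 where y: "y0 = mY r" "y1 = mY (\<i> * r)" "y2 = mY (- r)" "y3 = mY (- \<i> * r)"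
  define z0 z1 z2 z3 where zz: "z0 = mZ r" "z1 = mZ (\<i> * r)" "z2 = mZ (- r)" "z3 = mZ (- \<i> * r)"
  have sums: "(\<Sum>v\<in>\<Omega>. mX v) = x0 + x1 + x2 + x3" "(\<Sum>v\<in>\<Omega>. mY v) = y0 + y1 + y2 + y3"
    "(\<Sum>v\<in>\<Omega>. mZ v) = z0 + z1 + z2 + z3"
    unfolding x y zz by (rule sum_\<Omega>[OF r])+
  define A B C where abc: "A = x0 ^ 2 + x1 ^ 2 + x2 ^ 2 + x3 ^ 2" "B = y0 ^ 2 + y1 ^ 2 + y2 ^ 2 + y3 ^ 2"
    "C = z0 ^ 2 + z1 ^ 2 + z2 ^ 2 + z3 ^ 2"
  have norm: "sq_norm = A + B + C"
    unfolding sq_norm_def abc x y zz by (simp only: sum_\<Omega>[OF r])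
  have nonneg: "A \<ge> 0" "B \<ge> 0" "C \<ge> 0"
    by (simp_all add: abc)
  obtain e1 where e1: "y0 + y1 + y2 + y3 - (z0 + z1 + z2 + z3) = 2 * e1"
    "even (x1 - x0 - e1)" "even (x2 - x1 - e1)" "even (x3 - x2 - e1)"
    using parity_X[OF r] r orbit unfolding sums x by metis
  obtain e2 where e2: "x0 + x1 + x2 + x3 - (z0 + z1 + z2 + z3) = 2 * e2"
    "even (y1 - y0 - e2)" "even (y2 - y1 - e2)" "even (y3 - y2 - e2)"
    using parity_Y[OF r] r orbit unfolding sums y by metis
  obtain e3 where e3: "x0 + x1 + x2 + x3 - (y0 + y1 + y2 + y3) = 2 * e3"
    "even (z1 - z0 - e3)" "even (z2 - z1 - e3)" "even (z3 - z2 - e3)"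
    using parity_Z[OF r] r orbit unfolding sums zz by metis
  have deg: "x0 + x1 + x2 + x3 + (y0 + y1 + y2 + y3) + (z0 + z1 + z2 + z3) = 0"
    using degree_zero unfolding sums .
  have e: "e2 = e1 + e3"
    using e1(1) e2(1) e3(1) by linarith
  have dvd: "4 dvd (A - 2 * e1)" "4 dvd (B - 2 * e2)" "4 dvd (C - 2 * e3)"
    unfolding abc using sum_squares_mod_4[OF e1(2-4)] sum_squares_mod_4[OF e2(2-4)] sum_squares_mod_4[OF e3(2-4)] .
  show "4 dvd sq_norm"
  proof -
    \<comment> \<open>Each class contributes twice its half-difference modulo 4, and
      \<open>e2 = e1 + e3\<close> turns the total into a multiple of 4.\<close>
    have "A + B + C = (A - 2 * e1) + (B - 2 * e2) + (C - 2 * e3) + 4 * e2"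
      by (simp add: e)
    with dvd show "4 dvd sq_norm"
      unfolding norm by (simp only: dvd_add dvd_triv_left)
  qed
  have neg: "\<forall>w\<in>\<Omega>. f (- w) = f w" if "f (- r) = f r" "f (- \<i> * r) = f (\<i> * r)" for f :: "complex \<Rightarrow> int"
    unfolding \<Omega>_eq[OF r] using that by auto
  have zero: "\<forall>w\<in>\<Omega>. f w = 0" if "f r = 0" "f (\<i> * r) = 0" "f (- r) = 0" "f (- \<i> * r) = 0" for f :: "complex \<Rightarrow> int"
    unfolding \<Omega>_eq[OF r] using that by auto
  have A0: "x0 = 0 \<and> x1 = 0 \<and> x2 = 0 \<and> x3 = 0" if "A = 0"
    using sum_squares_eq_0[of x0 x1 x2 x3] that abc(1) by simp
  have B0: "y0 = 0 \<and> y1 = 0 \<and> y2 = 0 \<and> y3 = 0" if "B = 0"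
    using sum_squares_eq_0[of y0 y1 y2 y3] that abc(2) by simp
  have C0: "z0 = 0 \<and> z1 = 0 \<and> z2 = 0 \<and> z3 = 0" if "C = 0"
    using sum_squares_eq_0[of z0 z1 z2 z3] that abc(3) by simp
  have zeroX: "\<forall>w\<in>\<Omega>. mX w = 0" if "A = 0"
    using A0[OF that] zero[of mX] by (simp add: x)
  have zeroY: "\<forall>w\<in>\<Omega>. mY w = 0" if "B = 0"
    using B0[OF that] zero[of mY] by (simp add: y)
  have zeroZ: "\<forall>w\<in>\<Omega>. mZ w = 0" if "C = 0"
    using C0[OF that] zero[of mZ] by (simp add: zz)
  show "sq_norm \<noteq> 4"
  proof
    assume "sq_norm = 4"
    then have four: "A + B + C = 4"
      by (simp add: norm)
    \<comment> \<open>A class of squared norm 2 has an odd half-difference, so its parities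
      alternate along w -> iw.\<close>
    have even: "even A" and par: "A = 2 \<Longrightarrow> odd e1" if "4 dvd (A - 2 * e1)" for A e1 :: int
      using that by presburger+
    note even = even[OF dvd(1)] even[OF dvd(2)] even[OF dvd(3)]
      and par = par[OF dvd(1)] par[OF dvd(2)] par[OF dvd(3)]
    have "A \<in> {0, 2, 4} \<and> B \<in> {0, 2, 4} \<and> C \<in> {0, 2, 4}"
      using four nonneg even unfolding insert_iff empty_iff by presburger
    \<comment> \<open>Squared norm 4 sits on one class, excluded by congruence modulo 4, or splits
      as 2 + 2 over two classes, excluded by symmetry under -1.\<close>
    with four consider "A = 4" "B = 0" "C = 0" | "A = 0" "B = 4" "C = 0" | "A = 0" "B = 0" "C = 4"
      | "A = 2" "B = 2" "C = 0" | "A = 2" "B = 0" "C = 2" | "A = 0" "B = 2" "C = 2"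
      by auto
    then show False
    proof cases
      case 1
      have "4 dvd (x1 - x0)" "4 dvd (x2 - x1)" "4 dvd (x3 - x2)"
        unfolding x using support_X zeroY[OF 1(2)] zeroZ[OF 1(3)] r orbit by metis+
      moreover have "x0 + x1 + x2 + x3 = 0"
        using deg B0[OF 1(2)] C0[OF 1(3)] by simp
      ultimately show False
        using congruent_norm_4 1(1) abc(1) by metis
    next
      case 2
      have "4 dvd (y1 - y0)" "4 dvd (y2 - y1)" "4 dvd (y3 - y2)"
        unfolding y using support_Y zeroX[OF 2(1)] zeroZ[OF 2(3)] r orbit by metis+
      moreover have "y0 + y1 + y2 + y3 = 0"
        using deg A0[OF 2(1)] C0[OF 2(3)] by simp
      ultimately show False
        using congruent_norm_4 2(2) abc(2) by metis
    next
      case 3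
      have "4 dvd (z1 - z0)" "4 dvd (z2 - z1)" "4 dvd (z3 - z2)"
        unfolding zz using support_Z zeroX[OF 3(1)] zeroY[OF 3(2)] r orbit by metis+
      moreover have "z0 + z1 + z2 + z3 = 0"
        using deg A0[OF 3(1)] B0[OF 3(2)] by simp
      ultimately show False
        using congruent_norm_4 3(3) abc(3) by metis
    next
      case 4
      have "x0 + x1 + x2 + x3 = 2 * e2"
        using e2(1) C0[OF 4(3)] by simp
      \<comment> \<open>The third class has degree 0, so the degree of this class is twice an odd
        number and opposite entries agree.\<close>
      then have "x2 = x0 \<and> x3 = x1"
        using alternating_norm_2[OF 4(1)[unfolded abc] _ _ e1(2-4)] par 4 by blast
      then have "\<forall>w\<in>\<Omega>. mX (- w) = mX w"
        unfolding x by (intro neg) auto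
      then have "even (y1 - y0)"
        unfolding y using symmetric_Y[OF _ _ r] zeroZ[OF 4(3)] \<Omega>_mult[OF fourth_power_i(3)] by simp
      \<comment> \<open>The symmetry under -1 makes the second class constant in parity, but its
        half-difference \<open>e2\<close> is odd.\<close>
      then show False
        using e2(2) par(2)[OF 4(2)] by presburger
    next
      case 5
      have "z0 + z1 + z2 + z3 = 2 * (- e1)"
        using e1(1) B0[OF 5(2)] by simp
      then have "z2 = z0 \<and> z3 = z1"
        using alternating_norm_2[OF 5(3)[unfolded abc] _ _ e3(2-4)] par 5 by auto
      then have "\<forall>w\<in>\<Omega>. mZ (- w) = mZ w"
        unfolding zz by (intro neg) auto
      then have "even (x1 - x0)"
        unfolding x using symmetric_X[OF _ _ r] zeroY[OF 5(2)] \<Omega>_mult[OF fourth_power_i(3)] by simp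
      then show False
        using e1(2) par(1)[OF 5(1)] by presburger
    next
      case 6
      have "z0 + z1 + z2 + z3 = 2 * (- e2)"
        using e2(1) A0[OF 6(1)] by simp
      then have "z2 = z0 \<and> z3 = z1"
        using alternating_norm_2[OF 6(3)[unfolded abc] _ _ e3(2-4)] par 6 by auto
      then have "\<forall>w\<in>\<Omega>. mZ (- w) = mZ w"
        unfolding zz by (intro neg) auto
      then have "even (y1 - y0)"
        unfolding y using symmetric_Y[OF _ _ r] zeroX[OF 6(1)] \<Omega>_mult[OF fourth_power_i(3)] by simp
      then show False
        using e2(2) par(2)[OF 6(2)] by presburger
    qed
  qed
qed

end

section \<open>Functions of squared norm 8 and 12\<close>

context quartic
begin

lemma cuspidal_coordinate: "cuspidal_function emb X Y Z (X / Z)"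
  by unfold_locales (use funs_X_Z closed_point.ord_X_Z in auto)

lemma sq_norm_coordinate: "cuspidal_function.sq_norm emb X Y Z (X / Z) = 8"
proof -
  interpret c: cuspidal_function emb X Y Z "X / Z"
    by (rule cuspidal_coordinate)
  have "c.mX w = 1" "c.mY w = 0" "c.mZ w = - 1" if "w \<in> \<Omega>" for w
    unfolding c.mX_def c.mY_def c.mZ_def
    using closed_point.ord_X_Z_zero[OF closed_point_\<Omega>(1)[OF that]] closed_point.ord_X_Z[OF closed_point_\<Omega>(2)[OF that]]
      closed_point.ord_X_Z_pole[OF closed_point_\<Omega>(3)[OF that]] \<Omega>_nonzero[OF that] by simp_all
  then show ?thesis
    unfolding c.sq_norm_def by (simp add: card_\<Omega>)
qed

text \<open>The poles of numerator and denominator at infinity cancel. On the class X = 0 the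
  divisor is 1 at three cusps and 1 - 4 = -3 at the cusp of tangency, so the squared norm is 3 +
  9.\<close>

lemma cuspidal_tangent:
  assumes r: "r \<in> \<Omega>"
  shows "cuspidal_function emb X Y Z (X / Z / (Y / Z - emb r))"
    and "cuspidal_function.sq_norm emb X Y Z (X / Z / (Y / Z - emb r)) = 12"
proof -
  define z where "z = X / Z / (Y / Z - emb r)"
  have d: "Y / Z - emb r \<in> funs" "Y / Z - emb r \<noteq> 0" "X / Z \<noteq> 0"
    using second_nonconstant[of r] funs_diff[OF funs_Y_Z funs_const] by (simp_all add: right_minus_eq nonzero_divide_eq_eq)
  have ord: "order_at emb X Y Z a b c z = order_at emb X Y Z a b c (X / Z) - order_at emb X Y Z a b c (Y / Z - emb r)"
    if "closed_point emb X Y Z a b c" for a b c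
    unfolding z_def using closed_point.ord_divide[OF that funs_X_Z d(3,1,2)] .
  show cusp: "cuspidal_function emb X Y Z (X / Z / (Y / Z - emb r))"
    unfolding z_def[symmetric]
  proof
    show "z \<in> funs"
      unfolding z_def by (intro funs_divide funs_X_Z d(1))
    show "z \<noteq> 0"
      using d by (simp add: z_def)
    show "order_at emb X Y Z a b c z = 0" if "closed_point emb X Y Z a b c" "a \<noteq> 0" "b \<noteq> 0" "c \<noteq> 0" for a b c
      using ord[OF that(1)] closed_point.ord_X_Z[OF that(1)] closed_point.ord_Y_diff(1)[OF that(1) r] that by simp
  qed
  interpret c: cuspidal_function emb X Y Z z
    unfolding z_def by (rule cusp)
  have m: "c.mX w = 1 - (if w = r then 4 else 0)" "c.mY w = 0" "c.mZ w = 0" if w: "w \<in> \<Omega>" for w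
    unfolding c.mX_def c.mY_def c.mZ_def
    using ord[OF closed_point_\<Omega>(1)[OF w]] ord[OF closed_point_\<Omega>(2)[OF w]] ord[OF closed_point_\<Omega>(3)[OF w]]
      closed_point.ord_X_Z_zero[OF closed_point_\<Omega>(1)[OF w]] closed_point.ord_X_Z[OF closed_point_\<Omega>(2)[OF w]]
      closed_point.ord_X_Z_pole[OF closed_point_\<Omega>(3)[OF w]]
      closed_point.ord_Y_diff(2)[OF closed_point_\<Omega>(1)[OF w] r] closed_point.ord_Y_diff(1)[OF closed_point_\<Omega>(2)[OF w] r]
      closed_point.ord_Y_diff(3)[OF closed_point_\<Omega>(3)[OF w] r] \<Omega>_nonzero[OF w] by simp_all
  have "(\<Sum>w\<in>\<Omega>. c.mX w ^ 2) = (\<Sum>w\<in>\<Omega>. 1 + 1 * (if r = w then 8 else 0))"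
    by (rule sum.cong) (auto simp: m)
  also have "\<dots> = 12"
    unfolding sum.distrib sum_delta_\<Omega>[OF r] by (simp add: card_\<Omega>)
  finally have "c.sq_norm = 12"
    unfolding c.sq_norm_def by (simp add: m)
  then show "cuspidal_function.sq_norm emb X Y Z (X / Z / (Y / Z - emb r)) = 12"
    unfolding z_def .
qed

end

section \<open>The Fermat function field\<close>

lemma form_add: "form d (\<lambda>i j. f i j + g i j) X Y Z = form d f X Y Z + form d g X Y Z"
  by (simp add: form_def distrib_right sum.distrib)

lemma form_scale: "form d (\<lambda>i j. k * f i j) X Y Z = k * form d f X Y Z"
  by (simp add: form_def sum_distrib_left mult.assoc)

lemma form_mult_X:
  "form (Suc d) (\<lambda>i j. case i of 0 \<Rightarrow> 0 | Suc i' \<Rightarrow> f i' j) X Y Z = X * form d f X Y Z"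
  unfolding form_def sum.atMost_Suc_shift
  by (simp add: sum_distrib_left mult_ac)

lemma form_mult_Y:
  "form (Suc d) (\<lambda>i j. case j of 0 \<Rightarrow> 0 | Suc j' \<Rightarrow> f i j') X Y Z = Y * form d f X Y Z"
proof -
  have "(\<Sum>j\<le>Suc d - i. (case j of 0 \<Rightarrow> 0 | Suc j' \<Rightarrow> f i j') * X ^ i * Y ^ j * Z ^ (Suc d - i - j))
      = Y * (\<Sum>j\<le>d - i. f i j * X ^ i * Y ^ j * Z ^ (d - i - j))" if "i \<le> d" for i
    unfolding Suc_diff_le[OF that] sum.atMost_Suc_shift by (simp add: sum_distrib_left mult_ac)
  then show ?thesis
    unfolding form_def by (simp add: sum_distrib_left)
qed

text \<open>The cutoff removes coefficients of total degree \<open>Suc d\<close>, which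
  \<open>form d\<close> never reads but \<open>form (Suc d)\<close> would.\<close>

lemma form_mult_Z:
  "form (Suc d) (\<lambda>i j. if i + j \<le> d then f i j else 0) X Y Z = Z * form d f X Y Z"
proof -
  have "(\<Sum>j\<le>Suc d - i. (if i + j \<le> d then f i j else 0) * X ^ i * Y ^ j * Z ^ (Suc d - i - j))
      = Z * (\<Sum>j\<le>d - i. f i j * X ^ i * Y ^ j * Z ^ (d - i - j))" if i: "i \<le> d" for i
  proof -
    have "(if i + j \<le> d then f i j else 0) * X ^ i * Y ^ j * Z ^ (Suc d - i - j)
        = Z * (f i j * X ^ i * Y ^ j * Z ^ (d - i - j))" if "j \<le> d - i" for j
      using that i by (simp add: Suc_diff_le mult_ac)
    then show ?thesis
      unfolding Suc_diff_le[OF i] using i by (simp add: sum_distrib_left Suc_diff_le)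
  qed
  then show ?thesis
    unfolding form_def by (simp add: sum_distrib_left)
qed

context complex_algebra_pair
begin

lemma specializes_zero: "specializes emb X Y Z e A B C d 0 0"
  using specializes_scale[OF specializes_power_Z[of emb e X Y Z A B C d], of 0] by simp

lemma specializes_sum:
  "(\<And>i. i \<in> S \<Longrightarrow> specializes emb X Y Z e A B C d (u i) (w i))
    \<Longrightarrow> specializes emb X Y Z e A B C d (\<Sum>i\<in>S. u i) (\<Sum>i\<in>S. w i)"
  by (induction S rule: infinite_finite_induct) (auto intro: specializes_zero specializes.add)

lemma specializes_monomial: "specializes emb X Y Z e A B C (i + j + k) (X ^ i * Y ^ j * Z ^ k) (A ^ i * B ^ j * C ^ k)"
proof -
  have "specializes emb X Y Z e A B C (j + k) (Y ^ j * Z ^ k) (B ^ j * C ^ k)"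
    by (induction j) (auto simp: mult.assoc intro: specializes_power_Z specializes.mult_Y)
  then show ?thesis
    by (induction i) (auto simp: mult.assoc add.assoc intro: specializes.mult_X)
qed

end

text \<open>With \<open>Z = \<epsilon>\<close>, where \<open>\<epsilon> ^ 4 = - 1\<close>, the equation of the curve becomes symmetric; the point
  \<open>(a : b : c)\<close> of the Fermat curve is then \<open>(a : b : \<epsilon> c)\<close>.\<close>

locale fermat_quartic = fermat_function_field 4 emb x y \<zeta> \<epsilon>
  for emb :: "complex \<Rightarrow> 'f::field" and x y \<zeta> \<epsilon>
begin

lemma epsilon_power: "\<epsilon> ^ 4 = - 1"
  using epsilon by (simp add: primitive_root_of_def)

sublocale quartic emb x y "emb \<epsilon>"
proof
  show emb1: "emb 1 = 1" by (rule emb_1)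
  show add: "emb (a + b) = emb a + emb b" and mult: "emb (a * b) = emb a * emb b" for a b
    by (rule emb_add, rule emb_mult)
  interpret e: complex_algebra emb
    by unfold_locales (fact emb1 add mult)+
  show "x ^ 4 + y ^ 4 + emb \<epsilon> ^ 4 = 0"
    using fermat_equation epsilon_power by (simp add: e.emb_minus flip: e.emb_power)
  show "emb \<epsilon> \<noteq> 0"
    using epsilon_nz by simp
  show "x \<noteq> emb k * emb \<epsilon>" for k
    using x_transcendental[of "[:- (k * \<epsilon>), 1:]"]
    by (auto simp: map_poly_pCons e.emb_minus e.emb_mult)
qed

lemma form_specializes:
  "specializes emb x y (emb \<epsilon>) id a b (\<epsilon> * c) d (form_xy d f) (form d f a b c)"
proof -
  interpret p: complex_algebra_pair emb id ..
  have "specializes emb x y (emb \<epsilon>) id a b (\<epsilon> * c) d (emb (f i j) * x ^ i * y ^ j * 1 ^ (d - i - j))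
      (f i j * a ^ i * b ^ j * c ^ (d - i - j))" if "i \<le> d" "j \<le> d - i" for i j
  proof -
    define k where "k = d - i - j"
    \<comment> \<open>Here the third coordinate is \<epsilon> instead of 1; the scalar
      \<open>inverse (\<epsilon> ^ k)\<close> compensates for it on both sides.\<close>
    have "specializes emb x y (emb \<epsilon>) id a b (\<epsilon> * c) (i + j + k)
        (emb (f i j * inverse (\<epsilon> ^ k)) * (x ^ i * y ^ j * emb \<epsilon> ^ k))
        (id (f i j * inverse (\<epsilon> ^ k)) * (a ^ i * b ^ j * (\<epsilon> * c) ^ k))"
      by (intro p.specializes_scale p.specializes_monomial)
    moreover have "i + j + k = d"
      using that by (simp add: k_def)
    moreover have "emb (f i j * inverse (\<epsilon> ^ k)) * (x ^ i * y ^ j * emb \<epsilon> ^ k) = emb (f i j) * x ^ i * y ^ j * 1 ^ k"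
      using epsilon_nz by (simp add: emb_mult emb_inverse emb_power)
    moreover have "id (f i j * inverse (\<epsilon> ^ k)) * (a ^ i * b ^ j * (\<epsilon> * c) ^ k) = f i j * a ^ i * b ^ j * c ^ k"
      using epsilon_nz by (simp add: power_mult_distrib)
    ultimately show ?thesis
      unfolding k_def[symmetric] by (simp only:)
  qed
  then show ?thesis
    unfolding form_xy_def form_def by (intro p.specializes_sum) auto
qed

text \<open>With \<open>form_specializes\<close> this shows that derivations and coefficient arrays
  describe the same pairs of values.\<close>

lemma specializes_form:
  assumes "specializes emb x y (emb \<epsilon>) id a b (\<epsilon> * c) d u w"
  shows "\<exists>f. u = form_xy d f \<and> w = form d f a b c"
  using assms
proof (induction rule: specializes.induct)
  case (const k)
  show ?case
    by (rule exI[of _ "\<lambda>_ _. k"]) (simp add: form_xy_def form_def)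
next
  case (add d u w u' w')
  then obtain f g where "u = form_xy d f" "w = form d f a b c" "u' = form_xy d g" "w' = form d g a b c"
    by blast
  then show ?case
    by (intro exI[of _ "\<lambda>i j. f i j + g i j"]) (simp add: form_xy_def form_add emb_add)
next
  case (mult_X d u w)
  then obtain f where f: "u = form_xy d f" "w = form d f a b c"
    by blast
  have "emb (case i of 0 \<Rightarrow> 0 | Suc i' \<Rightarrow> f i' j) = (case i of 0 \<Rightarrow> 0 | Suc i' \<Rightarrow> emb (f i' j))" for i j
    by (cases i) simp_all
  then show ?case
    by (intro exI[of _ "\<lambda>i j. case i of 0 \<Rightarrow> 0 | Suc i' \<Rightarrow> f i' j"]) (simp add: f form_xy_def form_mult_X)
next
  case (mult_Y d u w)
  then obtain f where f: "u = form_xy d f" "w = form d f a b c"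
    by blast
  have "emb (case j of 0 \<Rightarrow> 0 | Suc j' \<Rightarrow> f i j') = (case j of 0 \<Rightarrow> 0 | Suc j' \<Rightarrow> emb (f i j'))" for i j
    by (cases j) simp_all
  then show ?case
    by (intro exI[of _ "\<lambda>i j. case j of 0 \<Rightarrow> 0 | Suc j' \<Rightarrow> f i j'"]) (simp add: f form_xy_def form_mult_Y)
next
  case (mult_Z d u w)
  then obtain f where f: "u = form_xy d f" "w = form d f a b c"
    by blast
  have "emb (if i + j \<le> d then \<epsilon> * f i j else 0) = (if i + j \<le> d then emb \<epsilon> * emb (f i j) else 0)" for i j
    by (simp add: emb_mult)
  then show ?case
    by (intro exI[of _ "\<lambda>i j. if i + j \<le> d then \<epsilon> * f i j else 0"])
      (simp add: f form_xy_def form_mult_Z form_scale)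
qed

section \<open>Local rings, function field and valuations in terms of places\<close>

lemma local_ring_eq: "local_ring (a, b, c) = {r. \<exists>g. place emb x y (emb \<epsilon>) id a b (\<epsilon> * c) r g}"
proof (intro equalityI subsetI)
  fix r assume "r \<in> local_ring (a, b, c)"
  then obtain d f g where "r = form_xy d f / form_xy d g" "form d g a b c \<noteq> 0"
    by (auto simp: local_ring_def)
  then show "r \<in> {r. \<exists>g. place emb x y (emb \<epsilon>) id a b (\<epsilon> * c) r g}"
    unfolding place_def using form_specializes by blast
next
  fix r assume "r \<in> {r. \<exists>g. place emb x y (emb \<epsilon>) id a b (\<epsilon> * c) r g}"
  then obtain d u u' w w' where "specializes emb x y (emb \<epsilon>) id a b (\<epsilon> * c) d u w"
    "specializes emb x y (emb \<epsilon>) id a b (\<epsilon> * c) d u' w'" "w' \<noteq> 0" "r = u / u'"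
    unfolding place_def by blast
  moreover from this obtain f g where "u = form_xy d f" "u' = form_xy d g" "w' = form d g a b c"
    using specializes_form by blast
  ultimately show "r \<in> local_ring (a, b, c)"
    unfolding local_ring_def prod.case by blast
qed

lemma function_field_eq: "function_field = funs"
proof (intro equalityI subsetI)
  fix r assume "r \<in> function_field"
  then obtain d f g where r: "r = form_xy d f / form_xy d g" "form_xy d g \<noteq> 0"
    by (auto simp: function_field_def)
  have "self.spec d (form_xy d f) (form_xy d f)" "self.spec d (form_xy d g) (form_xy d g)"
    by (rule specializes_selfI[OF form_specializes])+
  with r show "r \<in> funs"
    unfolding funs_iff_spec by blast
next
  fix r assume "r \<in> funs"
  then obtain d u v where r: "self.spec d u u" "self.spec d v v" "v \<noteq> 0" "r = u / v"
    using funs_iff_spec by blast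
  obtain f g where "u = form_xy d f" "v = form_xy d g"
    using specializes_ex[OF r(1)] specializes_ex[OF r(2)] specializes_form by metis
  with r show "r \<in> function_field"
    unfolding function_field_def by blast
qed

text \<open>Units of the local ring are the elements with nonzero value and non-units those with
  value 0, so both definitions select the same uniformizers.\<close>

lemma valuation_eq:
  assumes "closed_point emb x y (emb \<epsilon>) a b (\<epsilon> * c)"
  shows "valuation (a, b, c) z = order_at emb x y (emb \<epsilon>) a b (\<epsilon> * c) z"
proof -
  interpret P: closed_point emb x y "emb \<epsilon>" a b "\<epsilon> * c" by fact
  have units: "u \<in> local_units (a, b, c) \<longleftrightarrow> (\<exists>g. P.pl u g \<and> g \<noteq> 0)" for u
  proof
    assume "u \<in> local_units (a, b, c)"
    then obtain g g' where *: "P.pl u g" "u \<noteq> 0" "P.pl (inverse u) g'"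
      unfolding local_units_def local_ring_eq by blast
    then have "P.pl 1 (g * g')"
      using P.place_mult[OF *(1,3)] by simp
    then have "g * g' = 1"
      using P.place_unique P.place_1 by blast
    with * show "\<exists>g. P.pl u g \<and> g \<noteq> 0"
      by force
  qed (use P.place_inverse P.place_nonzero in \<open>auto simp: local_units_def local_ring_eq\<close>)
  have ideal: "local_ring (a, b, c) - local_units (a, b, c) = {r. P.pl r 0}"
    using units P.place_unique unfolding local_ring_eq by blast
  have unif: "uniformizer (a, b, c) t \<longleftrightarrow> P.unif t" for t
  proof
    assume "uniformizer (a, b, c) t"
    then have t: "t \<noteq> 0" "{r. P.pl r 0} = (\<lambda>w. t * w) ` {r. \<exists>g. P.pl r g}"
      unfolding uniformizer_def ideal unfolding local_ring_eq by auto
    have "t * 1 \<in> (\<lambda>w. t * w) ` {r. \<exists>g. P.pl r g}"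
      using P.place_1 by blast
    then have "P.pl t 0"
      unfolding t(2)[symmetric] by simp
    moreover have "\<exists>s h. P.pl s h \<and> r = t * s" if "P.pl r 0" for r
      using that t(2) by blast
    ultimately show "P.unif t"
      using t(1) unfolding uniformizes_def by blast
  next
    assume t: "P.unif t"
    have "{r. P.pl r 0} = (\<lambda>w. t * w) ` {r. \<exists>g. P.pl r g}"
    proof (intro equalityI subsetI)
      fix r assume "r \<in> {r. P.pl r 0}"
      then show "r \<in> (\<lambda>w. t * w) ` {r. \<exists>g. P.pl r g}"
        using P.unifD(3)[OF t] by blast
    next
      fix r assume "r \<in> (\<lambda>w. t * w) ` {r. \<exists>g. P.pl r g}"
      then obtain s g where "r = t * s" "P.pl s g" by blast
      then show "r \<in> {r. P.pl r 0}"
        using P.place_mult[OF P.unifD(2)[OF t], of s g] by simp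
    qed
    then show "uniformizer (a, b, c) t"
      using P.unifD(1)[OF t] unfolding uniformizer_def ideal unfolding local_ring_eq by blast
  qed
  show ?thesis
    unfolding valuation_def order_at_def has_order_def unif units by metis
qed

lemma closed_point_fermat:
  assumes "(a, b, c) \<in> fermat_points 4"
  shows "closed_point emb x y (emb \<epsilon>) a b (\<epsilon> * c)"
  using assms epsilon_power epsilon_nz
  by (intro closed_pointI) (auto simp: fermat_points_def power_mult_distrib)

lemma zeta_power: "\<zeta> ^ 4 = 1"
  using zeta by (simp add: primitive_root_of_def)

lemma zeta_powers_\<Omega>:
  assumes "k \<noteq> 0" "\<And>j. k * \<zeta> ^ j \<in> \<Omega>"
  shows "bij_betw (\<lambda>j. k * \<zeta> ^ j) {..<4} \<Omega>"
proof -
  have inj: "inj_on (\<lambda>j. k * \<zeta> ^ j) {..<4}"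
    using root_powers_inj assms(1) by (auto simp: inj_on_def)
  moreover have "(\<lambda>j. k * \<zeta> ^ j) ` {..<4} = \<Omega>"
    by (rule card_subset_eq) (use assms card_image[OF inj] card_\<Omega> in auto)
  ultimately show ?thesis
    by (simp add: bij_betw_def)
qed

text \<open>An affine cusp such as (0 : \<zeta>^j : 1) becomes (0 : \<zeta>^j : \<epsilon>) in the
  symmetric coordinates, so normalizing divides by \<epsilon>; the cusps at infinity keep their
  parameter \<epsilon> \<zeta>^j.\<close>

lemma epsilon_zeta_\<Omega>: "\<epsilon> * \<zeta> ^ j \<in> \<Omega>" "inverse \<epsilon> * \<zeta> ^ j \<in> \<Omega>"
proof -
  have "(\<zeta> ^ j) ^ 4 = 1"
    using zeta_power by (metis mult.commute power_mult power_one)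
  then show "\<epsilon> * \<zeta> ^ j \<in> \<Omega>" "inverse \<epsilon> * \<zeta> ^ j \<in> \<Omega>"
    using epsilon_power by (simp_all add: \<Omega>_def power_mult_distrib power_inverse)
qed

lemmas affine_cusps = zeta_powers_\<Omega>[OF _ epsilon_zeta_\<Omega>(2)]
lemmas infinite_cusps = zeta_powers_\<Omega>[OF _ epsilon_zeta_\<Omega>(1)]

lemma zero_coordinate_cusp:
  assumes "(a, b, c) \<in> fermat_points 4" "a = 0 \<or> b = 0 \<or> c = 0"
  shows "\<exists>P\<in>cusps. same_point P (a, b, c)"
proof -
  have eq: "a ^ 4 + b ^ 4 = c ^ 4" and nz: "(a, b, c) \<noteq> (0, 0, 0)"
    using assms(1) by (auto simp: fermat_points_def)
  have root: "\<exists>j<4. w = inverse \<epsilon> * \<zeta> ^ j" "\<exists>j<4. w = \<epsilon> * \<zeta> ^ j" if "w \<in> \<Omega>" for w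
    using that affine_cusps infinite_cusps epsilon_nz by (fastforce simp: bij_betw_def)+
  have unit: "\<exists>j<4. s = \<zeta> ^ j" if "s ^ 4 = 1" for s
  proof -
    have "inverse \<epsilon> * s \<in> \<Omega>"
      using that epsilon_power by (simp add: \<Omega>_def power_mult_distrib power_inverse)
    then show ?thesis
      using root(1) epsilon_nz by fastforce
  qed
  consider "a = 0" "c \<noteq> 0" | "b = 0" "c \<noteq> 0" | "c = 0" "b \<noteq> 0"
    using eq nz assms(2) by (cases "b = 0"; cases "c = 0") auto
  then show ?thesis
  proof cases
    case 1
    then have "(b / c) ^ 4 = 1"
      using eq by (simp add: power_divide)
    then obtain j where "j < 4" "b / c = \<zeta> ^ j"
      using unit by blast
    then have "(0, \<zeta> ^ j, 1) \<in> cusps" "same_point (0, \<zeta> ^ j, 1) (a, b, c)"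
      using 1 by (auto simp: cusps_def same_point_def field_simps)
    then show ?thesis by blast
  next
    case 2
    then have "(a / c) ^ 4 = 1"
      using eq by (simp add: power_divide)
    then obtain j where "j < 4" "a / c = \<zeta> ^ j"
      using unit by blast
    then have "(\<zeta> ^ j, 0, 1) \<in> cusps" "same_point (\<zeta> ^ j, 0, 1) (a, b, c)"
      using 2 by (auto simp: cusps_def same_point_def field_simps)
    then show ?thesis by blast
  next
    case 3
    then have "a ^ 4 = - (b ^ 4)"
      using eq by (simp add: eq_neg_iff_add_eq_0)
    then have "a / b \<in> \<Omega>"
      using 3 by (simp add: \<Omega>_def power_divide)
    then obtain j where "j < 4" "a / b = \<epsilon> * \<zeta> ^ j"
      using root(2) by blast
    then have "(\<epsilon> * \<zeta> ^ j, 1, 0) \<in> cusps" "same_point (\<epsilon> * \<zeta> ^ j, 1, 0) (a, b, c)"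
      using 3 by (auto simp: cusps_def same_point_def field_simps)
    then show ?thesis by blast
  qed
qed

lemma cusp_units_iff: "z \<in> cusp_units \<longleftrightarrow> cuspidal_function emb x y (emb \<epsilon>) z"
proof
  assume z: "z \<in> cusp_units"
  show "cuspidal_function emb x y (emb \<epsilon>) z"
  proof
    show "z \<in> funs" "z \<noteq> 0"
      using z by (auto simp: cusp_units_def function_field_eq)
    fix a b c assume P: "closed_point emb x y (emb \<epsilon>) a b c" and nz: "a \<noteq> 0" "b \<noteq> 0" "c \<noteq> 0"
    interpret P: closed_point emb x y "emb \<epsilon>" a b c by (rule P)
    \<comment> \<open>Back to Fermat coordinates, in which the definition of
      \<open>cusp_units\<close> speaks about the point.\<close>
    define c' where "c' = c / \<epsilon>"
    have c: "c = \<epsilon> * c'"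
      using epsilon_nz by (simp add: c'_def)
    have "(a, b, c') \<in> fermat_points 4"
      using P.point_eq nz epsilon_power by (simp add: fermat_points_def c power_mult_distrib)
    moreover have "\<not> (\<exists>P\<in>cusps. same_point P (a, b, c'))"
      using nz by (auto simp: cusps_def same_point_def c)
    ultimately have "valuation (a, b, c') z = 0"
      using z unfolding cusp_units_def by blast
    then show "order_at emb x y (emb \<epsilon>) a b c z = 0"
      using valuation_eq P by (simp add: c)
  qed
next
  assume "cuspidal_function emb x y (emb \<epsilon>) z"
  then interpret c: cuspidal_function emb x y "emb \<epsilon>" z .
  have "\<exists>P\<in>cusps. same_point P (a, b, c)" if P: "(a, b, c) \<in> fermat_points 4" and "valuation (a, b, c) z \<noteq> 0" for a b c
  proof (rule zero_coordinate_cusp[OF P], rule ccontr)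
    assume "\<not> (a = 0 \<or> b = 0 \<or> c = 0)"
    then show False
      using c.z_unit[OF closed_point_fermat[OF P]] valuation_eq[OF closed_point_fermat[OF P]] that(2) epsilon_nz
      by simp
  qed
  then show "z \<in> cusp_units"
    using c.z_funs by (auto simp: cusp_units_def function_field_eq)
qed

section \<open>Norms of lattice vectors and the two smallest values\<close>

definition divisor :: "'f \<Rightarrow> coords \<Rightarrow> real" where
  "divisor z P = (if P \<in> cusps then real_of_int (valuation P z) else 0)"

lemma lattice_eq: "lattice = divisor ` cusp_units"
  unfolding lattice_def divisor_def ..

lemma finite_cusps: "finite cusps"
  by (simp add: cusps_def)

lemma L2_set_divisor:
  assumes "z \<in> cusp_units"
  shows "L2_set (divisor z) cusps = sqrt (real_of_int (cuspidal_function.sq_norm emb x y (emb \<epsilon>) z))"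
proof -
  interpret c: cuspidal_function emb x y "emb \<epsilon>" z
    using assms by (simp add: cusp_units_iff)
  have zeta4: "(\<zeta> ^ j) ^ 4 = 1" for j
    using zeta_power by (metis mult.commute power_mult power_one)
  have pts: "(0, \<zeta> ^ j, 1) \<in> fermat_points 4" "(\<zeta> ^ j, 0, 1) \<in> fermat_points 4" "(\<epsilon> * \<zeta> ^ j, 1, 0) \<in> fermat_points 4" for j
    using zeta4[of j] epsilon_power by (simp_all add: fermat_points_def power_mult_distrib)
  have val: "valuation (0, \<zeta> ^ j, 1) z = c.mX (inverse \<epsilon> * \<zeta> ^ j)" "valuation (\<zeta> ^ j, 0, 1) z = c.mY (inverse \<epsilon> * \<zeta> ^ j)"
    "valuation (\<epsilon> * \<zeta> ^ j, 1, 0) z = c.mZ (\<epsilon> * \<zeta> ^ j)" for j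
    using valuation_eq[OF closed_point_fermat[OF pts(1)]] valuation_eq[OF closed_point_fermat[OF pts(2)]]
      valuation_eq[OF closed_point_fermat[OF pts(3)]] epsilon_nz
      order_at_homogeneous[of \<epsilon> emb x y "emb \<epsilon>" 0 "inverse \<epsilon> * \<zeta> ^ j" 1 z]
      order_at_homogeneous[of \<epsilon> emb x y "emb \<epsilon>" "inverse \<epsilon> * \<zeta> ^ j" 0 1 z]
    by (simp_all add: c.mX_def c.mY_def c.mZ_def mult.assoc[symmetric])
  let ?A = "(\<lambda>j. (0, \<zeta> ^ j, 1)) ` {..<4} :: coords set"
  let ?B = "(\<lambda>j. (\<zeta> ^ j, 0, 1)) ` {..<4} :: coords set"
  let ?C = "(\<lambda>j. (\<epsilon> * \<zeta> ^ j, 1, 0)) ` {..<4} :: coords set"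
  let ?v = "\<lambda>P. valuation P z ^ 2"
  have inj: "inj_on (\<lambda>j. (0::complex, \<zeta> ^ j, 1::complex)) {..<4}" "inj_on (\<lambda>j. (\<zeta> ^ j, 0::complex, 1::complex)) {..<4}"
    "inj_on (\<lambda>j. (\<epsilon> * \<zeta> ^ j, 1::complex, 0::complex)) {..<4}"
    subgoal using root_powers_inj unfolding inj_on_def prod.inject by blast
    subgoal using root_powers_inj unfolding inj_on_def prod.inject by blast
    subgoal using root_powers_inj epsilon_nz unfolding inj_on_def prod.inject mult_cancel_left by blast
    done
  have "(0, \<zeta> ^ i, 1) \<noteq> (\<zeta> ^ j, 0, 1 :: complex)" for i j
    using zeta_nz by simp
  then have disj1: "?A \<inter> ?B = {}"
    by blast
  have disj2: "(?A \<union> ?B) \<inter> ?C = {}"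
    by (auto simp only: prod.inject zero_neq_one one_neq_zero)
  have "sum ?v cusps = sum ?v ?A + sum ?v ?B + sum ?v ?C"
    unfolding cusps_def by (simp only: sum.union_disjoint disj1 disj2 finite_Un finite_imageI finite_lessThan simp_thms)
  also have "sum ?v ?A = (\<Sum>j<4. c.mX (inverse \<epsilon> * \<zeta> ^ j) ^ 2)"
    by (simp only: sum.reindex[OF inj(1)] o_def val)
  also have "\<dots> = (\<Sum>w\<in>\<Omega>. c.mX w ^ 2)"
    using epsilon_nz by (intro sum.reindex_bij_betw affine_cusps) simp
  also have "sum ?v ?B = (\<Sum>j<4. c.mY (inverse \<epsilon> * \<zeta> ^ j) ^ 2)"
    by (simp only: sum.reindex[OF inj(2)] o_def val)
  also have "\<dots> = (\<Sum>w\<in>\<Omega>. c.mY w ^ 2)"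
    using epsilon_nz by (intro sum.reindex_bij_betw affine_cusps) simp
  also have "sum ?v ?C = (\<Sum>j<4. c.mZ (\<epsilon> * \<zeta> ^ j) ^ 2)"
    by (simp only: sum.reindex[OF inj(3)] o_def val)
  also have "\<dots> = (\<Sum>w\<in>\<Omega>. c.mZ w ^ 2)"
    using epsilon_nz by (intro sum.reindex_bij_betw infinite_cusps)
  finally have "sum ?v cusps = c.sq_norm"
    by (simp add: c.sq_norm_def)
  moreover have "(\<Sum>P\<in>cusps. divisor z P ^ 2) = real_of_int (sum ?v cusps)"
    by (simp add: divisor_def)
  ultimately show ?thesis
    by (simp add: L2_set_def)
qed

lemma lattice_norms:
  assumes "v \<in> lattice"
  obtains N :: int where "L2_set v cusps = sqrt (real_of_int N)" "4 dvd N" "N \<noteq> 4"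
proof -
  obtain z where z: "z \<in> cusp_units" "v = divisor z"
    using assms unfolding lattice_eq by blast
  interpret c: cuspidal_function emb x y "emb \<epsilon>" z
    using z(1) by (simp add: cusp_units_iff)
  show thesis
    using that L2_set_divisor[OF z(1)] c.sq_norm_mod_4 c.sq_norm_neq_4 z(2) by blast
qed

lemma lattice_attains:
  "\<exists>v\<in>lattice. L2_set v cusps = sqrt 8" "\<exists>v\<in>lattice. L2_set v cusps = sqrt 12"
proof -
  obtain r where r: "r \<in> \<Omega>" using \<Omega>_nonempty by blast
  have attains: "\<exists>v\<in>lattice. L2_set v cusps = sqrt (real_of_int (cuspidal_function.sq_norm emb x y (emb \<epsilon>) z))"
    if "cuspidal_function emb x y (emb \<epsilon>) z" for z
    using that L2_set_divisor[of z] unfolding lattice_eq cusp_units_iff[symmetric] by blast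
  show "\<exists>v\<in>lattice. L2_set v cusps = sqrt 8"
    using attains[OF cuspidal_coordinate] by (simp only: sq_norm_coordinate of_int_numeral)
  show "\<exists>v\<in>lattice. L2_set v cusps = sqrt 12"
    using attains[OF cuspidal_tangent(1)[OF r]] by (simp only: cuspidal_tangent(2)[OF r] of_int_numeral)
qed

lemma lattice_norm_pos:
  assumes "v \<in> lattice" "v \<noteq> (\<lambda>_. 0)"
  shows "L2_set v cusps > 0"
proof -
  have "v P = 0" if "P \<notin> cusps" for P
    using assms(1) that by (auto simp: lattice_eq divisor_def)
  then have "\<exists>P\<in>cusps. v P \<noteq> 0"
    using assms(2) by blast
  then have "L2_set v cusps \<noteq> 0"
    using finite_cusps by (simp add: L2_set_eq_0_iff)
  then show ?thesis
    using L2_set_nonneg[of v cusps] by linarith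
qed

lemma min_distance_lattice: "min_distance cusps lattice = sqrt 8"
  unfolding min_distance_def
proof (rule Least_equality)
  obtain v where v: "v \<in> lattice" "L2_set v cusps = sqrt 8"
    using lattice_attains(1) by blast
  moreover have "v \<noteq> (\<lambda>_. 0)"
    using v(2) by (auto simp: L2_set_def)
  ultimately show "\<exists>v\<in>lattice. v \<noteq> (\<lambda>_. 0) \<and> sqrt 8 = L2_set v cusps"
    by metis
next
  fix s assume "\<exists>v\<in>lattice. v \<noteq> (\<lambda>_. 0) \<and> s = L2_set v cusps"
  then obtain v where v: "v \<in> lattice" "v \<noteq> (\<lambda>_. 0)" "s = L2_set v cusps"
    by blast
  obtain N where N: "L2_set v cusps = sqrt (real_of_int N)" "4 dvd N" "N \<noteq> 4"
    using lattice_norms[OF v(1)] .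
  have "N > 0"
    using lattice_norm_pos[OF v(1,2)] by (simp add: N(1))
  then have "N \<ge> 8"
    using N(2,3) by presburger
  then show "sqrt 8 \<le> s"
    by (simp add: v(3) N(1))
qed

lemma second_min_distance_lattice: "second_min_distance cusps lattice = sqrt 12"
  unfolding second_min_distance_def min_distance_lattice
proof (rule Least_equality)
  show "\<exists>v\<in>lattice. sqrt 12 = L2_set v cusps \<and> sqrt 12 > sqrt 8"
    using lattice_attains(2) by (simp add: eq_commute[of "sqrt 12"])
next
  fix s assume "\<exists>v\<in>lattice. s = L2_set v cusps \<and> s > sqrt 8"
  then obtain v where v: "v \<in> lattice" "s = L2_set v cusps" "s > sqrt 8"
    by blast
  obtain N where N: "L2_set v cusps = sqrt (real_of_int N)" "4 dvd N" "N \<noteq> 4"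
    using lattice_norms[OF v(1)] .
  have "N > 8"
    using v(2,3) by (simp add: N(1))
  then have "N \<ge> 12"
    using N(2) by presburger
  then show "sqrt 12 \<le> s"
    by (simp add: v(2) N(1))
qed

end

theorem theorem3p11:
  fixes emb :: "complex \<Rightarrow> 'f::field"
    and x y :: 'f
    and \<zeta> \<epsilon> :: complex
  assumes "fermat_function_field 4 emb x y \<zeta> \<epsilon>"
  shows "second_min_distance (fermat_function_field.cusps 4 \<zeta> \<epsilon>)
           (fermat_function_field.lattice 4 emb x y \<zeta> \<epsilon>) = sqrt (4 ^ 2 - 4)
         \<and> sqrt (4 ^ 2 - 4) = sqrt 12"
proof -
  interpret fermat_quartic emb x y \<zeta> \<epsilon>
    using assms by (simp add: fermat_quartic_def)
  show ?thesis
    using second_min_distance_lattice by simp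
qed

end
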